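(* For a generic $V \in \ell^\infty(\mathbb{Z})$, the Schr\"odinger operator $H_V$ on $\ell^2(\mathbb{Z})$ has pure point spectrum with exponentially decaying eigenvectors.
   Context: $\ell^\infty(\mathbb{Z})$ denotes the space of bounded real-valued functions $V:\mathbb{Z}\to\mathbb{R}$ (potentials), equipped with the uniform norm $\|\cdot\|_\infty$. For $V \in \ell^\infty(\mathbb{Z})$, $H_V$ is the bounded self-adjoint operator on $\ell^2(\mathbb{Z})$ given by $[H_V\psi](n)=\psi(n+1)+\psi(n-1)+V(n)\psi(n)$. An assertion holds for a generic $V$ if there is a dense $G_\delta$ subset of $\ell^\infty(\mathbb{Z})$ (with respect to $\|\cdot\|_\infty$) such that the assertion is true for all $V$ in this subset. Pure point spectrum means that all spectral measures of $H_V$ are pure point (equivalently, the eigenvectors of $H_V$ span a dense subspace of $\ell^2(\mathbb{Z})$). An eigenvector $\phi$ is exponentially decaying if there are $C,c>0$ (which may depend on $\phi$) with $|\phi(n)|\le Ce^{-c|n|}$ for all $n\in\mathbb{Z}$. *)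

theory Defs
  imports "HOL-Analysis.Analysis"
begin

text \<open>Since \<^typ>\<open>int\<close> carries the discrete topology, the bounded continuous functions on it are
  exactly the bounded functions; the norm of \<^typ>\<open>int \<Rightarrow>\<^sub>C real\<close> is the supremum norm.\<close>

type_synonym potential = "int \<Rightarrow>\<^sub>C real"

lemma bcontfun_int_iff: "(f :: int \<Rightarrow> real) \<in> bcontfun \<longleftrightarrow> bounded (range f)"
  by (simp add: bcontfun_def)

definition generic :: "('a::topological_space \<Rightarrow> bool) \<Rightarrow> bool" where
  "generic P \<longleftrightarrow> (\<exists>G. gdelta G \<and> closure G = UNIV \<and> (\<forall>x\<in>G. P x))"

definition ell2 :: "(int \<Rightarrow> complex) set" where
  "ell2 = {\<psi>. (\<lambda>n. (cmod (\<psi> n))\<^sup>2) summable_on UNIV}"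

text \<open>Only meaningful on \<^const>\<open>ell2\<close>: the sum of a non-summable family is \<open>0\<close>.\<close>

definition ell2_norm :: "(int \<Rightarrow> complex) \<Rightarrow> real" where
  "ell2_norm \<psi> = sqrt (\<Sum>\<^sub>\<infinity>n. (cmod (\<psi> n))\<^sup>2)"

definition schrodinger :: "potential \<Rightarrow> (int \<Rightarrow> complex) \<Rightarrow> (int \<Rightarrow> complex)" where
  "schrodinger V \<psi> = (\<lambda>n. \<psi> (n + 1) + \<psi> (n - 1) + of_real (apply_bcontfun V n) * \<psi> n)"

lemma ell2_add:
  assumes "\<phi> \<in> ell2" "\<psi> \<in> ell2"
  shows "(\<lambda>n. \<phi> n + \<psi> n) \<in> ell2"
proof -
  have le: "(cmod (\<phi> n + \<psi> n))\<^sup>2 \<le> 2 * (cmod (\<phi> n))\<^sup>2 + 2 * (cmod (\<psi> n))\<^sup>2" for n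
  proof -
    have "(cmod (\<phi> n + \<psi> n))\<^sup>2 \<le> (cmod (\<phi> n) + cmod (\<psi> n))\<^sup>2"
      by (intro power_mono norm_triangle_ineq norm_ge_zero)
    also have "\<dots> \<le> 2 * (cmod (\<phi> n))\<^sup>2 + 2 * (cmod (\<psi> n))\<^sup>2"
      using sum_squares_bound[of "cmod (\<phi> n)" "cmod (\<psi> n)"] by (simp add: power2_sum)
    finally show ?thesis .
  qed
  have "(\<lambda>n. 2 * (cmod (\<phi> n))\<^sup>2 + 2 * (cmod (\<psi> n))\<^sup>2) summable_on UNIV"
    using assms by (intro summable_on_add summable_on_cmult_right) (auto simp: ell2_def)
  then show ?thesis
    unfolding ell2_def mem_Collect_eq
    by (rule summable_on_comparison_test) (use le in auto)
qed

lemma ell2_shift: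
  assumes "\<psi> \<in> ell2"
  shows "(\<lambda>n. \<psi> (n + k)) \<in> ell2"
proof -
  have "bij (\<lambda>n::int. n + k)"
    by (rule bij_betw_byWitness[where f' = "\<lambda>n. n - k"]) auto
  from summable_on_reindex_bij_betw[OF this, of "\<lambda>n. (cmod (\<psi> n))\<^sup>2"] assms
  show ?thesis by (simp add: ell2_def)
qed

lemma schrodinger_in_ell2:
  assumes "\<psi> \<in> ell2"
  shows "schrodinger V \<psi> \<in> ell2"
proof -
  have V: "\<bar>apply_bcontfun V n\<bar> \<le> norm V" for n
    using norm_bounded[of V n] by simp
  have "(\<lambda>n. (norm V)\<^sup>2 * (cmod (\<psi> n))\<^sup>2) summable_on UNIV"
    using assms by (intro summable_on_cmult_right) (simp add: ell2_def)
  then have "(\<lambda>n. (cmod (of_real (apply_bcontfun V n) * \<psi> n))\<^sup>2) summable_on UNIV"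
    by (rule summable_on_comparison_test)
       (use V in \<open>auto simp: norm_mult power_mult_distrib simp flip: abs_le_square_iff
          intro!: mult_right_mono\<close>)
  then have "(\<lambda>n. of_real (apply_bcontfun V n) * \<psi> n) \<in> ell2"
    by (simp add: ell2_def)
  from ell2_add[OF ell2_add[OF ell2_shift[OF assms, of 1] ell2_shift[OF assms, of "-1"]] this]
  show ?thesis by (simp add: schrodinger_def)
qed

definition eigenvector :: "potential \<Rightarrow> (int \<Rightarrow> complex) \<Rightarrow> bool" where
  "eigenvector V \<phi> \<longleftrightarrow>
     \<phi> \<in> ell2 \<and> \<phi> \<noteq> (\<lambda>n. 0) \<and> (\<exists>E::complex. schrodinger V \<phi> = (\<lambda>n. E * \<phi> n))"

text \<open>The finite complex-linear combinations of eigenvectors are dense in \<^const>\<open>ell2\<close>. For the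
  bounded self-adjoint operator at hand this is the same as all spectral measures being pure point.\<close>

definition pure_point_spectrum :: "potential \<Rightarrow> bool" where
  "pure_point_spectrum V \<longleftrightarrow>
     (\<forall>\<psi>\<in>ell2. \<forall>\<epsilon>>0. \<exists>F c. finite F \<and> (\<forall>\<phi>\<in>F. eigenvector V \<phi>) \<and>
        ell2_norm (\<lambda>n. \<psi> n - (\<Sum>\<phi>\<in>F. c \<phi> * \<phi> n)) < \<epsilon>)"

definition exponentially_decaying :: "(int \<Rightarrow> complex) \<Rightarrow> bool" where
  "exponentially_decaying \<phi> \<longleftrightarrow>
     (\<exists>C c::real. C > 0 \<and> c > 0 \<and> (\<forall>n. cmod (\<phi> n) \<le> C * exp (- c * \<bar>real_of_int n\<bar>)))"

end

theory Submission
  imports Defs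
begin

text \<open>
  By Baire's theorem it suffices that, for every site \<open>m\<close>, every potential can be perturbed slightly
  so that the unit vector at \<open>m\<close> lies, robustly, near the span of finitely many exponentially decaying
  eigenvectors. Simplicity of eigenvalues (constancy of the Wronskian) and orthogonality then make
  every eigenvector a multiple of one of those.

  For the perturbation take \<open>m = 0\<close>. Averaging over independent two-point perturbations of \<open>V\<close> makes
  an inverse moment of the norm of the transfer matrices decay, uniformly in \<open>V\<close> and in bounded
  energies: each step acts isometrically on \<open>L\<^sup>2\<close> of the projective line, up to an averaging of
  translates that loses mass. Choosing the values not worse than the average block by block, from the
  ends of a large box towards \<open>0\<close>, gives a bound on solutions whose integral over the energy does not
  depend on the box. Rank-one spectral averaging over \<open>V 0\<close> turns it into decay at most of the
  eigenvectors of the box that matter at \<open>0\<close>, and their number does not grow with the box. Outside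
  the box only these finitely many energies count, so the potential can be chosen there to expand
  solutions at all of them simultaneously. This hyperbolicity persists for nearby energies and
  potentials, which traps nearby eigenvectors, and a limit of boxes yields eigenvectors on the line.
\<close>

section \<open>Loss of mass under averaging\<close>

text \<open>The background potential is arbitrary, so no stationarity or ergodic theorem is
  available: growth of solutions must come from the added noise alone. The even functions
  homogeneous of degree -1 on the plane, restricted to the line (x, 1), are the ones on which a
  transfer matrix acts isometrically in L^2(dx), as a translation by E - v and the map x to -1/x; 1
  / norm is one of them.

  The obstacle on a box is that its eigenvalues become more and more numerous, while a block of
  fixed length can be made to expand solutions only at a bounded number of energies. Markov's
  inequality therefore keeps just the eigenvectors carrying nearly all of the spectral measure at 0.
  Each of them has a fixed share of its mass on -1, 0, 1, and the squares of an orthonormal family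
  add up to at most 1 at any site, which bounds their number.

  Robustness rests on orthogonality: extended by zero, these vectors almost solve the eigenvalue
  equation of every nearby potential on every larger box, so eigenvectors with energies elsewhere
  are almost invisible at 0.\<close>

definition l2sq :: "(real \<Rightarrow> real) \<Rightarrow> ennreal" where
  "l2sq f = (\<integral>\<^sup>+x. ennreal ((f x)\<^sup>2) \<partial>lborel)"

definition half_avg :: "real \<Rightarrow> (real \<Rightarrow> real) \<Rightarrow> real \<Rightarrow> real" where
  "half_avg c f = (\<lambda>x. (f x + f (x - c)) / 2)"

text \<open>The action of \<open>step 0\<close> on even functions homogeneous of degree -1, read off
  on the line (x, 1): the vector (-1, x) is x times (-1/x, 1), whence the factor 1 / |x|. This
  factor is also what makes the map an isometry.\<close>

definition inversion :: "(real \<Rightarrow> real) \<Rightarrow> real \<Rightarrow> real" where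
  "inversion f = (\<lambda>x. f (- 1 / x) / \<bar>x\<bar>)"

definition increment :: "real \<Rightarrow> (real \<Rightarrow> real) \<Rightarrow> ennreal" where
  "increment c f = (\<integral>\<^sup>+x. ennreal ((f x - f (x - c))\<^sup>2) \<partial>lborel)"

section \<open>Translations and the inversion as changes of variables\<close>

lemma nn_integral_translate:
  fixes f :: "real \<Rightarrow> ennreal"
  assumes [measurable]: "f \<in> borel_measurable borel"
  shows "(\<integral>\<^sup>+x. f (x - c) \<partial>lborel) = (\<integral>\<^sup>+x. f x \<partial>lborel)"
  using nn_integral_real_affine[of f 1 "-c"] by simp

text \<open>Substitution is applied to an increasing map on a compact interval, so 0 and infinity
  are cut out, and the two half-lines, which x to -1/x exchanges, are handled separately.\<close>

lemma nn_integral_inversion_aux: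
  fixes f :: "real \<Rightarrow> ennreal"
  assumes [measurable]: "f \<in> borel_measurable borel" and n: "1 < n"
  shows "(\<integral>\<^sup>+x. f x * indicator {-n..-1/n} x \<partial>lborel) =
         (\<integral>\<^sup>+x. f (- 1 / x) * ennreal (1 / x\<^sup>2) * indicator {1/n..n} x \<partial>lborel)"
    "(\<integral>\<^sup>+x. f x * indicator {1/n..n} x \<partial>lborel) =
         (\<integral>\<^sup>+x. f (- 1 / x) * ennreal (1 / x\<^sup>2) * indicator {-n..-1/n} x \<partial>lborel)"
proof -
  have n': "1 / n < n" "0 < 1 / n"
    using n by (auto simp: divide_less_eq) (metis less_1_mult less_trans mult_1 n)
  have d: "((\<lambda>x. - 1 / x) has_real_derivative (1 / x\<^sup>2)) (at x)" if "x \<noteq> 0" for x :: real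
    using that by (auto intro!: derivative_eq_intros simp: power2_eq_square)
  have pos: "x \<noteq> 0" if "1/n \<le> x" for x using that n' by auto
  have neg: "x \<noteq> 0" if "x \<le> -1/n" for x using that n' by auto
  have c1: "continuous_on {1/n..n} (\<lambda>x. 1 / x\<^sup>2)" using pos by (intro continuous_intros) auto
  have c2: "continuous_on {-n..-1/n} (\<lambda>x. 1 / x\<^sup>2)" using neg by (intro continuous_intros) auto
  show "(\<integral>\<^sup>+x. f x * indicator {-n..-1/n} x \<partial>lborel) =
         (\<integral>\<^sup>+x. f (- 1 / x) * ennreal (1 / x\<^sup>2) * indicator {1/n..n} x \<partial>lborel)"
    using nn_integral_substitution_aux[of f "1/n" n "\<lambda>x. - 1 / x" "\<lambda>x. 1 / x\<^sup>2"] n n' d pos c1 by auto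
  show "(\<integral>\<^sup>+x. f x * indicator {1/n..n} x \<partial>lborel) =
         (\<integral>\<^sup>+x. f (- 1 / x) * ennreal (1 / x\<^sup>2) * indicator {-n..-1/n} x \<partial>lborel)"
    using nn_integral_substitution_aux[of f "-n" "-1/n" "\<lambda>x. - 1 / x" "\<lambda>x. 1 / x\<^sup>2"] n n' d neg c2 by auto
qed

lemma nn_integral_inversion:
  fixes f :: "real \<Rightarrow> ennreal"
  assumes [measurable]: "f \<in> borel_measurable borel"
  shows "(\<integral>\<^sup>+x. f (- 1 / x) * ennreal (1 / x\<^sup>2) \<partial>lborel) = (\<integral>\<^sup>+x. f x \<partial>lborel)"
proof -
  \<comment> \<open>These sets exhaust the line without 0, and the inversion exchanges the two
    halves of each of them.\<close>
  define A where "A k = {- real (k+2)..-1/real (k+2)} \<union> {1/real (k+2)..real (k+2)}" for k :: nat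
  have [measurable]: "A k \<in> sets borel" for k by (auto simp: A_def)
  have incA: "A i \<subseteq> A j" if "i \<le> j" for i j
  proof -
    have "1 / real (j+2) \<le> 1 / real (i+2)" using that by (intro divide_left_mono) auto
    then show ?thesis using that by (auto simp: A_def)
  qed
  have UA: "\<exists>k. x \<in> A k" if "x \<noteq> 0" for x :: real
  proof -
    obtain k :: nat where k: "real k > max \<bar>x\<bar> (1/\<bar>x\<bar>)" using reals_Archimedean2 by blast
    have "1 / real (k+2) \<le> \<bar>x\<bar>"
    proof -
      have "1/\<bar>x\<bar> \<le> real (k+2)" using k by auto
      then show ?thesis using that by (simp add: field_simps)
    qed
    then have "x \<in> A k" using k by (auto simp: A_def)
    then show ?thesis ..
  qed
  have lim: "(\<integral>\<^sup>+x. g x \<partial>lborel) = (SUP k. \<integral>\<^sup>+x. g x * indicator (A k) x \<partial>lborel)"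
    if [measurable]: "g \<in> borel_measurable borel" for g :: "real \<Rightarrow> ennreal"
  proof -
    have "(SUP k. \<integral>\<^sup>+x. g x * indicator (A k) x \<partial>lborel) = (\<integral>\<^sup>+x. (SUP k. g x * indicator (A k) x) \<partial>lborel)"
      using incA by (intro nn_integral_monotone_convergence_SUP[symmetric])
        (auto simp: incseq_def le_fun_def intro!: mult_left_mono split: split_indicator)
    also have "\<dots> = (\<integral>\<^sup>+x. g x \<partial>lborel)"
    proof (rule nn_integral_cong_AE)
      have "AE x in lborel. x \<noteq> (0::real)" by (rule AE_lborel_singleton)
      then show "AE x in lborel. (SUP k. g x * indicator (A k) x) = g x"
      proof eventually_elim
        case (elim x)
        obtain k where "x \<in> A k" using UA elim by blast
        then have "g x \<le> (SUP k. g x * indicator (A k) x)"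
          by (intro SUP_upper2[of k]) auto
        moreover have "(SUP k. g x * indicator (A k) x) \<le> g x"
          by (intro SUP_least) (auto split: split_indicator)
        ultimately show ?case by (rule antisym[rotated])
      qed
    qed
    finally show ?thesis ..
  qed
  have split: "(\<integral>\<^sup>+x. g x * indicator (A k) x \<partial>lborel) = (\<integral>\<^sup>+x. g x * indicator {- real (k+2)..-1/real (k+2)} x \<partial>lborel)
      + (\<integral>\<^sup>+x. g x * indicator {1/real (k+2)..real (k+2)} x \<partial>lborel)"
    if [measurable]: "g \<in> borel_measurable borel" for g :: "real \<Rightarrow> ennreal" and k
  proof -
    define d where "d = 1/real (k+2)"
    have d: "0 < d" "1/real (k+2) = d" "-1/real (k+2) = -d" by (auto simp: d_def)
    have "indicator (A k) x = (indicator {- real (k+2)..-1/real (k+2)} x + indicator {1/real (k+2)..real (k+2)} x :: ennreal)" for x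
      using d(1) unfolding A_def d(2,3) by (auto split: split_indicator)
    then show ?thesis by (subst nn_integral_add[symmetric]) (auto simp: distrib_left)
  qed
  have "(\<integral>\<^sup>+x. f (- 1 / x) * ennreal (1 / x\<^sup>2) * indicator (A k) x \<partial>lborel) = (\<integral>\<^sup>+x. f x * indicator (A k) x \<partial>lborel)" for k
    using nn_integral_inversion_aux[of f "real (k+2)"] by (subst (1 2) split) (auto simp: add.commute)
  then show ?thesis by (subst (1 2) lim) auto
qed

lemma l2sq_inversion:
  assumes [measurable]: "f \<in> borel_measurable borel"
  shows "l2sq (inversion f) = l2sq f"
proof -
  have "ennreal ((inversion f x)\<^sup>2) = ennreal ((f (- 1 / x))\<^sup>2) * ennreal (1 / x\<^sup>2)" for x
    by (subst ennreal_mult[symmetric]) (auto simp: inversion_def power_divide)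
  then show ?thesis
    using nn_integral_inversion[of "\<lambda>x. ennreal ((f x)\<^sup>2)"] by (simp add: l2sq_def)
qed

lemma l2sq_translate:
  assumes [measurable]: "f \<in> borel_measurable borel"
  shows "l2sq (\<lambda>x. f (x + c)) = l2sq f"
  using nn_integral_translate[of "\<lambda>x. ennreal ((f x)\<^sup>2)" "-c"] by (simp add: l2sq_def)

lemma half_avg_measurable [measurable]:
  "f \<in> borel_measurable borel \<Longrightarrow> half_avg c f \<in> borel_measurable borel"
  unfolding half_avg_def by simp

lemma inversion_measurable [measurable]:
  "f \<in> borel_measurable borel \<Longrightarrow> inversion f \<in> borel_measurable borel"
  unfolding inversion_def by simp

text \<open>The parallelogram identity for \<open>f\<close> and its translate: the loss of mass
  under averaging is exactly a quarter of the increment, so little loss means near invariance under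
  translation.\<close>

lemma l2sq_half_avg:
  assumes [measurable]: "f \<in> borel_measurable borel"
  shows "4 * l2sq f = 4 * l2sq (half_avg c f) + increment c f"
proof -
  have "2 * l2sq f + 2 * l2sq f = (\<integral>\<^sup>+x. 2 * ennreal ((f x)\<^sup>2) + 2 * ennreal ((f (x - c))\<^sup>2) \<partial>lborel)"
    using nn_integral_translate[of "\<lambda>x. ennreal ((f x)\<^sup>2)" c]
    by (simp add: nn_integral_add nn_integral_cmult l2sq_def)
  also have "\<dots> = (\<integral>\<^sup>+x. 4 * ennreal ((half_avg c f x)\<^sup>2) + ennreal ((f x - f (x - c))\<^sup>2) \<partial>lborel)"
  proof (rule nn_integral_cong)
    fix x :: real
    have "2 * ennreal ((f x)\<^sup>2) + 2 * ennreal ((f (x - c))\<^sup>2) = ennreal (2 * (f x)\<^sup>2 + 2 * (f (x - c))\<^sup>2)"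
      by (simp add: ennreal_mult' flip: ennreal_numeral)
    also have "2 * (f x)\<^sup>2 + 2 * (f (x - c))\<^sup>2 = 4 * (half_avg c f x)\<^sup>2 + (f x - f (x - c))\<^sup>2"
      by (simp add: half_avg_def power2_eq_square field_simps)
    also have "ennreal \<dots> = 4 * ennreal ((half_avg c f x)\<^sup>2) + ennreal ((f x - f (x - c))\<^sup>2)"
      by (simp add: ennreal_mult' flip: ennreal_numeral)
    finally show "2 * ennreal ((f x)\<^sup>2) + 2 * ennreal ((f (x - c))\<^sup>2) = 4 * ennreal ((half_avg c f x)\<^sup>2) + ennreal ((f x - f (x - c))\<^sup>2)" .
  qed
  also have "\<dots> = 4 * l2sq (half_avg c f) + increment c f"
    by (simp add: nn_integral_add nn_integral_cmult l2sq_def increment_def)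
  finally show ?thesis by (simp flip: distrib_right)
qed

text \<open>Telescoping into \<open>j\<close> increments of equal mass; Cauchy-Schwarz accounts for
  the square of \<open>j\<close>.\<close>

lemma increment_multiple:
  assumes [measurable]: "f \<in> borel_measurable borel"
  shows "increment (real j * c) f \<le> of_nat (j ^ 2) * increment c f"
proof -
  have "increment (real j * c) f \<le> (\<integral>\<^sup>+x. of_nat j * (\<Sum>i<j. ennreal ((f (x - real i * c) - f (x - real i * c - c))\<^sup>2)) \<partial>lborel)"
    unfolding increment_def
  proof (rule nn_integral_mono)
    fix x :: real
    have "f x - f (x - real j * c) = (\<Sum>i<j. f (x - real i * c) - f (x - real (Suc i) * c))"
      using sum_lessThan_telescope'[of "\<lambda>i. f (x - real i * c)" j] by simp
    then have "(f x - f (x - real j * c))\<^sup>2 \<le> (\<Sum>i<j. (f (x - real i * c) - f (x - real (Suc i) * c))\<^sup>2) * real j"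
      using sum_squared_le_sum_of_squares[of "\<lambda>i. f (x - real i * c) - f (x - real (Suc i) * c)" "{..<j}"] by simp
    then have "ennreal ((f x - f (x - real j * c))\<^sup>2) \<le> ennreal (real j * (\<Sum>i<j. (f (x - real i * c) - f (x - real i * c - c))\<^sup>2))"
      by (intro ennreal_leI) (simp add: algebra_simps)
    also have "\<dots> = of_nat j * (\<Sum>i<j. ennreal ((f (x - real i * c) - f (x - real i * c - c))\<^sup>2))"
      by (simp add: ennreal_mult' sum_ennreal ennreal_of_nat_eq_real_of_nat sum_nonneg)
    finally show "ennreal ((f x - f (x - real j * c))\<^sup>2) \<le> \<dots>" .
  qed
  also have "\<dots> = of_nat j * (\<Sum>i<j. (\<integral>\<^sup>+x. ennreal ((f (x - real i * c) - f (x - real i * c - c))\<^sup>2) \<partial>lborel))"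
    by (subst nn_integral_cmult) (auto intro!: borel_measurable_sum simp: nn_integral_sum simp del: sum_ennreal)
  also have "\<dots> = of_nat j * (\<Sum>i<j. increment c f)"
  proof -
    have "(\<integral>\<^sup>+x. ennreal ((f (x - real i * c) - f (x - real i * c - c))\<^sup>2) \<partial>lborel) = increment c f" for i
      using nn_integral_translate[of "\<lambda>x. ennreal ((f x - f (x - c))\<^sup>2)" "real i * c"] by (simp add: increment_def)
    then show ?thesis by simp
  qed
  also have "\<dots> = of_nat (j ^ 2) * increment c f"
    by (simp add: power2_eq_square mult.assoc)
  finally show ?thesis .
qed

text \<open>The translates of \<open>{a..<a+4}\<close> by multiples of \<open>m * c\<close> are disjoint; if \<open>f\<close> is nearly invariant
  under translation by \<open>c\<close>, then they all carry about the same mass, which is therefore small.\<close>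

lemma l2_mass_interval:
  assumes [measurable]: "f \<in> borel_measurable borel" and m: "real m * c \<ge> 4"
  shows "of_nat n * (\<integral>\<^sup>+x. ennreal ((f x)\<^sup>2) * indicator {a..<a+4} x \<partial>lborel)
    \<le> 2 * l2sq f + 2 * of_nat (n * (n * m)\<^sup>2) * increment c f"
proof -
  let ?J = "indicator {a..<a+4} :: real \<Rightarrow> ennreal"
  define s where "s i = real (i * m) * c" for i :: nat
  have one: "(\<integral>\<^sup>+x. ennreal ((f x)\<^sup>2) * ?J x \<partial>lborel)
     \<le> 2 * (\<integral>\<^sup>+x. ennreal ((f x)\<^sup>2) * ?J (x + s i) \<partial>lborel) + 2 * of_nat ((n*m)\<^sup>2) * increment c f" if "i < n" for i
  proof -
    have "(\<integral>\<^sup>+x. ennreal ((f x)\<^sup>2) * ?J x \<partial>lborel)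
       \<le> (\<integral>\<^sup>+x. 2 * (ennreal ((f (x - s i))\<^sup>2) * ?J x) + 2 * ennreal ((f x - f (x - s i))\<^sup>2) \<partial>lborel)"
    proof (rule nn_integral_mono)
      fix x
      have "(f x)\<^sup>2 \<le> 2 * (f (x - s i))\<^sup>2 + 2 * (f x - f (x - s i))\<^sup>2"
        using zero_le_power2[of "2 * f (x - s i) - f x"] by (simp add: power2_eq_square algebra_simps)
      then have "ennreal ((f x)\<^sup>2) \<le> 2 * ennreal ((f (x - s i))\<^sup>2) + 2 * ennreal ((f x - f (x - s i))\<^sup>2)"
        by (simp add: ennreal_mult'[symmetric] ennreal_leI flip: ennreal_numeral ennreal_plus)
      then show "ennreal ((f x)\<^sup>2) * ?J x \<le> 2 * (ennreal ((f (x - s i))\<^sup>2) * ?J x) + 2 * ennreal ((f x - f (x - s i))\<^sup>2)"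
        by (auto split: split_indicator)
    qed
    also have "\<dots> = 2 * (\<integral>\<^sup>+x. ennreal ((f (x - s i))\<^sup>2) * ?J x \<partial>lborel) + 2 * increment (s i) f"
      by (simp add: nn_integral_add nn_integral_cmult increment_def)
    also have "(\<integral>\<^sup>+x. ennreal ((f (x - s i))\<^sup>2) * ?J x \<partial>lborel) = (\<integral>\<^sup>+x. ennreal ((f x)\<^sup>2) * ?J (x + s i) \<partial>lborel)"
      using nn_integral_translate[of "\<lambda>x. ennreal ((f x)\<^sup>2) * ?J (x + s i)" "s i"] by simp
    also have "increment (s i) f \<le> of_nat ((n*m)\<^sup>2) * increment c f"
    proof -
      have "increment (s i) f \<le> of_nat ((i*m)\<^sup>2) * increment c f"
        unfolding s_def by (rule increment_multiple) simp
      also have "\<dots> \<le> of_nat ((n*m)\<^sup>2) * increment c f"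
        using that by (intro mult_right_mono of_nat_mono power_mono) auto
      finally show ?thesis .
    qed
    finally show ?thesis by (simp add: mult.assoc add_left_mono mult_left_mono)
  qed
  have "of_nat n * (\<integral>\<^sup>+x. ennreal ((f x)\<^sup>2) * ?J x \<partial>lborel) = (\<Sum>i<n. (\<integral>\<^sup>+x. ennreal ((f x)\<^sup>2) * ?J x \<partial>lborel))"
    by simp
  also have "\<dots> \<le> (\<Sum>i<n. 2 * (\<integral>\<^sup>+x. ennreal ((f x)\<^sup>2) * ?J (x + s i) \<partial>lborel) + 2 * of_nat ((n*m)\<^sup>2) * increment c f)"
    by (intro sum_mono one) auto
  also have "\<dots> = 2 * (\<integral>\<^sup>+x. (\<Sum>i<n. ennreal ((f x)\<^sup>2) * ?J (x + s i)) \<partial>lborel) + of_nat n * (2 * of_nat ((n*m)\<^sup>2) * increment c f)"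
    by (subst nn_integral_sum) (auto simp: sum.distrib sum_distrib_left)
  finally have split: "of_nat n * (\<integral>\<^sup>+x. ennreal ((f x)\<^sup>2) * ?J x \<partial>lborel)
    \<le> 2 * (\<integral>\<^sup>+x. (\<Sum>i<n. ennreal ((f x)\<^sup>2) * ?J (x + s i)) \<partial>lborel) + of_nat n * (2 * of_nat ((n*m)\<^sup>2) * increment c f)" .
  have "(\<integral>\<^sup>+x. (\<Sum>i<n. ennreal ((f x)\<^sup>2) * ?J (x + s i)) \<partial>lborel) \<le> l2sq f"
    unfolding l2sq_def
  proof (rule nn_integral_mono)
    fix x
    have "(\<Sum>i<n. ?J (x + s i)) \<le> 1"
    proof (cases "\<exists>i<n. x + s i \<in> {a..<a+4}")
      case True
      then obtain i where i: "i < n" "x + s i \<in> {a..<a+4}" by blast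
      have "?J (x + s j) = (if j = i then 1 else 0)" for j
      proof (cases "j = i")
        case False
        have "\<bar>s i - s j\<bar> = \<bar>real i - real j\<bar> * (real m * c)"
        proof -
          have "s i - s j = (real i - real j) * (real m * c)" by (simp add: s_def algebra_simps)
          moreover have "\<bar>real m * c\<bar> = real m * c" using m by linarith
          ultimately show ?thesis by (metis abs_mult)
        qed
        also have "\<dots> \<ge> 1 * 4" using m False by (intro mult_mono) auto
        finally show ?thesis using i False by (auto split: split_indicator)
      qed (use i in auto)
      then show ?thesis using i by simp
    qed (auto split: split_indicator)
    then have "ennreal ((f x)\<^sup>2) * (\<Sum>i<n. ?J (x + s i)) \<le> ennreal ((f x)\<^sup>2) * 1"
      by (rule mult_left_mono) simp
    then show "(\<Sum>i<n. ennreal ((f x)\<^sup>2) * ?J (x + s i)) \<le> ennreal ((f x)\<^sup>2)"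
      by (simp add: sum_distrib_left)
  qed
  then have "2 * (\<integral>\<^sup>+x. (\<Sum>i<n. ennreal ((f x)\<^sup>2) * ?J (x + s i)) \<partial>lborel) + of_nat n * (2 * of_nat ((n*m)\<^sup>2) * increment c f)
     \<le> 2 * l2sq f + of_nat n * (2 * of_nat ((n*m)\<^sup>2) * increment c f)"
    by (intro add_right_mono mult_left_mono) auto
  with split have "of_nat n * (\<integral>\<^sup>+x. ennreal ((f x)\<^sup>2) * ?J x \<partial>lborel)
    \<le> 2 * l2sq f + of_nat n * (2 * of_nat ((n*m)\<^sup>2) * increment c f)"
    by (rule order_trans)
  then show ?thesis by (simp only: of_nat_mult mult_ac)
qed

text \<open>Convexity of the square. The last term is the mass of \<open>f\<close> on
  \<open>S\<close> shifted back by \<open>c\<close>.\<close>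

lemma half_avg_mass:
  assumes [measurable]: "f \<in> borel_measurable borel" "S \<in> sets borel"
  shows "2 * (\<integral>\<^sup>+x. ennreal ((half_avg c f x)\<^sup>2) * indicator S x \<partial>lborel)
    \<le> (\<integral>\<^sup>+x. ennreal ((f x)\<^sup>2) * indicator S x \<partial>lborel)
      + (\<integral>\<^sup>+x. ennreal ((f x)\<^sup>2) * indicator S (x + c) \<partial>lborel)"
proof -
  have "2 * (\<integral>\<^sup>+x. ennreal ((half_avg c f x)\<^sup>2) * indicator S x \<partial>lborel)
    = (\<integral>\<^sup>+x. 2 * (ennreal ((half_avg c f x)\<^sup>2) * indicator S x) \<partial>lborel)"
    by (simp add: nn_integral_cmult)
  also have "\<dots> \<le> (\<integral>\<^sup>+x. ennreal ((f x)\<^sup>2) * indicator S x + ennreal ((f (x - c))\<^sup>2) * indicator S x \<partial>lborel)"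
  proof (rule nn_integral_mono)
    fix x
    have "2 * (half_avg c f x)\<^sup>2 \<le> (f x)\<^sup>2 + (f (x - c))\<^sup>2"
      using zero_le_power2[of "f x - f (x - c)"] by (simp add: half_avg_def power2_eq_square field_simps)
    then have "2 * ennreal ((half_avg c f x)\<^sup>2) \<le> ennreal ((f x)\<^sup>2) + ennreal ((f (x - c))\<^sup>2)"
      by (simp add: ennreal_mult'[symmetric] ennreal_leI flip: ennreal_numeral ennreal_plus)
    then show "2 * (ennreal ((half_avg c f x)\<^sup>2) * indicator S x)
       \<le> ennreal ((f x)\<^sup>2) * indicator S x + ennreal ((f (x - c))\<^sup>2) * indicator S x"
      by (auto split: split_indicator)
  qed
  also have "\<dots> = (\<integral>\<^sup>+x. ennreal ((f x)\<^sup>2) * indicator S x \<partial>lborel)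
      + (\<integral>\<^sup>+x. ennreal ((f x)\<^sup>2) * indicator S (x + c) \<partial>lborel)"
    using nn_integral_translate[of "\<lambda>x. ennreal ((f x)\<^sup>2) * indicator S (x + c)" c]
    by (simp add: nn_integral_add)
  finally show ?thesis .
qed

text \<open>The inversion exchanges the mass near \<open>0\<close> and the mass near infinity, so a function and its
  inversion cannot both be spread out: two averaging steps must lose a fixed proportion of the mass.\<close>

lemma two_step_contraction:
  fixes c :: real
  assumes c: "0 < c" "c \<le> 1"
  obtains \<kappa> where "0 \<le> \<kappa>" "\<kappa> < 1"
    "\<And>f d. f \<in> borel_measurable borel \<Longrightarrow>
      l2sq (half_avg c (inversion (\<lambda>x. half_avg c f (x + d)))) \<le> ennreal \<kappa> * l2sq f"
proof -
  obtain m :: nat where m: "real m > 4 / c" using reals_Archimedean2 by blast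
  then have m: "real m * c \<ge> 4" using c by (simp add: field_simps)
  \<comment> \<open>With 8 translates per interval, the four interval masses entering
    \<open>total\<close> give 16 nk \<le> 8 nf + 16 K (nf - nk) for the masses nf of
    \<open>f\<close> and nk of \<open>k\<close>; solving for nk yields \<open>\<kappa>\<close>.
    Neither constant depends on the shift \<open>d\<close>.\<close>
  define K :: nat where "K = 8 * (8 * m)\<^sup>2"
  define \<kappa> where "\<kappa> = (4 + 8 * real K) / (8 + 8 * real K)"
  have \<kappa>: "0 \<le> \<kappa>" "\<kappa> < 1" by (auto simp: \<kappa>_def field_simps)
  have "l2sq (half_avg c (inversion (\<lambda>x. half_avg c f (x + d)))) \<le> ennreal \<kappa> * l2sq f"
    if [measurable]: "f \<in> borel_measurable borel" for f d
  proof (cases "l2sq f = \<infinity>")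
    case True
    have "\<kappa> > 0" by (simp add: \<kappa>_def field_simps)
    with True show ?thesis by (simp add: ennreal_mult_top)
  next
    case False
    define g where "g = half_avg c f"
    define h where "h = inversion (\<lambda>x. g (x + d))"
    define k where "k = half_avg c h"
    have [measurable]: "g \<in> borel_measurable borel" "h \<in> borel_measurable borel" "k \<in> borel_measurable borel"
      unfolding g_def h_def k_def by (auto intro!: half_avg_measurable inversion_measurable)
    have gh: "l2sq h = l2sq g"
      unfolding h_def by (simp add: l2sq_inversion l2sq_translate)
    have e1: "4 * l2sq f = 4 * l2sq h + increment c f"
      using l2sq_half_avg[of f c] gh by (simp add: g_def)
    have e2: "4 * l2sq h = 4 * l2sq k + increment c h"
      using l2sq_half_avg[of h c] by (simp add: k_def)
    define If where "If a = (\<integral>\<^sup>+x. ennreal ((f x)\<^sup>2) * indicator {a..<a+4} x \<partial>lborel)" for a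
    define Ih where "Ih a = (\<integral>\<^sup>+x. ennreal ((h x)\<^sup>2) * indicator {a..<a+4} x \<partial>lborel)" for a
    have If: "8 * If a \<le> 2 * l2sq f + 2 * of_nat K * increment c f" for a
      using l2_mass_interval[of f m c 8 a] m by (simp add: If_def K_def)
    have Ih: "8 * Ih a \<le> 2 * l2sq h + 2 * of_nat K * increment c h" for a
      using l2_mass_interval[of h m c 8 a] m by (simp add: Ih_def K_def)
    define far where "far = (\<integral>\<^sup>+x. ennreal ((h x)\<^sup>2) * indicator {x. \<bar>x\<bar> \<ge> 1} x \<partial>lborel)"
    define g_near where "g_near = (\<integral>\<^sup>+x. ennreal ((g x)\<^sup>2) * indicator {d-1..<(d-1)+4} x \<partial>lborel)"
    have far: "far \<le> g_near"
    proof -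
      have "far = (\<integral>\<^sup>+x. (\<lambda>y. ennreal ((g (y + d))\<^sup>2) * indicator {-1..1} y) (- 1 / x) * ennreal (1 / x\<^sup>2) \<partial>lborel)"
        unfolding far_def
      proof (rule nn_integral_cong)
        fix x :: real
        have "x = 0 \<or> (\<bar>x\<bar> \<ge> 1 \<longleftrightarrow> - 1 / x \<in> {-1..1})"
          by (cases x "0::real" rule: linorder_cases) (auto simp: field_simps)
        then show "ennreal ((h x)\<^sup>2) * indicator {x. 1 \<le> \<bar>x\<bar>} x
          = (\<lambda>y. ennreal ((g (y + d))\<^sup>2) * indicator {-1..1} y) (- 1 / x) * ennreal (1 / x\<^sup>2)"
          by (auto simp: h_def inversion_def power_divide ennreal_mult'[symmetric] split: split_indicator)
      qed
      also have "\<dots> = (\<integral>\<^sup>+y. ennreal ((g (y + d))\<^sup>2) * indicator {-1..1} y \<partial>lborel)"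
        by (rule nn_integral_inversion) simp
      also have "\<dots> = (\<integral>\<^sup>+y. ennreal ((g y)\<^sup>2) * indicator {-1..1} (y - d) \<partial>lborel)"
        using nn_integral_translate[of "\<lambda>y. ennreal ((g (y + d))\<^sup>2) * indicator {-1..1} y" d] by simp
      also have "\<dots> \<le> g_near"
        unfolding g_near_def by (rule nn_integral_mono) (auto split: split_indicator)
      finally show ?thesis .
    qed
    have near: "2 * g_near \<le> If (d - 1) + If (d - 1 - c)"
    proof -
      have "2 * g_near \<le> If (d - 1) + (\<integral>\<^sup>+x. ennreal ((f x)\<^sup>2) * indicator {d-1..<(d-1)+4} (x + c) \<partial>lborel)"
        using half_avg_mass[of f "{d-1..<(d-1)+4}" c] by (simp add: g_near_def If_def g_def)
      also have "(\<lambda>x. indicator {d-1..<(d-1)+4} (x + c)) = (indicator {d-1-c..<(d-1-c)+4} :: real \<Rightarrow> ennreal)"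
        by (auto simp: fun_eq_iff split: split_indicator)
      finally show ?thesis by (simp add: If_def)
    qed
    have kin: "2 * (\<integral>\<^sup>+x. ennreal ((k x)\<^sup>2) * indicator {-2..<-2+4} x \<partial>lborel) \<le> Ih (-2) + Ih (-2-c)"
    proof -
      have "2 * (\<integral>\<^sup>+x. ennreal ((k x)\<^sup>2) * indicator {-2..<-2+4} x \<partial>lborel)
         \<le> Ih (-2) + (\<integral>\<^sup>+x. ennreal ((h x)\<^sup>2) * indicator {-2..<-2+4} (x + c) \<partial>lborel)"
        using half_avg_mass[of h "{-2..<-2+4}" c] by (simp add: k_def Ih_def)
      also have "(\<lambda>x. indicator {-2..<-2+4} (x + c)) = (indicator {-2-c..<(-2-c)+4} :: real \<Rightarrow> ennreal)"
        by (auto simp: fun_eq_iff split: split_indicator)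
      finally show ?thesis by (simp add: Ih_def)
    qed
    \<comment> \<open>As c \<le> 1, the average at a point outside [-2, 2) uses \<open>h\<close>
      only at arguments of modulus at least 1.\<close>
    have kout: "2 * (\<integral>\<^sup>+x. ennreal ((k x)\<^sup>2) * indicator (- {-2..<-2+4}) x \<partial>lborel) \<le> 2 * far"
    proof -
      have "2 * (\<integral>\<^sup>+x. ennreal ((k x)\<^sup>2) * indicator (- {-2..<-2+4}) x \<partial>lborel)
         \<le> (\<integral>\<^sup>+x. ennreal ((h x)\<^sup>2) * indicator (- {-2..<-2+4}) x \<partial>lborel)
         + (\<integral>\<^sup>+x. ennreal ((h x)\<^sup>2) * indicator (- {-2..<-2+4}) (x + c) \<partial>lborel)"
        using half_avg_mass[of h "- {-2..<-2+4}" c] by (simp add: k_def)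
      also have "\<dots> \<le> far + far"
        unfolding far_def using c by (intro add_mono nn_integral_mono) (auto split: split_indicator)
      finally show ?thesis by (simp flip: mult_2)
    qed
    have ksplit: "l2sq k = (\<integral>\<^sup>+x. ennreal ((k x)\<^sup>2) * indicator {-2..<-2+4} x \<partial>lborel)
       + (\<integral>\<^sup>+x. ennreal ((k x)\<^sup>2) * indicator (- {-2..<-2+4}) x \<partial>lborel)"
      unfolding l2sq_def
      by (subst nn_integral_add[symmetric]) (auto intro!: nn_integral_cong split: split_indicator)
    have total: "2 * l2sq k \<le> (Ih (-2) + Ih (-2-c)) + (If (d - 1) + If (d - 1 - c))"
    proof -
      have "2 * far \<le> If (d - 1) + If (d - 1 - c)"
        using far near by (meson mult_left_mono order_trans zero_le)
      with kout have "2 * (\<integral>\<^sup>+x. ennreal ((k x)\<^sup>2) * indicator (- {-2..<-2+4}) x \<partial>lborel) \<le> If (d - 1) + If (d - 1 - c)"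
        by (rule order_trans)
      with kin show ?thesis unfolding ksplit distrib_left by (rule add_mono)
    qed
    have "16 * l2sq k = 8 * (2 * l2sq k)" by (simp add: mult.assoc[symmetric])
    also have "\<dots> \<le> 8 * ((Ih (-2) + Ih (-2-c)) + (If (d - 1) + If (d - 1 - c)))"
      by (rule mult_left_mono[OF total]) simp
    also have "\<dots> = (8 * Ih (-2) + 8 * Ih (-2-c)) + (8 * If (d - 1) + 8 * If (d - 1 - c))"
      by (simp add: distrib_left)
    also have "\<dots> \<le> ((2 * l2sq h + 2 * of_nat K * increment c h) + (2 * l2sq h + 2 * of_nat K * increment c h))
       + ((2 * l2sq f + 2 * of_nat K * increment c f) + (2 * l2sq f + 2 * of_nat K * increment c f))"
      by (intro add_mono If Ih)
    finally have main: "16 * l2sq k \<le> \<dots>" .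
    obtain nf where nf: "l2sq f = ennreal nf" "nf \<ge> 0" using False by (cases "l2sq f") auto
    have "4 * l2sq f \<noteq> \<infinity>" using nf by (simp add: ennreal_mult_eq_top_iff)
    then have fin: "l2sq h \<noteq> \<infinity>" "increment c f \<noteq> \<infinity>" unfolding e1 by (auto simp: ennreal_mult_eq_top_iff)
    obtain nh where nh: "l2sq h = ennreal nh" "nh \<ge> 0" using fin by (cases "l2sq h") auto
    obtain df where df: "increment c f = ennreal df" "df \<ge> 0" using fin by (cases "increment c f") auto
    have "4 * l2sq h \<noteq> \<infinity>" using nh by (simp add: ennreal_mult_eq_top_iff)
    then have fin: "l2sq k \<noteq> \<infinity>" "increment c h \<noteq> \<infinity>" unfolding e2 by (auto simp: ennreal_mult_eq_top_iff)
    obtain nk where nk: "l2sq k = ennreal nk" "nk \<ge> 0" using fin by (cases "l2sq k") auto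
    obtain dh where dh: "increment c h = ennreal dh" "dh \<ge> 0" using fin by (cases "increment c h") auto
    note conv = ennreal_mult'[symmetric] ennreal_of_nat_eq_real_of_nat
    have r1: "4 * nf = 4 * nh + df"
      using e1 nf nh df by (simp add: conv flip: ennreal_numeral ennreal_plus)
    have r2: "4 * nh = 4 * nk + dh"
      using e2 nk nh dh by (simp add: conv flip: ennreal_numeral ennreal_plus)
    have "16 * nk \<le> ((2 * nh + 2 * real K * dh) + (2 * nh + 2 * real K * dh))
       + ((2 * nf + 2 * real K * df) + (2 * nf + 2 * real K * df))"
      using main nf nh nk df dh by (simp add: conv flip: ennreal_numeral ennreal_plus)
    then have "16 * nk \<le> 4 * nh + 4 * nf + 4 * real K * (df + dh)"
      by (simp add: algebra_simps)
    \<comment> \<open>The two increments add up to four times the total loss, the quantity to be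
      bounded below; this closes the estimate.\<close>
    also have "df + dh = 4 * nf - 4 * nk" using r1 r2 by simp
    finally have "16 * nk \<le> 8 * nf + 16 * real K * nf - 16 * real K * nk"
      using r1 df by (simp add: algebra_simps)
    then have "nk \<le> \<kappa> * nf" by (simp add: \<kappa>_def field_simps)
    then show ?thesis
      using nf nk by (simp add: conv g_def h_def k_def \<kappa>)
  qed
  then show thesis using that \<kappa> by blast
qed

section \<open>Averaged growth of transfer matrices\<close>

text \<open>The vector holds the values of a solution at n and n - 1, and \<open>e\<close> stands
  for E - V n.\<close>

definition step :: "real \<Rightarrow> real \<times> real \<Rightarrow> real \<times> real" where
  "step e y = (e * fst y - snd y, fst y)"

definition transfer :: "real \<Rightarrow> real list \<Rightarrow> real \<times> real \<Rightarrow> real \<times> real" where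
  "transfer E vs y = fold (\<lambda>v. step (E - v)) vs y"

text \<open>An expectation over independent fair two-point noise. The recursion exposes the
  conditional expectations that the later selection compares entry by entry.\<close>

primrec two_point_avg :: "real \<Rightarrow> (real \<times> real \<Rightarrow> real) \<Rightarrow> real \<Rightarrow> real list \<Rightarrow> real \<times> real \<Rightarrow> real" where
  "two_point_avg c g E [] y = g y"
| "two_point_avg c g E (v # vs) y =
     (two_point_avg c g E vs (step (E - v) y) + two_point_avg c g E vs (step (E - v - c) y)) / 2"

definition uniform_avg :: "real \<Rightarrow> real \<Rightarrow> (real \<times> real \<Rightarrow> real) \<Rightarrow> real \<times> real \<Rightarrow> real" where
  "uniform_avg c e g y = integral {0..c} (\<lambda>w. g (step (e - w) y)) / c"

definition inv_norm :: "real \<times> real \<Rightarrow> real" where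
  "inv_norm y = 1 / norm y"

text \<open>The square root is taken because 1 / sqrt |x| is locally integrable on the line and 1 /
  |x| is not.\<close>

definition inv_sqrt_norm :: "real \<times> real \<Rightarrow> real" where
  "inv_sqrt_norm y = 1 / sqrt (norm y)"

text \<open>Two-point noise controls only a mean square over initial directions. The inner uniform
  average spreads a direction over an interval of projective coordinates, which turns the mean
  square into a bound singular at vectors with first component 0; the outer one integrates this
  singularity, so that every initial vector is covered.\<close>

definition block_avg :: "real \<Rightarrow> real \<Rightarrow> real list \<Rightarrow> real \<times> real \<Rightarrow> real" where
  "block_avg c E vs = uniform_avg c (E - vs ! 0) (uniform_avg c (E - vs ! 1)
     (two_point_avg c inv_sqrt_norm E (drop 2 vs)))"

lemma step_eq_0_iff [simp]: "step e y = 0 \<longleftrightarrow> y = 0"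
  by (auto simp: step_def prod_eq_iff)

lemma transfer_Nil [simp]: "transfer E [] y = y"
  and transfer_Cons: "transfer E (v # vs) y = transfer E vs (step (E - v) y)"
  and transfer_append: "transfer E (vs @ ws) y = transfer E ws (transfer E vs y)"
  by (simp_all add: transfer_def)

lemma transfer_eq_0_iff [simp]: "transfer E vs y = 0 \<longleftrightarrow> y = 0"
  by (induction vs arbitrary: y) (auto simp: transfer_Cons)

lemma step_scaleR: "step e (r *\<^sub>R y) = r *\<^sub>R step e y"
  by (simp add: step_def algebra_simps)

section \<open>Continuity of the averages in energy and initial vector\<close>

lemma continuous_on_step [continuous_intros]:
  "continuous_on A e \<Longrightarrow> continuous_on A y \<Longrightarrow> continuous_on A (\<lambda>x. step (e x) (y x))"
  unfolding step_def by (intro continuous_intros)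

lemma continuous_on_transfer [continuous_intros]:
  "continuous_on A e \<Longrightarrow> continuous_on A y \<Longrightarrow> continuous_on A (\<lambda>x. transfer (e x) vs (y x))"
  by (induction vs arbitrary: y) (simp_all add: transfer_Cons continuous_on_step continuous_intros)

lemma continuous_on_two_point_avg:
  assumes g: "continuous_on (- {0}) g"
  shows "continuous_on A e \<Longrightarrow> continuous_on A y \<Longrightarrow> (\<And>x. x \<in> A \<Longrightarrow> y x \<noteq> 0) \<Longrightarrow>
    continuous_on A (\<lambda>x. two_point_avg c g (e x) vs (y x))"
proof (induction vs arbitrary: y)
  case Nil
  then show ?case by (auto intro!: continuous_on_compose2[OF g])
next
  case (Cons v vs)
  then show ?case unfolding two_point_avg.simps by (intro continuous_intros Cons.IH) auto
qed

lemma continuous_on_uniform_avg: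
  assumes "continuous_on (A \<times> {0..c}) (\<lambda>(x, w). G x (step (e x - w) (y x)))"
  shows "continuous_on A (\<lambda>x. uniform_avg c (e x) (G x) (y x))"
  using integral_continuous_on_param[of A 0 c "\<lambda>x w. G x (step (e x - w) (y x))"] assms
  unfolding uniform_avg_def by (cases "c = 0") (auto intro!: continuous_intros)

lemma continuous_on_inv_norm: "continuous_on (- {0}) inv_norm"
  unfolding inv_norm_def by (auto intro!: continuous_intros)

lemma continuous_on_inv_sqrt_norm: "continuous_on (- {0}) inv_sqrt_norm"
  unfolding inv_sqrt_norm_def by (auto intro!: continuous_intros)

lemma continuous_on_fst_comp:
  "continuous_on A f \<Longrightarrow> continuous_on (A \<times> B) (\<lambda>x. f (fst x))"
  by (rule continuous_on_compose2[of A f]) (auto intro!: continuous_intros)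

lemma continuous_on_uniform_avg_two_point_avg:
  assumes "continuous_on A e" "continuous_on A y" "\<And>x. x \<in> A \<Longrightarrow> y x \<noteq> 0"
  shows "continuous_on A (\<lambda>x. uniform_avg c (e x - v) (two_point_avg c inv_sqrt_norm (e x) vs) (y x))"
proof (rule continuous_on_uniform_avg)
  have "continuous_on (A \<times> {0..c}) (\<lambda>x. two_point_avg c inv_sqrt_norm (e (fst x)) vs (step (e (fst x) - v - snd x) (y (fst x))))"
    using assms(3) by (intro continuous_on_two_point_avg continuous_on_inv_sqrt_norm continuous_intros
      continuous_on_fst_comp assms(1,2)) auto
  then show "continuous_on (A \<times> {0..c}) (\<lambda>(x, w). two_point_avg c inv_sqrt_norm (e x) vs (step (e x - v - w) (y x)))"
    by (simp add: case_prod_unfold)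
qed

lemma continuous_on_block_avg:
  assumes "continuous_on A e" "continuous_on A y" "\<And>x. x \<in> A \<Longrightarrow> y x \<noteq> 0"
  shows "continuous_on A (\<lambda>x. block_avg c (e x) vs (y x))"
  unfolding block_avg_def
proof (rule continuous_on_uniform_avg)
  have "continuous_on (A \<times> {0..c}) (\<lambda>x. uniform_avg c (e (fst x) - vs ! 1)
      (two_point_avg c inv_sqrt_norm (e (fst x)) (drop 2 vs)) (step (e (fst x) - vs ! 0 - snd x) (y (fst x))))"
    using assms(3) by (intro continuous_on_uniform_avg_two_point_avg continuous_intros
      continuous_on_fst_comp assms(1,2)) auto
  then show "continuous_on (A \<times> {0..c}) (\<lambda>(x, w). uniform_avg c (e x - vs ! 1)
      (two_point_avg c inv_sqrt_norm (e x) (drop 2 vs)) (step (e x - vs ! 0 - w) (y x)))"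
    by (simp add: case_prod_unfold)
qed

lemma two_point_avg_nonneg: "(\<And>y. 0 \<le> g y) \<Longrightarrow> 0 \<le> two_point_avg c g E vs y"
  by (induction vs arbitrary: y) auto

text \<open>Homogeneity of degree -1, by which values at vectors with nonzero second component are
  read off from the line (x, 1).\<close>

lemma two_point_avg_inv_norm_scaleR:
  "two_point_avg c inv_norm E vs (r *\<^sub>R y) = two_point_avg c inv_norm E vs y / \<bar>r\<bar>"
  by (induction vs arbitrary: y) (auto simp: inv_norm_def step_scaleR add_divide_distrib)

text \<open>Jensen's inequality for the concave square root, one averaging at a time.\<close>

lemma two_point_avg_sqrt_le:
  "two_point_avg c inv_sqrt_norm E vs y \<le> sqrt (two_point_avg c inv_norm E vs y)"
proof (induction vs arbitrary: y)
  case Nil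
  then show ?case by (simp add: inv_sqrt_norm_def inv_norm_def real_sqrt_divide)
next
  case (Cons v vs)
  let ?a = "two_point_avg c inv_norm E vs (step (E - v) y)" and ?b = "two_point_avg c inv_norm E vs (step (E - v - c) y)"
  have nn: "0 \<le> ?a" "0 \<le> ?b" by (simp_all add: two_point_avg_nonneg inv_norm_def)
  have "(sqrt ?a + sqrt ?b) / 2 \<le> sqrt ((?a + ?b) / 2)"
  proof (rule real_le_rsqrt)
    show "((sqrt ?a + sqrt ?b) / 2)\<^sup>2 \<le> (?a + ?b) / 2"
      using nn zero_le_power2[of "sqrt ?a - sqrt ?b"] by (simp add: power2_eq_square field_simps)
  qed
  then show ?case using Cons[of "step (E - v) y"] Cons[of "step (E - v - c) y"] by simp
qed

section \<open>Mean-square decay on the projective line\<close>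

definition line_avg :: "real \<Rightarrow> real \<Rightarrow> real list \<Rightarrow> real \<Rightarrow> real" where
  "line_avg c E vs x = two_point_avg c inv_norm E vs (x, 1)"

lemma line_avg_nonneg: "0 \<le> line_avg c E vs x"
  by (simp add: line_avg_def two_point_avg_nonneg inv_norm_def)

lemma continuous_on_line_avg: "continuous_on A (line_avg c E vs)"
  unfolding line_avg_def
  by (intro continuous_on_two_point_avg continuous_on_inv_norm continuous_intros) (auto simp: prod_eq_iff)

lemma line_avg_measurable [measurable]: "line_avg c E vs \<in> borel_measurable borel"
  by (intro borel_measurable_continuous_onI continuous_on_line_avg)

text \<open>\<open>step e (x, 1)\<close> is x times (e - 1/x, 1). Noise in the potential thus
  becomes an average of translates, seen through the isometric inversion.\<close>

lemma line_avg_Cons: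
  assumes "x \<noteq> 0"
  shows "line_avg c E (v # vs) x = inversion (\<lambda>x. half_avg c (line_avg c E vs) (x + (E - v))) x"
proof -
  have "step e (x, 1) = x *\<^sub>R (e - 1 / x, 1)" for e
    using assms by (simp add: step_def right_diff_distrib)
  then have "line_avg c E (v # vs) x = (line_avg c E vs (E - v - 1 / x) / \<bar>x\<bar> + line_avg c E vs (E - v - c - 1 / x) / \<bar>x\<bar>) / 2"
    by (simp only: line_avg_def two_point_avg.simps two_point_avg_inv_norm_scaleR)
  moreover have "- 1 / x + (E - v) - c = E - v - c - 1 / x" "- 1 / x + (E - v) = E - v - 1 / x"
    by auto
  ultimately show ?thesis
    unfolding inversion_def half_avg_def by (simp only: add_divide_distrib divide_divide_eq_left mult.commute)
qed

lemma l2sq_cong_AE: "(AE x in lborel. f x = g x) \<Longrightarrow> l2sq f = l2sq g"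
  unfolding l2sq_def by (rule nn_integral_cong_AE) auto

lemma l2sq_line_avg_Cons:
  "l2sq (line_avg c E (v # vs)) = l2sq (half_avg c (line_avg c E vs))"
proof -
  have "AE x in lborel. x \<noteq> (0::real)" by (rule AE_lborel_singleton)
  then have "l2sq (line_avg c E (v # vs)) = l2sq (inversion (\<lambda>x. half_avg c (line_avg c E vs) (x + (E - v))))"
    by (intro l2sq_cong_AE) (auto simp: line_avg_Cons elim!: eventually_mono)
  also have "\<dots> = l2sq (half_avg c (line_avg c E vs))"
    by (subst l2sq_inversion) (auto simp: l2sq_translate)
  finally show ?thesis .
qed

text \<open>Brings two steps into the form of \<open>two_step_contraction\<close>. The outer entry
  \<open>u\<close> only translates and drops out of the mass. The exceptional points 0 and
  \<open>c\<close> arise because \<open>half_avg\<close> evaluates at x and at x - c.\<close>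

lemma l2sq_line_avg_Cons_Cons:
  "l2sq (line_avg c E (u # v # vs)) = l2sq (half_avg c (inversion (\<lambda>x. half_avg c (line_avg c E vs) (x + (E - v)))))"
proof -
  have "AE x in lborel. x \<noteq> (0::real)" "AE x in lborel. x \<noteq> c" by (rule AE_lborel_singleton)+
  then have "AE x in lborel. half_avg c (line_avg c E (v # vs)) x
      = half_avg c (inversion (\<lambda>x. half_avg c (line_avg c E vs) (x + (E - v)))) x"
    by eventually_elim (simp add: half_avg_def[of _ "line_avg _ _ (_ # _)"] half_avg_def[of _ "inversion _"] line_avg_Cons)
  then show ?thesis unfolding l2sq_line_avg_Cons by (rule l2sq_cong_AE)
qed

lemma l2sq_line_avg_Nil: "l2sq (line_avg c E []) = ennreal pi"
proof -
  let ?f = "\<lambda>x::real. ennreal (1 / (1 + x\<^sup>2))"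
  let ?g = "\<lambda>x::real. ?f x * indicator {0..} x"
  have half: "(\<integral>\<^sup>+x. ?g x \<partial>lborel) = ennreal (pi / 2 - arctan 0)"
    by (intro nn_integral_FTC_atLeast tendsto_arctan_at_top)
      (auto intro!: derivative_eq_intros simp: field_simps)
  have "l2sq (line_avg c E []) = (\<integral>\<^sup>+x. ?f x \<partial>lborel)"
    by (simp add: l2sq_def line_avg_def inv_norm_def norm_Pair power_divide add.commute)
  also have "\<dots> = (\<integral>\<^sup>+x. ?g x + ?g (0 + (-1) * x) \<partial>lborel)"
  proof (rule nn_integral_cong_AE)
    have "AE x in lborel. x \<noteq> (0::real)" by (rule AE_lborel_singleton)
    then show "AE x in lborel. ?f x = ?g x + ?g (0 + (-1) * x)"
      by eventually_elim (auto split: split_indicator)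
  qed
  also have "\<dots> = (\<integral>\<^sup>+x. ?g x \<partial>lborel) + (\<integral>\<^sup>+x. ?g (0 + (-1) * x) \<partial>lborel)"
    by (rule nn_integral_add) auto
  also have "(\<integral>\<^sup>+x. ?g (0 + (-1) * x) \<partial>lborel) = (\<integral>\<^sup>+x. ?g x \<partial>lborel)"
    using nn_integral_real_affine[of ?g "-1" 0] by simp
  finally show ?thesis unfolding half by (simp flip: ennreal_plus)
qed

text \<open>The rate is uniform in \<open>E\<close> and \<open>vs\<close> because they enter only
  through translations; pi is the mass for the empty list.\<close>

lemma l2sq_line_avg_decay:
  fixes c :: real
  assumes c: "0 < c" "c \<le> 1"
  obtains \<kappa> where "0 \<le> \<kappa>" "\<kappa> < 1"
    "\<And>E vs n. length vs = 2 * n \<Longrightarrow> l2sq (line_avg c E vs) \<le> ennreal (pi * \<kappa> ^ n)"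
proof -
  obtain \<kappa> where \<kappa>: "0 \<le> \<kappa>" "\<kappa> < 1"
    "\<And>f d. f \<in> borel_measurable borel \<Longrightarrow>
      l2sq (half_avg c (inversion (\<lambda>x. half_avg c f (x + d)))) \<le> ennreal \<kappa> * l2sq f"
    using two_step_contraction[OF c] by metis
  have "l2sq (line_avg c E vs) \<le> ennreal (pi * \<kappa> ^ n)" if "length vs = 2 * n" for E vs n
    using that
  proof (induction n arbitrary: vs)
    case 0
    then show ?case by (simp add: l2sq_line_avg_Nil)
  next
    case (Suc n)
    then obtain u v ws where vs: "vs = u # v # ws" "length ws = 2 * n"
      by (auto simp: length_Suc_conv)
    have "l2sq (line_avg c E vs) \<le> ennreal \<kappa> * l2sq (line_avg c E ws)"
      unfolding vs l2sq_line_avg_Cons_Cons by (rule \<kappa>(3)) simp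
    also have "\<dots> \<le> ennreal \<kappa> * ennreal (pi * \<kappa> ^ n)"
      by (rule mult_left_mono[OF Suc.IH[OF vs(2)]]) simp
    also have "\<dots> = ennreal (pi * \<kappa> ^ Suc n)"
      using \<kappa> by (subst ennreal_mult[symmetric]) (auto simp: mult_ac)
    finally show ?case .
  qed
  then show thesis using that \<kappa> by blast
qed

section \<open>From mean squares to every initial vector\<close>

lemma integral_square_le_l2sq:
  fixes f :: "real \<Rightarrow> real"
  assumes f: "continuous_on UNIV f" and r: "l2sq f \<le> ennreal r" "0 \<le> r" and "0 \<le> c"
  shows "integral {0..c} (\<lambda>w. (f (s - w))\<^sup>2) \<le> r"
proof -
  have cont: "continuous_on {s-c..s} (\<lambda>x. (f x)\<^sup>2)"
    using f by (intro continuous_intros continuous_on_subset[OF f]) auto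
  have [measurable]: "f \<in> borel_measurable borel" by (rule borel_measurable_continuous_onI[OF f])
  have int: "set_integrable lborel {s-c..s} (\<lambda>x. (f x)\<^sup>2)"
    by (rule borel_integrable_atLeastAtMost'[OF cont])
  have "((\<lambda>w. (f (s - w))\<^sup>2) has_integral integral {s-c..s} (\<lambda>x. (f x)\<^sup>2)) {0..c}"
  proof -
    have "((\<lambda>x. (f x)\<^sup>2) has_integral integral {s-c..s} (\<lambda>x. (f x)\<^sup>2)) (cbox (s-c) s)"
      using integrable_integral[OF integrable_continuous_real[OF cont]] by simp
    from has_integral_affinity[OF this, of "-1" s] show ?thesis
      using \<open>0 \<le> c\<close> by (simp add: image_affinity_atLeastAtMost)
  qed
  then have "integral {0..c} (\<lambda>w. (f (s - w))\<^sup>2) = integral {s-c..s} (\<lambda>x. (f x)\<^sup>2)"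
    by (rule integral_unique)
  also have "\<dots> = (LINT x:{s-c..s}|lborel. (f x)\<^sup>2)"
    by (rule set_borel_integral_eq_integral(2)[OF int, symmetric])
  also have "ennreal \<dots> = (\<integral>\<^sup>+x. ennreal (indicator {s-c..s} x * (f x)\<^sup>2) \<partial>lborel)"
    using int unfolding set_lebesgue_integral_def set_integrable_def
    by (subst nn_integral_eq_integral) auto
  also have "\<dots> \<le> l2sq f"
    unfolding l2sq_def by (rule nn_integral_mono) (auto split: split_indicator)
  also have "\<dots> \<le> ennreal r" by (rule r)
  finally show ?thesis using r by simp
qed

text \<open>As w varies, the first component \<open>h\<close> of the stepped vector moves affinely
  with speed |a|. If |a| is comparable to the norm, integrating 1 / sqrt |h| through a possible zero
  costs only a constant; otherwise b dominates and \<open>h\<close> never gets small. The bound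
  \<open>M\<close> on \<open>e\<close> makes the constant uniform.\<close>

lemma uniform_avg_inverse_sqrt_le:
  fixes M c :: real
  assumes c: "0 < c" "c \<le> 1" and M: "0 \<le> M"
  obtains C where "C > 0"
    "\<And>e y \<mu> g. \<bar>e\<bar> \<le> M \<Longrightarrow> y \<noteq> 0 \<Longrightarrow> 0 \<le> \<mu> \<Longrightarrow> continuous_on (- {0}) g \<Longrightarrow>
      (\<And>z. fst z \<noteq> 0 \<Longrightarrow> g z \<le> \<mu> / sqrt \<bar>fst z\<bar>) \<Longrightarrow> uniform_avg c e g y \<le> C * \<mu> / sqrt (norm y)"
proof -
  define C where "C = 16 * (M + 1) * sqrt (M + 2) / c + 2"
  have C: "C > 0" "C \<ge> 2" "C \<ge> 16 * (M + 1) * sqrt (M + 2) / c"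
    unfolding C_def using c M by (auto intro!: add_nonneg_pos)
  have "uniform_avg c e g y \<le> C * \<mu> / sqrt (norm y)"
    if e: "\<bar>e\<bar> \<le> M" and y: "y \<noteq> 0" and \<mu>: "0 \<le> \<mu>" and g: "continuous_on (- {0}) g"
      and le: "\<And>z. fst z \<noteq> 0 \<Longrightarrow> g z \<le> \<mu> / sqrt \<bar>fst z\<bar>"
    for e y \<mu> g
  proof -
    obtain a b where ab: "y = (a, b)" by (cases y)
    have ny: "norm y > 0" using y by simp
    have na: "\<bar>a\<bar> \<le> norm y" and nb: "\<bar>b\<bar> \<le> norm y" and nab: "norm y \<le> \<bar>a\<bar> + \<bar>b\<bar>"
      using norm_fst_le[of a b] norm_snd_le[of b a] norm_Pair_le[of a b] by (auto simp: ab)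
    define h where "h w = (e - w) * a - b" for w
    have fst_step: "fst (step (e - w) y) = h w" for w by (simp add: step_def h_def ab)
    have cont: "continuous_on {0..c} (\<lambda>w. g (step (e - w) y))"
      using y by (intro continuous_on_compose2[OF g] continuous_intros) auto
    then have int: "((\<lambda>w. g (step (e - w) y)) has_integral c * uniform_avg c e g y) {0..c}"
      using integrable_integral[OF integrable_continuous_real[OF cont]] c by (simp add: uniform_avg_def)
    have ea: "\<bar>(e - w) * a\<bar> \<le> (M + 1) * \<bar>a\<bar>" if "w \<in> {0..c}" for w
      unfolding abs_mult using that c e by (intro mult_right_mono) auto
    show ?thesis
    proof (cases "norm y \<le> 4 * (M + 1) * \<bar>a\<bar>")
      case True
      then have a: "a \<noteq> 0" using ny by auto
      \<comment> \<open>One formula serves on both sides of the zero of \<open>h\<close>, since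
        \<open>sqrt\<close> is an odd function on the reals, and it is continuous through the
        zero.\<close>
      define F where "F w = - (2 * \<mu> / a) * sqrt (h w)" for w
      \<comment> \<open>At the zero of \<open>h\<close> the integrand takes the value of
        \<open>g\<close>: the bound on \<open>g\<close> says nothing there, and division by zero
        would give 0.\<close>
      have "((\<lambda>w. if h w = 0 then g (step (e - w) y) else \<mu> / sqrt \<bar>h w\<bar>) has_integral F c - F 0) {0..c}"
      proof (rule fundamental_theorem_of_calculus_interior_strong[of "{e - b / a}"])
        show "continuous_on {0..c} F" unfolding F_def h_def by (intro continuous_intros)
        fix w assume w: "w \<in> {0<..<c} - {e - b / a}"
        have h0: "h w \<noteq> 0"
        proof
          assume "h w = 0"
          then have "w = e - b / a" using a by (simp add: h_def field_simps)
          then show False using w by simp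
        qed
        have hd: "(h has_real_derivative - a) (at w)"
          unfolding h_def by (auto intro!: derivative_eq_intros)
        have sd: "DERIV sqrt (h w) :> inverse (sqrt \<bar>h w\<bar>) / 2"
          using h0 by (intro DERIV_real_sqrt_generic) (auto simp: real_sqrt_minus)
        have "((\<lambda>w. sqrt (h w)) has_real_derivative (inverse (sqrt \<bar>h w\<bar>) / 2) * (- a)) (at w)"
          by (rule DERIV_chain2[OF sd hd])
        then have "(F has_real_derivative - (2 * \<mu> / a) * ((inverse (sqrt \<bar>h w\<bar>) / 2) * (- a))) (at w)"
          unfolding F_def by (rule DERIV_cmult)
        also have "- (2 * \<mu> / a) * ((inverse (sqrt \<bar>h w\<bar>) / 2) * (- a)) = \<mu> / sqrt \<bar>h w\<bar>"
          using a by (simp add: field_simps)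
        finally show "(F has_vector_derivative (if h w = 0 then g (step (e - w) y) else \<mu> / sqrt \<bar>h w\<bar>)) (at w)"
          using h0 by (simp add: has_real_derivative_iff_has_vector_derivative)
      qed (use c in auto)
      from has_integral_le[OF int this] have "c * uniform_avg c e g y \<le> F c - F 0"
        using le[of "step (e - w) y" for w] by (simp add: fst_step)
      also have "\<dots> \<le> 2 * \<mu> / \<bar>a\<bar> * (2 * sqrt ((M + 2) * norm y))"
      proof -
        have hb: "\<bar>sqrt (h w)\<bar> \<le> sqrt ((M + 2) * norm y)" if "w \<in> {0..c}" for w
        proof -
          have "\<bar>h w\<bar> \<le> (M + 1) * \<bar>a\<bar> + \<bar>b\<bar>" using ea[OF that] unfolding h_def by linarith
          also have "\<dots> \<le> (M + 1) * norm y + norm y"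
            using na nb M by (intro add_mono mult_left_mono) auto
          finally have "\<bar>h w\<bar> \<le> (M + 2) * norm y" by (simp add: algebra_simps)
          then have "sqrt \<bar>h w\<bar> \<le> sqrt ((M + 2) * norm y)" by simp
          moreover have "\<bar>sqrt (h w)\<bar> = sqrt \<bar>h w\<bar>" by (simp add: abs_if real_sqrt_minus)
          ultimately show ?thesis by simp
        qed
        have "F c - F 0 = (2 * \<mu> / a) * (sqrt (h 0) - sqrt (h c))" by (simp add: F_def right_diff_distrib)
        also have "\<dots> \<le> \<bar>2 * \<mu> / a\<bar> * \<bar>sqrt (h 0) - sqrt (h c)\<bar>" unfolding abs_mult[symmetric] by (rule abs_ge_self)
        also have "\<dots> \<le> \<bar>2 * \<mu> / a\<bar> * (2 * sqrt ((M + 2) * norm y))"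
          using hb[of 0] hb[of c] c by (intro mult_left_mono) auto
        finally show ?thesis using \<mu> by (simp add: abs_mult)
      qed
      also have "\<dots> \<le> (2 * \<mu> * (4 * (M + 1)) / norm y) * (2 * sqrt ((M + 2) * norm y))"
      proof (rule mult_right_mono)
        have "1 / \<bar>a\<bar> \<le> 4 * (M + 1) / norm y" using True a ny by (simp add: field_simps)
        from mult_left_mono[OF this, of "2 * \<mu>"] \<mu> show "2 * \<mu> / \<bar>a\<bar> \<le> 2 * \<mu> * (4 * (M + 1)) / norm y" by simp
      qed (use M in auto)
      also have "\<dots> = 16 * (M + 1) * sqrt (M + 2) * \<mu> * (sqrt (norm y) / norm y)"
        by (simp add: real_sqrt_mult)
      also have "sqrt (norm y) / norm y = 1 / sqrt (norm y)"
        using ny by (simp add: real_div_sqrt divide_eq_eq field_simps flip: real_sqrt_mult)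
      finally have "uniform_avg c e g y * c \<le> 16 * (M + 1) * sqrt (M + 2) * \<mu> * (1 / sqrt (norm y))"
        by (simp only: mult.commute)
      then have "uniform_avg c e g y \<le> 16 * (M + 1) * sqrt (M + 2) * \<mu> * (1 / sqrt (norm y)) / c"
        using c by (simp only: pos_le_divide_eq)
      also have "\<dots> = (16 * (M + 1) * sqrt (M + 2) / c) * (\<mu> / sqrt (norm y))" by simp
      also have "\<dots> \<le> C * (\<mu> / sqrt (norm y))"
        using C \<mu> by (intro mult_right_mono) auto
      finally show ?thesis by simp
    next
      case False
      have "c * uniform_avg c e g y \<le> 2 * \<mu> / sqrt (norm y) * c"
      proof (rule has_integral_le[OF int])
        show "((\<lambda>w. 2 * \<mu> / sqrt (norm y)) has_integral 2 * \<mu> / sqrt (norm y) * c) {0..c}"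
          using has_integral_const_real[of "2 * \<mu> / sqrt (norm y)" 0 c] c by (simp add: mult.commute)
        fix w assume w: "w \<in> {0..c}"
        have "4 * \<bar>a\<bar> \<le> 4 * (M + 1) * \<bar>a\<bar>" using M by (simp add: algebra_simps)
        then have "\<bar>h w\<bar> \<ge> norm y / 4"
          using ea[OF w] False nab unfolding h_def by linarith
        then have hy: "sqrt (norm y) \<le> 2 * sqrt \<bar>h w\<bar>" "h w \<noteq> 0"
          using ny by (auto intro!: real_le_lsqrt simp: power_mult_distrib simp flip: real_sqrt_mult[of 4, simplified])
        have "g (step (e - w) y) \<le> \<mu> / sqrt \<bar>h w\<bar>"
          using le[of "step (e - w) y"] hy by (simp add: fst_step)
        also have "\<dots> \<le> 2 * \<mu> / sqrt (norm y)"
          using hy ny \<mu> mult_right_mono[OF hy(1) \<mu>] by (simp add: field_simps)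
        finally show "g (step (e - w) y) \<le> 2 * \<mu> / sqrt (norm y)" .
      qed
      then have "c * uniform_avg c e g y \<le> c * (2 * (\<mu> / sqrt (norm y)))" by (simp add: mult.commute)
      then have "uniform_avg c e g y \<le> 2 * (\<mu> / sqrt (norm y))" using c by (simp only: mult_le_cancel_left_pos)
      also have "\<dots> \<le> C * (\<mu> / sqrt (norm y))"
        using C \<mu> by (intro mult_right_mono) auto
      finally show ?thesis by simp
    qed
  qed
  then show thesis using that C(1) by blast
qed

text \<open>Trades the square root, which the inverse square root of the norm produces, for a small
  constant plus the square that the mean-square decay controls.\<close>

lemma sqrt_le_add_power:
  fixes t :: real
  assumes "0 < \<delta>" "0 \<le> t"
  shows "sqrt t \<le> \<delta> + t\<^sup>2 / \<delta> ^ 3"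
proof (cases "sqrt t \<le> \<delta>")
  case True
  then show ?thesis using assms by (simp add: add_increasing2)
next
  case False
  then have "\<delta> ^ 3 * sqrt t \<le> sqrt t ^ 3 * sqrt t"
    using assms by (intro mult_right_mono power_mono) auto
  also have "\<dots> = (sqrt t ^ 2) ^ 2" by (simp add: power3_eq_cube power2_eq_square mult.assoc)
  also have "\<dots> = t\<^sup>2" using assms by simp
  finally have "sqrt t \<le> t\<^sup>2 / \<delta> ^ 3" using assms by (simp add: field_simps)
  then show ?thesis using assms by simp
qed

text \<open>Once the first component of \<open>z\<close> is scaled out, the uniform variable moves
  the projective coordinate over an interval of length \<open>c\<close>, and the average becomes an
  integral of \<open>line_avg\<close>.\<close>

lemma uniform_avg_two_point_avg_le:
  assumes c: "0 < c" and \<delta>: "0 < \<delta>" and r: "l2sq (line_avg c E vs) \<le> ennreal r" "0 \<le> r" and z: "fst z \<noteq> 0"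
  shows "uniform_avg c e (two_point_avg c inv_sqrt_norm E vs) z \<le> (\<delta> + r / (c * \<delta> ^ 3)) / sqrt \<bar>fst z\<bar>"
proof -
  obtain a b where ab: "z = (a, b)" by (cases z)
  have a: "a \<noteq> 0" using z by (simp add: ab)
  let ?f = "line_avg c E vs"
  let ?s = "e - b / a"
  have cont: "continuous_on {0..c} (\<lambda>w. two_point_avg c inv_sqrt_norm E vs (step (e - w) z))"
    using z by (intro continuous_on_two_point_avg continuous_on_inv_sqrt_norm continuous_intros) auto
  have cont2: "continuous_on {0..c} (\<lambda>w. (?f (?s - w))\<^sup>2)"
    by (intro continuous_intros continuous_on_compose2[OF continuous_on_line_avg[of UNIV]]) auto
  have "integral {0..c} (\<lambda>w. two_point_avg c inv_sqrt_norm E vs (step (e - w) z))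
     \<le> integral {0..c} (\<lambda>w. (\<delta> + (?f (?s - w))\<^sup>2 * (1 / \<delta> ^ 3)) * (1 / sqrt \<bar>a\<bar>))"
  proof (rule integral_le)
    fix w
    have "step (e - w) z = a *\<^sub>R (?s - w, 1)" using a by (simp add: step_def ab algebra_simps)
    then have "two_point_avg c inv_norm E vs (step (e - w) z) = ?f (?s - w) / \<bar>a\<bar>"
      by (simp only: two_point_avg_inv_norm_scaleR line_avg_def)
    then have "two_point_avg c inv_sqrt_norm E vs (step (e - w) z) \<le> sqrt (?f (?s - w) / \<bar>a\<bar>)"
      using two_point_avg_sqrt_le by metis
    also have "\<dots> = sqrt (?f (?s - w)) * (1 / sqrt \<bar>a\<bar>)" by (simp add: real_sqrt_divide)
    also have "\<dots> \<le> (\<delta> + (?f (?s - w))\<^sup>2 / \<delta> ^ 3) * (1 / sqrt \<bar>a\<bar>)"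
      by (intro mult_right_mono sqrt_le_add_power \<delta> line_avg_nonneg) auto
    finally show "two_point_avg c inv_sqrt_norm E vs (step (e - w) z) \<le> (\<delta> + (?f (?s - w))\<^sup>2 * (1 / \<delta> ^ 3)) * (1 / sqrt \<bar>a\<bar>)"
      by simp
  qed (intro integrable_continuous_real cont continuous_intros cont2)+
  also have "\<dots> = (\<delta> * c + integral {0..c} (\<lambda>w. (?f (?s - w))\<^sup>2) * (1 / \<delta> ^ 3)) * (1 / sqrt \<bar>a\<bar>)"
    using c \<delta> integrable_continuous_real[OF cont2] by (subst integral_mult_left, subst integral_add) (auto intro!: integrable_continuous_real continuous_intros cont2)
  also have "\<dots> \<le> (\<delta> * c + r * (1 / \<delta> ^ 3)) * (1 / sqrt \<bar>a\<bar>)"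
    using \<delta> c integral_square_le_l2sq[OF continuous_on_line_avg r, of c ?s]
    by (intro mult_right_mono add_left_mono) auto
  finally have "uniform_avg c e (two_point_avg c inv_sqrt_norm E vs) z \<le> (\<delta> * c + r * (1 / \<delta> ^ 3)) * (1 / sqrt \<bar>a\<bar>) / c"
    using c unfolding uniform_avg_def by (intro divide_right_mono) auto
  also have "\<dots> = (\<delta> + r / (c * \<delta> ^ 3)) / sqrt \<bar>a\<bar>"
    using c \<delta> by (simp add: field_simps)
  finally show ?thesis by (simp add: ab)
qed

theorem block_avg_small:
  fixes M c \<sigma> :: real
  assumes c: "0 < c" "c \<le> 1" and M: "0 \<le> M" and \<sigma>: "0 < \<sigma>"
  obtains N where "2 \<le> N"
    "\<And>E vs y. length vs = N \<Longrightarrow> (\<And>v. v \<in> set vs \<Longrightarrow> \<bar>E - v\<bar> \<le> M) \<Longrightarrow> y \<noteq> 0 \<Longrightarrow>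
      block_avg c E vs y \<le> \<sigma> / sqrt (norm y)"
proof -
  obtain C where C: "C > 0"
    "\<And>e y \<mu> g. \<bar>e\<bar> \<le> M \<Longrightarrow> y \<noteq> 0 \<Longrightarrow> 0 \<le> \<mu> \<Longrightarrow> continuous_on (- {0}) g \<Longrightarrow>
      (\<And>z. fst z \<noteq> 0 \<Longrightarrow> g z \<le> \<mu> / sqrt \<bar>fst z\<bar>) \<Longrightarrow> uniform_avg c e g y \<le> C * \<mu> / sqrt (norm y)"
    using uniform_avg_inverse_sqrt_le[OF c M] by metis
  obtain \<kappa> where \<kappa>: "0 \<le> \<kappa>" "\<kappa> < 1"
    "\<And>E vs n. length vs = 2 * n \<Longrightarrow> l2sq (line_avg c E vs) \<le> ennreal (pi * \<kappa> ^ n)"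
    using l2sq_line_avg_decay[OF c] by metis
  \<comment> \<open>Half of \<open>\<sigma>\<close> pays for the constant \<open>\<delta>\<close>,
    the other half for the mean square after 2 n further entries. With the two uniform entries the
    block has length 2 n + 2.\<close>
  define \<delta> where "\<delta> = \<sigma> / (2 * C)"
  have \<delta>: "\<delta> > 0" using C \<sigma> by (simp add: \<delta>_def)
  have "(\<lambda>n. pi * \<kappa> ^ n / (c * \<delta> ^ 3)) \<longlonglongrightarrow> pi * 0 / (c * \<delta> ^ 3)"
    using \<kappa> c \<delta> by (intro tendsto_intros LIMSEQ_power_zero) auto
  then have "\<forall>\<^sub>F n in sequentially. pi * \<kappa> ^ n / (c * \<delta> ^ 3) < \<delta>"
    using \<delta> by (intro order_tendstoD(2)) auto
  then obtain n where n: "pi * \<kappa> ^ n / (c * \<delta> ^ 3) < \<delta>" by (auto simp: eventually_sequentially)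
  have "block_avg c E vs y \<le> \<sigma> / sqrt (norm y)"
    if len: "length vs = 2 * n + 2" and vs: "\<And>v. v \<in> set vs \<Longrightarrow> \<bar>E - v\<bar> \<le> M" and y: "y \<noteq> 0" for E vs y
  proof -
    let ?g = "uniform_avg c (E - vs ! 1) (two_point_avg c inv_sqrt_norm E (drop 2 vs))"
    have "block_avg c E vs y \<le> C * (\<delta> + pi * \<kappa> ^ n / (c * \<delta> ^ 3)) / sqrt (norm y)"
      unfolding block_avg_def
    proof (rule C(2))
      show "\<bar>E - vs ! 0\<bar> \<le> M" using len by (intro vs nth_mem) auto
      show "continuous_on (- {0}) ?g"
        using continuous_on_uniform_avg_two_point_avg[of "-{0}" "\<lambda>_. E" "\<lambda>y. y" c "vs ! 1" "drop 2 vs"]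
        by (auto intro!: continuous_intros)
      show "?g z \<le> (\<delta> + pi * \<kappa> ^ n / (c * \<delta> ^ 3)) / sqrt \<bar>fst z\<bar>" if "fst z \<noteq> 0" for z
        using len that \<kappa> \<delta> c by (intro uniform_avg_two_point_avg_le) auto
    qed (use y \<delta> c \<kappa> in auto)
    also have "\<dots> \<le> C * (\<delta> + \<delta>) / sqrt (norm y)"
      using C n by (intro divide_right_mono mult_left_mono) auto
    also have "C * (\<delta> + \<delta>) = \<sigma>" using C by (simp add: \<delta>_def)
    finally show ?thesis .
  qed
  then show thesis using that[of "2 * n + 2"] by simp
qed

section \<open>Selecting potentials\<close>

definition lifted :: "real \<Rightarrow> real list \<Rightarrow> real list \<Rightarrow> bool" where
  "lifted c vs ws \<longleftrightarrow> list_all2 (\<lambda>v w. v \<le> w \<and> w \<le> v + c) vs ws"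

lemma exists_le_average:
  fixes f :: "real \<Rightarrow> real"
  assumes c: "0 < c" and f: "continuous_on {0..c} f"
  shows "\<exists>w\<in>{0..c}. f w \<le> integral {0..c} f / c"
proof -
  have "\<exists>w\<in>{0..c}. \<forall>x\<in>{0..c}. f w \<le> f x"
    using c f by (intro continuous_attains_inf) auto
  then obtain w where w: "w \<in> {0..c}" "\<And>x. x \<in> {0..c} \<Longrightarrow> f w \<le> f x" by blast
  have "integral {0..c} (\<lambda>_. f w) \<le> integral {0..c} f"
    using w f by (intro integral_le integrable_continuous_real) auto
  then show ?thesis using w(1) c by (intro bexI[of _ w]) (auto simp: field_simps)
qed

lemma mean_ge: "t = (x + y) / 2 \<Longrightarrow> x \<le> t \<or> y \<le> t" for t x y :: real
  by (cases "x \<le> t") auto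

text \<open>Derandomization by conditional expectations: one of two continuations is not worse than
  their mean. \<open>\<Lambda>\<close> is left abstract so that both an integral over energies and a
  finite sum of energies are covered; the selected entries do not depend on E.\<close>

lemma select_two_point:
  fixes \<Lambda> :: "(real \<Rightarrow> real) \<Rightarrow> real"
  assumes half: "\<And>F G. continuous_on X F \<Longrightarrow> continuous_on X G \<Longrightarrow> \<Lambda> (\<lambda>E. (F E + G E) / 2) = (\<Lambda> F + \<Lambda> G) / 2"
    and c: "0 \<le> c" and g: "continuous_on (- {0}) g"
    and y: "continuous_on X y" "\<And>E. E \<in> X \<Longrightarrow> y E \<noteq> 0"
  shows "\<exists>ws. lifted c vs ws \<and> \<Lambda> (\<lambda>E. g (transfer E ws (y E))) \<le> \<Lambda> (\<lambda>E. two_point_avg c g E vs (y E))"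
  using y
proof (induction vs arbitrary: y)
  case Nil
  then show ?case by (auto simp: lifted_def)
next
  case (Cons v vs)
  let ?F = "\<lambda>a E. two_point_avg c g E vs (step (E - a) (y E))"
  have cont: "continuous_on X (?F a)" for a
    using Cons.prems by (intro continuous_on_two_point_avg g continuous_intros) auto
  let ?T = "\<Lambda> (\<lambda>E. two_point_avg c g E (v # vs) (y E))"
  have "?T = (\<Lambda> (?F v) + \<Lambda> (?F (v + c))) / 2"
    using half[OF cont[of v] cont[of "v + c"]] by (simp add: diff_diff_eq)
  then have "\<Lambda> (?F v) \<le> ?T \<or> \<Lambda> (?F (v + c)) \<le> ?T" by (rule mean_ge)
  then obtain a where a: "a = v \<or> a = v + c" "\<Lambda> (?F a) \<le> ?T" by blast
  have "\<exists>ws. lifted c vs ws \<and> \<Lambda> (\<lambda>E. g (transfer E ws (step (E - a) (y E)))) \<le> \<Lambda> (?F a)"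
    using Cons.prems by (intro Cons.IH continuous_intros) auto
  then obtain ws where "lifted c vs ws" "\<Lambda> (\<lambda>E. g (transfer E ws (step (E - a) (y E)))) \<le> \<Lambda> (?F a)" by blast
  with a c show ?case
    by (intro exI[of _ "a # ws"]) (auto simp: lifted_def transfer_Cons)
qed

text \<open>Conditional expectations again, with uniform noise on the two leading entries. The
  assumption \<open>avg\<close> combines the exchange of \<open>\<Lambda>\<close> with the noise
  integral and the choice of a value not above the mean.\<close>

lemma select_block:
  fixes \<Lambda> :: "(real \<Rightarrow> real) \<Rightarrow> real"
  assumes half: "\<And>F G. continuous_on X F \<Longrightarrow> continuous_on X G \<Longrightarrow> \<Lambda> (\<lambda>E. (F E + G E) / 2) = (\<Lambda> F + \<Lambda> G) / 2"
    and avg: "\<And>F. continuous_on (X \<times> {0..c}) (\<lambda>(E, w). F E w) \<Longrightarrow>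
      \<exists>w\<in>{0..c}. \<Lambda> (\<lambda>E. F E w) \<le> \<Lambda> (\<lambda>E. integral {0..c} (F E) / c)"
    and c: "0 \<le> c"
    and y: "continuous_on X y" "\<And>E. E \<in> X \<Longrightarrow> y E \<noteq> 0"
    and vs: "2 \<le> length vs"
  shows "\<exists>ws. lifted c vs ws \<and> \<Lambda> (\<lambda>E. inv_sqrt_norm (transfer E ws (y E))) \<le> \<Lambda> (\<lambda>E. block_avg c E vs (y E))"
proof -
  obtain v1 v2 us where v: "vs = v1 # v2 # us" using vs by (cases vs; cases "tl vs") auto
  let ?h = "\<lambda>E. two_point_avg c inv_sqrt_norm E us"
  let ?g = "\<lambda>E. uniform_avg c (E - v2) (?h E)"
  have fs: "continuous_on (X \<times> {0..c}) (\<lambda>x. y (fst x))" by (rule continuous_on_fst_comp[OF y(1)])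
  have "continuous_on (X \<times> {0..c}) (\<lambda>x. ?g (fst x) (step (fst x - v1 - snd x) (y (fst x))))"
    using y(2) by (intro continuous_on_uniform_avg_two_point_avg continuous_intros fs) auto
  then obtain w1 where w1: "w1 \<in> {0..c}" "\<Lambda> (\<lambda>E. ?g E (step (E - v1 - w1) (y E))) \<le> \<Lambda> (\<lambda>E. block_avg c E vs (y E))"
    using avg[of "\<lambda>E w. ?g E (step (E - v1 - w) (y E))"]
    by (auto simp: case_prod_unfold block_avg_def v uniform_avg_def[of c "_ - v1"])
  let ?y1 = "\<lambda>E. step (E - v1 - w1) (y E)"
  have y1: "continuous_on X ?y1" "\<And>E. E \<in> X \<Longrightarrow> ?y1 E \<noteq> 0"
    using y by (auto intro!: continuous_intros)
  have fs: "continuous_on (X \<times> {0..c}) (\<lambda>x. ?y1 (fst x))" by (rule continuous_on_fst_comp[OF y1(1)])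
  have "continuous_on (X \<times> {0..c}) (\<lambda>x. ?h (fst x) (step (fst x - v2 - snd x) (?y1 (fst x))))"
    using y1(2) by (intro continuous_on_two_point_avg continuous_on_inv_sqrt_norm continuous_intros fs) auto
  then obtain w2 where w2: "w2 \<in> {0..c}" "\<Lambda> (\<lambda>E. ?h E (step (E - v2 - w2) (?y1 E))) \<le> \<Lambda> (\<lambda>E. ?g E (?y1 E))"
    using avg[of "\<lambda>E w. ?h E (step (E - v2 - w) (?y1 E))"]
    by (auto simp: case_prod_unfold uniform_avg_def)
  let ?y2 = "\<lambda>E. step (E - v2 - w2) (?y1 E)"
  have y2: "continuous_on X ?y2" "\<And>E. E \<in> X \<Longrightarrow> ?y2 E \<noteq> 0"
    using y1 by (auto intro!: continuous_intros)
  obtain ws where ws: "lifted c us ws" "\<Lambda> (\<lambda>E. inv_sqrt_norm (transfer E ws (?y2 E))) \<le> \<Lambda> (\<lambda>E. ?h E (?y2 E))"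
    using select_two_point[where \<Lambda> = \<Lambda> and X = X and y = ?y2 and vs = us, OF half c continuous_on_inv_sqrt_norm y2]
    by blast
  show ?thesis
  proof (intro exI conjI)
    show "lifted c vs ((v1 + w1) # (v2 + w2) # ws)"
      using ws(1) w1(1) w2(1) by (simp add: lifted_def v)
    have "\<Lambda> (\<lambda>E. inv_sqrt_norm (transfer E ws (?y2 E))) \<le> \<Lambda> (\<lambda>E. block_avg c E vs (y E))"
      using ws(2) w2(2) w1(2) by linarith
    then show "\<Lambda> (\<lambda>E. inv_sqrt_norm (transfer E ((v1 + w1) # (v2 + w2) # ws) (y E))) \<le> \<Lambda> (\<lambda>E. block_avg c E vs (y E))"
      by (simp add: transfer_Cons diff_diff_eq)
  qed
qed

lemma select_block_integral:
  fixes Q :: "real \<Rightarrow> real"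
  assumes c: "0 < c" and Q: "continuous_on {a..b} Q"
    and y: "continuous_on {a..b} y" "\<And>E. E \<in> {a..b} \<Longrightarrow> y E \<noteq> 0"
    and vs: "2 \<le> length vs"
  shows "\<exists>ws. lifted c vs ws \<and> integral {a..b} (\<lambda>E. Q E * inv_sqrt_norm (transfer E ws (y E)))
    \<le> integral {a..b} (\<lambda>E. Q E * block_avg c E vs (y E))"
proof (rule select_block[of "{a..b}" "\<lambda>F. integral {a..b} (\<lambda>E. Q E * F E)"])
  fix F G :: "real \<Rightarrow> real" assume FG: "continuous_on {a..b} F" "continuous_on {a..b} G"
  have "integral {a..b} (\<lambda>E. Q E * F E + Q E * G E) = integral {a..b} (\<lambda>E. Q E * F E) + integral {a..b} (\<lambda>E. Q E * G E)"
    using FG Q by (intro integral_add integrable_continuous_real continuous_intros)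
  moreover have "(\<lambda>E. Q E * ((F E + G E) / 2)) = (\<lambda>E. (Q E * F E + Q E * G E) / 2)"
    by (simp add: distrib_left)
  ultimately show "integral {a..b} (\<lambda>E. Q E * ((F E + G E) / 2))
      = (integral {a..b} (\<lambda>E. Q E * F E) + integral {a..b} (\<lambda>E. Q E * G E)) / 2"
    by (simp only: integral_divide)
next
  fix F :: "real \<Rightarrow> real \<Rightarrow> real" assume F: "continuous_on ({a..b} \<times> {0..c}) (\<lambda>(E, w). F E w)"
  have Q': "continuous_on ({a..b} \<times> {0..c}) (\<lambda>x. Q (fst x))" by (rule continuous_on_fst_comp[OF Q])
  have FQ: "continuous_on ({a..b} \<times> {0..c}) (\<lambda>(E, w). Q E * F E w)"
    using continuous_on_mult[OF Q' F] by (simp add: case_prod_unfold)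
  have swap: "integral {0..c} (\<lambda>w. integral {a..b} (\<lambda>E. Q E * F E w)) = integral {a..b} (\<lambda>E. integral {0..c} (\<lambda>w. Q E * F E w))"
    using integral_swap_continuous[of a 0 b c "\<lambda>E w. Q E * F E w"] FQ
    by (simp add: cbox_Pair_eq)
  have "continuous_on ({0..c} \<times> {a..b}) (\<lambda>(w, E). Q E * F E w)"
    using continuous_on_compose2[OF FQ, of "{0..c} \<times> {a..b}" prod.swap]
    by (simp add: case_prod_unfold continuous_on_swap product_swap)
  then have cont: "continuous_on {0..c} (\<lambda>w. integral {a..b} (\<lambda>E. Q E * F E w))"
    using integral_continuous_on_param[of "{0..c}" a b "\<lambda>w E. Q E * F E w"] by simp
  have "integral {0..c} (\<lambda>w. integral {a..b} (\<lambda>E. Q E * F E w)) / c = integral {a..b} (\<lambda>E. Q E * (integral {0..c} (F E) / c))"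
    unfolding swap by simp
  with exists_le_average[OF c cont]
  show "\<exists>w\<in>{0..c}. integral {a..b} (\<lambda>E. Q E * F E w) \<le> integral {a..b} (\<lambda>E. Q E * (integral {0..c} (F E) / c))"
    by simp
qed (use assms in auto)

lemma select_block_finite:
  fixes y :: "real \<Rightarrow> real \<times> real" and q :: "real \<Rightarrow> real"
  assumes c: "0 < c" and X: "finite X" and y: "\<And>E. E \<in> X \<Longrightarrow> y E \<noteq> 0" and vs: "2 \<le> length vs"
  shows "\<exists>ws. lifted c vs ws \<and> (\<Sum>E\<in>X. q E * inv_sqrt_norm (transfer E ws (y E)))
    \<le> (\<Sum>E\<in>X. q E * block_avg c E vs (y E))"
proof (rule select_block[of X "\<lambda>F. \<Sum>E\<in>X. q E * F E"])
  fix F :: "real \<Rightarrow> real \<Rightarrow> real" assume F: "continuous_on (X \<times> {0..c}) (\<lambda>(E, w). F E w)"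
  have FE: "continuous_on {0..c} (F E)" if "E \<in> X" for E
  proof -
    have "continuous_on {0..c} (\<lambda>w. (E, w))" by (intro continuous_intros)
    from continuous_on_compose2[OF F this] that show ?thesis by auto
  qed
  have "continuous_on {0..c} (\<lambda>w. \<Sum>E\<in>X. q E * F E w)"
    by (intro continuous_intros FE)
  from exists_le_average[OF c this]
  show "\<exists>w\<in>{0..c}. (\<Sum>E\<in>X. q E * F E w) \<le> (\<Sum>E\<in>X. q E * (integral {0..c} (F E) / c))"
    using X FE by (subst (asm) integral_sum) (auto simp: sum_divide_distrib intro!: integrable_continuous_real continuous_intros)
qed (use assms in \<open>auto simp: distrib_left add_divide_distrib sum.distrib sum_divide_distrib intro: continuous_on_finite\<close>)

text \<open>One list has to serve all energies. The sum over \<open>X\<close> of the inverse square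
  roots of the growth factors is made at most 1/2, hence so is each term, and squaring gives growth
  by 4. The price is a block length that depends on \<open>k\<close>.\<close>

lemma outward_block:
  fixes M c :: real
  assumes c: "0 < c" "c \<le> 1" and M: "0 \<le> M"
  obtains N where "2 \<le> N"
    "\<And>X vs y. finite X \<Longrightarrow> card X \<le> k \<Longrightarrow> length vs = N \<Longrightarrow>
      (\<And>E v. E \<in> X \<Longrightarrow> v \<in> set vs \<Longrightarrow> \<bar>E - v\<bar> \<le> M) \<Longrightarrow> (\<And>E. E \<in> X \<Longrightarrow> y E \<noteq> 0) \<Longrightarrow>
      \<exists>ws. lifted c vs ws \<and> (\<forall>E\<in>X. 4 * norm (y E) \<le> norm (transfer E ws (y E)))"
proof -
  obtain N where N: "2 \<le> N"
    "\<And>E vs y. length vs = N \<Longrightarrow> (\<And>v. v \<in> set vs \<Longrightarrow> \<bar>E - v\<bar> \<le> M) \<Longrightarrow> y \<noteq> 0 \<Longrightarrow>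
      block_avg c E vs y \<le> 1 / (2 * (real k + 1)) / sqrt (norm y)"
    by (rule block_avg_small[OF c M, of "1 / (2 * (real k + 1))"]) auto
  have "\<exists>ws. lifted c vs ws \<and> (\<forall>E\<in>X. 4 * norm (y E) \<le> norm (transfer E ws (y E)))"
    if X: "finite X" "card X \<le> k" and vs: "length vs = N" "\<And>E v. E \<in> X \<Longrightarrow> v \<in> set vs \<Longrightarrow> \<bar>E - v\<bar> \<le> M"
      and y: "\<And>E. E \<in> X \<Longrightarrow> y E \<noteq> 0" for X vs y
  proof -
    obtain ws where ws: "lifted c vs ws"
      "(\<Sum>E\<in>X. sqrt (norm (y E)) * inv_sqrt_norm (transfer E ws (y E))) \<le> (\<Sum>E\<in>X. sqrt (norm (y E)) * block_avg c E vs (y E))"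
      using select_block_finite[where X = X and y = y and vs = vs and q = "\<lambda>E. sqrt (norm (y E))", OF c(1) X(1) y] N(1) vs(1) by blast
    note ws(2)
    also have "(\<Sum>E\<in>X. sqrt (norm (y E)) * block_avg c E vs (y E)) \<le> (\<Sum>E\<in>X. 1 / (2 * (real k + 1)))"
    proof (rule sum_mono)
      fix E assume E: "E \<in> X"
      have "sqrt (norm (y E)) * block_avg c E vs (y E) \<le> sqrt (norm (y E)) * (1 / (2 * (real k + 1)) / sqrt (norm (y E)))"
        using N(2)[OF vs(1)] vs(2) y E by (intro mult_left_mono) auto
      then show "sqrt (norm (y E)) * block_avg c E vs (y E) \<le> 1 / (2 * (real k + 1))" using y[OF E] by simp
    qed
    also have "\<dots> \<le> 1 / 2" using X by (simp add: field_simps)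
    finally have le: "(\<Sum>E\<in>X. sqrt (norm (y E)) * inv_sqrt_norm (transfer E ws (y E))) \<le> 1 / 2" .
    have "4 * norm (y E) \<le> norm (transfer E ws (y E))" if E: "E \<in> X" for E
    proof -
      have "sqrt (norm (y E)) * inv_sqrt_norm (transfer E ws (y E)) \<le> 1 / 2"
        by (rule order_trans[OF member_le_sum[OF E] le]) (use X in \<open>auto simp: inv_sqrt_norm_def\<close>)
      then have "2 * sqrt (norm (y E)) \<le> sqrt (norm (transfer E ws (y E)))"
        using y[OF E] by (simp add: inv_sqrt_norm_def field_simps)
      then have "(2 * sqrt (norm (y E)))\<^sup>2 \<le> (sqrt (norm (transfer E ws (y E))))\<^sup>2"
        by (rule power_mono) simp
      then show ?thesis by (simp add: power_mult_distrib)
    qed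
    with ws(1) show ?thesis by blast
  qed
  then show thesis using that[OF N(1)] by blast
qed

lemma unit_nonzero: "(1, 0) \<noteq> (0 :: real \<times> real)"
  by (simp add: prod_eq_iff)

text \<open>The blocks are chosen so that energies at which solutions fail to grow inwards are rare: \<open>q E\<close> is
  the loss against growth by \<open>2\<close> per block, and the bound on its integral is independent of \<open>p\<close>.\<close>

lemma inward_blocks:
  fixes M R c :: real
  assumes c: "0 < c" "c \<le> 1" and M: "0 \<le> M" and R: "0 \<le> R"
  obtains N where "2 \<le> N"
    "\<And>p vs. length vs = p * N \<Longrightarrow> (\<And>v. v \<in> set vs \<Longrightarrow> \<bar>v\<bar> \<le> M) \<Longrightarrow>
      \<exists>ws q. lifted c vs ws \<and> continuous_on {-R..R} q \<and> (\<forall>E\<in>{-R..R}. 0 \<le> q E) \<and> integral {-R..R} q \<le> 4 * R \<and>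
        (\<forall>E\<in>{-R..R}. \<forall>m\<le>p. 2 ^ m * sqrt (norm (transfer E (take ((p - m) * N) ws) (1, 0)))
            \<le> q E * sqrt (norm (transfer E ws (1, 0))))"
proof -
  obtain N where N: "2 \<le> N"
    "\<And>E vs y. length vs = N \<Longrightarrow> (\<And>v. v \<in> set vs \<Longrightarrow> \<bar>E - v\<bar> \<le> M + R) \<Longrightarrow> y \<noteq> 0 \<Longrightarrow>
      block_avg c E vs y \<le> 1 / 4 / sqrt (norm y)"
    using M R by (rule_tac block_avg_small[OF c, of "M + R" "1/4"]) auto
  have "\<exists>ws q. lifted c vs ws \<and> continuous_on {-R..R} q \<and> (\<forall>E\<in>{-R..R}. 0 \<le> q E) \<and> integral {-R..R} q \<le> 4 * R \<and>
        (\<forall>E\<in>{-R..R}. \<forall>m\<le>p. 2 ^ m * sqrt (norm (transfer E (take ((p - m) * N) ws) (1, 0)))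
            \<le> q E * sqrt (norm (transfer E ws (1, 0))))"
    if "length vs = p * N" "\<And>v. v \<in> set vs \<Longrightarrow> \<bar>v\<bar> \<le> M" for p vs
    using that
  proof (induction p arbitrary: vs)
    case 0
    then show ?case using R by (intro exI[of _ "[]"] exI[of _ "\<lambda>_. 1"]) (auto simp: lifted_def)
  next
    case (Suc p)
    define vs1 where "vs1 = take (p * N) vs"
    define vs2 where "vs2 = drop (p * N) vs"
    have vs: "vs = vs1 @ vs2" "length vs1 = p * N" "length vs2 = N"
      using Suc.prems by (auto simp: vs1_def vs2_def)
    obtain ws1 q1 where ws1: "lifted c vs1 ws1" and q1: "continuous_on {-R..R} q1" "\<And>E. E \<in> {-R..R} \<Longrightarrow> 0 \<le> q1 E"
      "integral {-R..R} q1 \<le> 4 * R"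
      and decay: "\<And>E m. E \<in> {-R..R} \<Longrightarrow> m \<le> p \<Longrightarrow> 2 ^ m * sqrt (norm (transfer E (take ((p - m) * N) ws1) (1, 0)))
            \<le> q1 E * sqrt (norm (transfer E ws1 (1, 0)))"
      using Suc.IH[OF vs(2)] Suc.prems(2) vs(1) by (metis (no_types, lifting) Un_iff set_append)
    have len1: "length ws1 = p * N" using ws1 vs(2) by (auto simp: lifted_def dest: list_all2_lengthD)
    define y where "y E = transfer E ws1 (1, 0)" for E
    have y: "continuous_on {-R..R} y" "\<And>E. y E \<noteq> 0"
      unfolding y_def by (auto intro!: continuous_intros simp: unit_nonzero)
    \<comment> \<open>The inherited loss, relative to the current vector, times the factor 2
      demanded from the next block.\<close>
    define Q where "Q E = 2 * q1 E * sqrt (norm (y E))" for E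
    have Q: "continuous_on {-R..R} Q" unfolding Q_def by (intro continuous_intros q1 y)
    obtain ws2 where ws2: "lifted c vs2 ws2"
      "integral {-R..R} (\<lambda>E. Q E * inv_sqrt_norm (transfer E ws2 (y E))) \<le> integral {-R..R} (\<lambda>E. Q E * block_avg c E vs2 (y E))"
      using select_block_integral[OF c(1) Q y] N(1) vs(3) by blast
    \<comment> \<open>The second summand compares demanded with actual growth; the 1 takes care of m
      = 0. As the block average is at most a quarter of the inverse square root, the integral I of
      the loss becomes at most 2 R + I / 2, and 4 R is the fixed point.\<close>
    define q where "q E = 1 + Q E * inv_sqrt_norm (transfer E ws2 (y E))" for E
    have cont: "continuous_on {-R..R} (\<lambda>E. Q E * inv_sqrt_norm (transfer E ws2 (y E)))"
      using y by (intro continuous_intros Q continuous_on_compose2[OF continuous_on_inv_sqrt_norm]) auto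
    have q: "continuous_on {-R..R} q" unfolding q_def by (intro continuous_intros cont)
    have "integral {-R..R} (\<lambda>E. Q E * block_avg c E vs2 (y E)) \<le> integral {-R..R} (\<lambda>E. 1 / 2 * q1 E)"
    proof (rule integral_le)
      show "(\<lambda>E. Q E * block_avg c E vs2 (y E)) integrable_on {-R..R}"
        using y by (intro integrable_continuous_real continuous_intros Q continuous_on_block_avg) auto
      show "(\<lambda>E. 1 / 2 * q1 E) integrable_on {-R..R}"
        by (intro integrable_continuous_real continuous_intros q1)
      fix E assume E: "E \<in> {-R..R}"
      have "\<bar>E - v\<bar> \<le> M + R" if "v \<in> set vs2" for v
      proof -
        have "\<bar>v\<bar> \<le> M" using that Suc.prems(2) vs(1) by auto
        then show ?thesis using E by auto
      qed
      then have "Q E * block_avg c E vs2 (y E) \<le> Q E * (1 / 4 / sqrt (norm (y E)))"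
        using N(2)[OF vs(3)] y(2) q1(2)[OF E] by (intro mult_left_mono) (auto simp: Q_def)
      also have "\<dots> = 1 / 2 * q1 E" using y(2)[of E] by (simp add: Q_def)
      finally show "Q E * block_avg c E vs2 (y E) \<le> 1 / 2 * q1 E" .
    qed
    then have "integral {-R..R} (\<lambda>E. Q E * inv_sqrt_norm (transfer E ws2 (y E))) \<le> 2 * R"
      using ws2(2) q1(3) by simp
    then have int: "integral {-R..R} q \<le> 4 * R"
      unfolding q_def using R
      by (subst integral_add) (auto intro!: integrable_continuous_real cont)
    have Qq: "Q E \<le> q E * sqrt (norm (transfer E (ws1 @ ws2) (1, 0)))" "1 \<le> q E" if "E \<in> {-R..R}" for E
    proof -
      have "0 \<le> Q E" using q1(2)[OF that] by (simp add: Q_def)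
      then show "1 \<le> q E" by (simp add: q_def inv_sqrt_norm_def)
      have "transfer E (ws1 @ ws2) (1, 0) \<noteq> 0" by (simp add: unit_nonzero)
      then show "Q E \<le> q E * sqrt (norm (transfer E (ws1 @ ws2) (1, 0)))"
        by (simp add: q_def inv_sqrt_norm_def y_def transfer_append distrib_right)
    qed
    show ?case
    proof (intro exI conjI ballI allI impI)
      show "lifted c vs (ws1 @ ws2)"
        using ws1 ws2(1) vs by (simp add: lifted_def list_all2_appendI)
      show "continuous_on {-R..R} q" by (rule q)
      show "integral {-R..R} q \<le> 4 * R" by (rule int)
      fix E assume E: "E \<in> {-R..R}"
      show "0 \<le> q E" using Qq(2)[OF E] by simp
      fix m assume m: "m \<le> Suc p"
      have len2: "length ws2 = N" using ws2(1) vs(3) by (auto simp: lifted_def dest: list_all2_lengthD)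
      show "2 ^ m * sqrt (norm (transfer E (take ((Suc p - m) * N) (ws1 @ ws2)) (1, 0)))
            \<le> q E * sqrt (norm (transfer E (ws1 @ ws2) (1, 0)))"
      proof (cases m)
        case 0
        then show ?thesis using Qq(2)[OF E] len1 len2
            mult_right_mono[of 1 "q E" "sqrt (norm (transfer E (ws1 @ ws2) (1, 0)))"] by simp
      next
        case (Suc j)
        then have j: "j \<le> p" using m by simp
        have "(p - j) * N \<le> length ws1" using len1 by simp
        then have take: "take ((Suc p - m) * N) (ws1 @ ws2) = take ((p - j) * N) ws1" using Suc by simp
        have "2 ^ m * sqrt (norm (transfer E (take ((Suc p - m) * N) (ws1 @ ws2)) (1, 0)))
            \<le> 2 * (q1 E * sqrt (norm (y E)))"
          using decay[OF E j] unfolding take y_def by (simp add: Suc)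
        also have "\<dots> = Q E" by (simp add: Q_def)
        also have "\<dots> \<le> q E * sqrt (norm (transfer E (ws1 @ ws2) (1, 0)))" by (rule Qq(1)[OF E])
        finally show ?thesis .
      qed
    qed
  qed
  then show thesis using that N(1) by blast
qed

section \<open>Symmetric matrices and rank-one averaging\<close>

definition inner_on :: "'a set \<Rightarrow> ('a \<Rightarrow> real) \<Rightarrow> ('a \<Rightarrow> real) \<Rightarrow> real" where
  "inner_on I f g = (\<Sum>i\<in>I. f i * g i)"

definition mat_vec :: "'a set \<Rightarrow> ('a \<Rightarrow> 'a \<Rightarrow> real) \<Rightarrow> ('a \<Rightarrow> real) \<Rightarrow> 'a \<Rightarrow> real" where
  "mat_vec I a f i = (\<Sum>j\<in>I. a i j * f j)"

text \<open>The vectors are functions on the whole type that vanish off \<open>I\<close>, so that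
  eigenvectors of boxes of different sizes can be compared directly and are extended by zero from
  the outset.\<close>

definition ortho_eigen :: "'a set \<Rightarrow> ('a \<Rightarrow> 'a \<Rightarrow> real) \<Rightarrow> nat \<Rightarrow> (nat \<Rightarrow> real) \<Rightarrow> (nat \<Rightarrow> 'a \<Rightarrow> real) \<Rightarrow> bool" where
  "ortho_eigen I a n F \<phi> \<longleftrightarrow>
     (\<forall>k<n. \<forall>i. i \<notin> I \<longrightarrow> \<phi> k i = 0) \<and>
     (\<forall>k<n. \<forall>i\<in>I. mat_vec I a (\<phi> k) i = F k * \<phi> k i) \<and>
     (\<forall>k<n. \<forall>l<n. inner_on I (\<phi> k) (\<phi> l) = (if k = l then 1 else 0))"

lemma inner_on_commute: "inner_on I f g = inner_on I g f"
  by (simp add: inner_on_def mult.commute)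

lemma inner_on_add_left: "inner_on I (\<lambda>i. f i + g i) h = inner_on I f h + inner_on I g h"
  and inner_on_diff_left: "inner_on I (\<lambda>i. f i - g i) h = inner_on I f h - inner_on I g h"
  and inner_on_scale_left: "inner_on I (\<lambda>i. c * f i) h = c * inner_on I f h"
  and inner_on_add_right: "inner_on I h (\<lambda>i. f i + g i) = inner_on I h f + inner_on I h g"
  and inner_on_diff_right: "inner_on I h (\<lambda>i. f i - g i) = inner_on I h f - inner_on I h g"
  and inner_on_scale_right: "inner_on I h (\<lambda>i. c * f i) = c * inner_on I h f"
  by (simp_all add: inner_on_def sum.distrib sum_subtractf sum_distrib_left algebra_simps)

lemmas inner_on_linear = inner_on_add_left inner_on_diff_left inner_on_scale_left
  inner_on_add_right inner_on_diff_right inner_on_scale_right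

lemma inner_on_sum_left: "inner_on I (\<lambda>i. \<Sum>k\<in>K. g k i) h = (\<Sum>k\<in>K. inner_on I (g k) h)"
  unfolding inner_on_def sum_distrib_right by (rule sum.swap)

lemma inner_on_self_nonneg: "0 \<le> inner_on I f f"
  by (auto simp: inner_on_def intro!: sum_nonneg)

lemma inner_on_self_eq_0: "finite I \<Longrightarrow> inner_on I f f = 0 \<longleftrightarrow> (\<forall>i\<in>I. f i = 0)"
  unfolding inner_on_def by (subst sum_nonneg_eq_0_iff) auto

lemma inner_on_cong: "(\<And>i. i \<in> I \<Longrightarrow> f i = f' i) \<Longrightarrow> (\<And>i. i \<in> I \<Longrightarrow> g i = g' i) \<Longrightarrow> inner_on I f g = inner_on I f' g'"
  unfolding inner_on_def by (rule sum.cong) auto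

lemma mat_vec_linear: "mat_vec I a (\<lambda>i. f i + c * g i) = (\<lambda>i. mat_vec I a f i + c * mat_vec I a g i)"
  by (rule ext) (simp add: mat_vec_def sum.distrib sum_distrib_left algebra_simps)

lemma inner_on_mat_vec_commute:
  assumes "\<And>i j. i \<in> I \<Longrightarrow> j \<in> I \<Longrightarrow> a i j = a j i"
  shows "inner_on I f (mat_vec I a g) = inner_on I (mat_vec I a f) g"
proof -
  have "inner_on I f (mat_vec I a g) = (\<Sum>i\<in>I. \<Sum>j\<in>I. f i * a i j * g j)"
    by (simp add: inner_on_def mat_vec_def sum_distrib_left mult.assoc)
  also have "\<dots> = (\<Sum>j\<in>I. \<Sum>i\<in>I. f i * a i j * g j)" by (rule sum.swap)
  also have "\<dots> = (\<Sum>j\<in>I. \<Sum>i\<in>I. (a j i * f i) * g j)"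
    using assms by (intro sum.cong refl) (auto simp: mult_ac)
  also have "\<dots> = inner_on I (mat_vec I a f) g"
    by (simp add: inner_on_def mat_vec_def sum_distrib_right)
  finally show ?thesis .
qed

text \<open>Tychonoff's theorem; it provides both the compact unit spheres of the spectral theorem
  and the limits of eigenvectors of growing boxes.\<close>

lemma compact_functions_PiE:
  fixes S :: "'a \<Rightarrow> real set"
  assumes "\<And>i. compact (S i)"
  shows "compact (Pi\<^sub>E UNIV S)"
  using assms compactin_PiE[of "\<lambda>_. euclidean :: real topology" UNIV S]
  by (simp add: euclidean_product_topology)

text \<open>\<open>r\<close> is the unit vector at \<open>i\<close> minus its projection onto the
  family. Its norm yields Bessel's inequality, and completeness when \<open>r\<close>
  vanishes.\<close>

lemma ortho_eigen_residual:
  assumes I: "finite I" "i \<in> I" and oe: "ortho_eigen I a n F \<phi>"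
  defines "r \<equiv> \<lambda>j. (if j = i then 1 else 0) - (\<Sum>k<n. \<phi> k i * \<phi> k j)"
  shows "\<And>k. k < n \<Longrightarrow> inner_on I r (\<phi> k) = 0"
    and "inner_on I r r = 1 - (\<Sum>k<n. (\<phi> k i)\<^sup>2)"
proof -
  have e: "inner_on I (\<lambda>j. if j = i then 1 else 0) f = f i" for f
    using I by (simp add: inner_on_def if_distrib[of "\<lambda>x. x * _"] cong: if_cong)
  have on: "inner_on I (\<phi> k) (\<phi> l) = (if k = l then 1 else 0)" if "k < n" "l < n" for k l
    using oe that by (auto simp: ortho_eigen_def)
  have s: "inner_on I (\<lambda>j. \<Sum>k<n. \<phi> k i * \<phi> k j) (\<phi> l) = \<phi> l i" if "l < n" for l
  proof -
    have "inner_on I (\<lambda>j. \<Sum>k<n. \<phi> k i * \<phi> k j) (\<phi> l) = (\<Sum>k<n. \<phi> k i * (if k = l then 1 else 0))"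
      unfolding inner_on_sum_left inner_on_scale_left using that by (intro sum.cong) (auto simp: on)
    also have "\<dots> = \<phi> l i" using that by (simp add: if_distrib cong: if_cong)
    finally show ?thesis .
  qed
  show r: "inner_on I r (\<phi> k) = 0" if "k < n" for k
    unfolding r_def inner_on_diff_left e s[OF that] by simp
  have "inner_on I (\<lambda>j. \<Sum>k<n. \<phi> k i * \<phi> k j) r = 0"
    unfolding inner_on_sum_left inner_on_scale_left using r by (subst inner_on_commute) simp
  then have "inner_on I r r = r i"
    by (subst (1) r_def) (simp add: inner_on_diff_left e)
  then show "inner_on I r r = 1 - (\<Sum>k<n. (\<phi> k i)\<^sup>2)" by (simp add: r_def power2_eq_square)
qed

text \<open>The sum of the squared norms is rearranged by sites; each site contributes at most 1 by
  Bessel.\<close>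

lemma ortho_eigen_card_le:
  assumes I: "finite I" and oe: "ortho_eigen I a n F \<phi>"
  shows "n \<le> card I"
proof -
  have "real n = (\<Sum>k<n. inner_on I (\<phi> k) (\<phi> k))" using oe by (simp add: ortho_eigen_def)
  also have "\<dots> = (\<Sum>i\<in>I. \<Sum>k<n. (\<phi> k i)\<^sup>2)"
    unfolding inner_on_def power2_eq_square by (rule sum.swap)
  also have "\<dots> \<le> (\<Sum>i\<in>I. 1)"
  proof (rule sum_mono)
    fix i assume "i \<in> I"
    from ortho_eigen_residual(2)[OF I this oe] show "(\<Sum>k<n. (\<phi> k i)\<^sup>2) \<le> 1"
      using inner_on_self_nonneg[of I] by (smt (verit))
  qed
  finally show ?thesis by simp
qed

text \<open>A minimizer of the quadratic form on the unit sphere of the orthogonal complement is an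
  eigenvector. The defect \<open>g\<close> of the eigenvalue equation is itself an admissible
  direction, because the complement is invariant, and moving against it would lower the form unless
  \<open>g\<close> = 0.\<close>

lemma ortho_eigen_extend:
  assumes I: "finite I" and sym: "\<And>i j. i \<in> I \<Longrightarrow> j \<in> I \<Longrightarrow> a i j = a j i"
    and oe: "ortho_eigen I a n F \<phi>"
    and r: "\<And>k. k < n \<Longrightarrow> inner_on I r (\<phi> k) = 0" "inner_on I r r \<noteq> 0"
  shows "\<exists>F \<phi>. ortho_eigen I a (Suc n) F \<phi>"
proof -
  define W where "W = {f. (\<forall>i. i \<notin> I \<longrightarrow> f i = 0) \<and> (\<forall>k<n. inner_on I f (\<phi> k) = 0)}"
  define S where "S = {f \<in> W. inner_on I f f = 1}"
  define R where "R f = inner_on I f (mat_vec I a f)" for f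
  have W_add: "(\<lambda>i. f i + c * g i) \<in> W" if "f \<in> W" "g \<in> W" for f g c
    using that by (auto simp: W_def inner_on_linear)
  have W_scale: "(\<lambda>i. c * f i) \<in> W" if "f \<in> W" for f c
    using that by (auto simp: W_def inner_on_linear)
  have cont_coord: "continuous_on A (\<lambda>f. f i)" for A :: "('a \<Rightarrow> real) set" and i
    by (rule continuous_on_subset[OF continuous_on_product_coordinates]) auto
  have cont_inner: "continuous_on A (\<lambda>f. inner_on I f h)" "continuous_on A (\<lambda>f. inner_on I f f)" "continuous_on A R"
    for A :: "('a \<Rightarrow> real) set" and h
    unfolding inner_on_def R_def mat_vec_def by (intro continuous_intros cont_coord)+
  have "compact S"
  proof -
    let ?K = "Pi\<^sub>E UNIV (\<lambda>i. if i \<in> I then {-1..1} else {0::real})"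
    have K: "compact ?K" by (rule compact_functions_PiE) auto
    have "S \<subseteq> ?K"
    proof
      fix f assume f: "f \<in> S"
      have "\<bar>f i\<bar> \<le> 1" if "i \<in> I" for i
      proof -
        have "f i * f i \<le> inner_on I f f"
          unfolding inner_on_def using I that by (intro member_le_sum) auto
        then have "(f i)\<^sup>2 \<le> 1\<^sup>2" using f by (simp add: S_def power2_eq_square)
        then show ?thesis by (simp only: abs_le_square_iff[symmetric] abs_one)
      qed
      then have "f i \<in> (if i \<in> I then {-1..1} else {0})" for i
        using f by (auto simp: S_def W_def abs_le_iff minus_le_iff)
      then show "f \<in> ?K" by auto
    qed
    moreover have "closed S"
    proof -
      have "closed {f :: _ \<Rightarrow> real. f i = 0}" for i :: 'a
        by (intro closed_Collect_eq continuous_on_const cont_coord)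
      moreover have "closed {f :: _ \<Rightarrow> real. inner_on I f (\<phi> k) = 0}" for k
        by (intro closed_Collect_eq continuous_on_const cont_inner)
      moreover have "closed {f :: _ \<Rightarrow> real. inner_on I f f = 1}"
        by (intro closed_Collect_eq continuous_on_const cont_inner)
      moreover have "S = (\<Inter>i\<in>-I. {f. f i = 0}) \<inter> (\<Inter>k\<in>{..<n}. {f. inner_on I f (\<phi> k) = 0}) \<inter> {f. inner_on I f f = 1}"
        by (auto simp: S_def W_def)
      ultimately show ?thesis by (auto intro!: closed_Int closed_INT)
    qed
    ultimately show ?thesis using K by (metis compact_Int_closed inf.absorb_iff2)
  qed
  moreover have "S \<noteq> {}"
  proof -
    define s where "s = 1 / sqrt (inner_on I r r)"
    have pos: "inner_on I r r > 0" using r(2) inner_on_self_nonneg[of I r] by simp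
    define f where "f i = (if i \<in> I then s * r i else 0)" for i
    have "inner_on I f g = s * inner_on I r g" for g
      unfolding inner_on_scale_left[symmetric] by (rule inner_on_cong) (auto simp: f_def)
    moreover have "inner_on I r f = s * inner_on I r r"
      unfolding inner_on_scale_right[symmetric] by (rule inner_on_cong) (auto simp: f_def)
    moreover have "s * (s * inner_on I r r) = 1" using pos by (simp add: s_def field_simps)
    ultimately have "f \<in> S" using r(1) by (simp add: S_def W_def f_def)
    then show ?thesis by blast
  qed
  ultimately obtain f0 where f0: "f0 \<in> S" "\<And>f. f \<in> S \<Longrightarrow> R f0 \<le> R f"
    using continuous_attains_inf[of S R] cont_inner(3) by blast
  define c where "c = R f0"
  have f0W: "f0 \<in> W" and f01: "inner_on I f0 f0 = 1" using f0 by (auto simp: S_def)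
  have low: "c * inner_on I f f \<le> R f" if f: "f \<in> W" for f
  proof (cases "inner_on I f f = 0")
    case True
    then have "\<forall>i\<in>I. f i = 0" using inner_on_self_eq_0[OF I] by blast
    then have "R f = 0" by (simp add: R_def inner_on_def)
    then show ?thesis using True by simp
  next
    case False
    then have pos: "inner_on I f f > 0" using inner_on_self_nonneg[of I f] by simp
    define s where "s = 1 / sqrt (inner_on I f f)"
    have s: "s\<^sup>2 = 1 / inner_on I f f" "s * (s * inner_on I f f) = 1"
      using pos by (simp_all add: s_def power_divide field_simps)
    have "(\<lambda>i. s * f i) \<in> S" using s(2) W_scale[OF f] by (simp add: S_def inner_on_linear)
    then have "c \<le> R (\<lambda>i. s * f i)" using f0(2) by (simp add: c_def)
    also have "R (\<lambda>i. s * f i) = s\<^sup>2 * R f"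
      using mat_vec_linear[of I a "\<lambda>_. 0" s f]
      by (simp add: R_def inner_on_linear power2_eq_square mat_vec_def[of I a "\<lambda>_. 0"] mult.assoc)
    finally show ?thesis using pos by (simp add: s field_simps)
  qed
  define g where "g i = (if i \<in> I then mat_vec I a f0 i - c * f0 i else 0)" for i
  have gI: "inner_on I g h = inner_on I (mat_vec I a f0) h - c * inner_on I f0 h" for h
    unfolding inner_on_scale_left[symmetric] inner_on_diff_left[symmetric] by (rule inner_on_cong) (auto simp: g_def)
  have gW: "g \<in> W"
  proof -
    have "inner_on I g (\<phi> k) = 0" if k: "k < n" for k
    proof -
      have "inner_on I (mat_vec I a f0) (\<phi> k) = inner_on I f0 (mat_vec I a (\<phi> k))"
        by (rule inner_on_mat_vec_commute[OF sym, symmetric]) auto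
      also have "\<dots> = inner_on I f0 (\<lambda>i. F k * \<phi> k i)"
        using oe k by (intro inner_on_cong) (auto simp: ortho_eigen_def)
      also have "\<dots> = 0" using f0W k by (simp add: inner_on_linear W_def)
      finally show ?thesis using f0W k by (simp add: gI W_def)
    qed
    then show ?thesis by (auto simp: W_def g_def)
  qed
  have g0: "inner_on I g g = 0"
  proof (rule ccontr)
    assume "inner_on I g g \<noteq> 0"
    then have G: "inner_on I g g > 0" using inner_on_self_nonneg[of I g] by simp
    define D where "D = R g - c * inner_on I g g"
    have ineq: "0 \<le> 2 * t * inner_on I g g + t\<^sup>2 * D" for t
    proof -
      define X Y where "X = inner_on I (mat_vec I a f0) g" and "Y = inner_on I f0 g"
      have e: "inner_on I f0 (mat_vec I a g) = X" "inner_on I g (mat_vec I a f0) = X" "inner_on I g f0 = Y"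
        "inner_on I f0 (mat_vec I a f0) = c" "inner_on I g (mat_vec I a g) = R g" "inner_on I f0 g = Y"
        unfolding X_def Y_def c_def R_def
        by (auto intro: inner_on_commute inner_on_mat_vec_commute[OF sym])
      have "R (\<lambda>i. f0 i + t * g i) = c + t * X + t * (X + t * R g)"
        unfolding R_def[of "\<lambda>i. f0 i + t * g i"] mat_vec_linear inner_on_linear e by (simp add: algebra_simps)
      moreover have "inner_on I (\<lambda>i. f0 i + t * g i) (\<lambda>i. f0 i + t * g i) = 1 + t * Y + t * (Y + t * inner_on I g g)"
        unfolding inner_on_linear e f01 by (simp add: algebra_simps)
      moreover have "c * inner_on I (\<lambda>i. f0 i + t * g i) (\<lambda>i. f0 i + t * g i) \<le> R (\<lambda>i. f0 i + t * g i)"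
        by (rule low[OF W_add[OF f0W gW]])
      ultimately have "c * (1 + t * Y + t * (Y + t * inner_on I g g)) \<le> c + t * X + t * (X + t * R g)" by simp
      then have "0 \<le> 2 * t * (X - c * Y) + t\<^sup>2 * (R g - c * inner_on I g g)"
        by (simp add: power2_eq_square algebra_simps)
      then show ?thesis unfolding D_def X_def Y_def gI[of g, symmetric] .
    qed
    \<comment> \<open>Small enough that the quadratic term cannot outweigh half of the linear one;
      the + 1 guards against D = 0.\<close>
    define t where "t = - inner_on I g g / (\<bar>D\<bar> + 1)"
    have "t\<^sup>2 * D \<le> t\<^sup>2 * (\<bar>D\<bar> + 1)" by (intro mult_left_mono) auto
    also have "\<dots> = t * (t * (\<bar>D\<bar> + 1))" by (simp add: power2_eq_square mult.assoc)
    also have "t * (\<bar>D\<bar> + 1) = - inner_on I g g" by (simp add: t_def add_nonneg_eq_0_iff)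
    finally have "0 \<le> t * inner_on I g g" using ineq[of t] by (simp add: mult.assoc)
    moreover have "t < 0" using G by (simp add: t_def divide_neg_pos)
    ultimately show False using G by (simp add: zero_le_mult_iff)
  qed
  have eig: "mat_vec I a f0 i = c * f0 i" if "i \<in> I" for i
    using g0 that inner_on_self_eq_0[OF I, of g] by (auto simp: g_def)
  have perp: "inner_on I f0 (\<phi> k) = 0" "inner_on I (\<phi> k) f0 = 0" if "k < n" for k
    using f0W that inner_on_commute[of I f0 "\<phi> k"] by (auto simp: W_def)
  have "ortho_eigen I a (Suc n) (F(n := c)) (\<phi>(n := f0))"
    using oe eig f0W f01 perp by (auto simp: ortho_eigen_def less_Suc_eq W_def)
  then show ?thesis by blast
qed

theorem symmetric_spectral:
  assumes I: "finite I" and sym: "\<And>i j. i \<in> I \<Longrightarrow> j \<in> I \<Longrightarrow> a i j = a j i"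
  obtains n F \<phi> where "ortho_eigen I a n F \<phi>"
    "\<And>i j. i \<in> I \<Longrightarrow> j \<in> I \<Longrightarrow> (\<Sum>k<n. \<phi> k i * \<phi> k j) = (if j = i then 1 else 0)"
proof -
  define P where "P n \<longleftrightarrow> (\<exists>F \<phi>. ortho_eigen I a n F \<phi>)" for n
  have "P 0" by (simp add: P_def ortho_eigen_def)
  moreover have "\<And>n. P n \<Longrightarrow> n \<le> card I" using ortho_eigen_card_le[OF I] by (auto simp: P_def)
  \<comment> \<open>A family of maximal size; a nonzero residual of some unit vector would extend
    it.\<close>
  ultimately obtain n where n: "P n" "\<not> P (Suc n)"
    by (metis Suc_n_not_le_n nat_induct)
  then obtain F \<phi> where oe: "ortho_eigen I a n F \<phi>" by (auto simp: P_def)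
  have "(\<Sum>k<n. \<phi> k i * \<phi> k j) = (if j = i then 1 else 0)" if ij: "i \<in> I" "j \<in> I" for i j
  proof -
    define r where "r = (\<lambda>j. (if j = i then 1 else 0) - (\<Sum>k<n. \<phi> k i * \<phi> k j))"
    have "inner_on I r (\<phi> k) = 0" if "k < n" for k
      unfolding r_def by (rule ortho_eigen_residual(1)[OF I ij(1) oe that])
    then have "inner_on I r r = 0"
      using ortho_eigen_extend[OF I sym oe, of r] n(2) by (auto simp: P_def)
    then have "r j = 0" using inner_on_self_eq_0[OF I] ij by blast
    then show ?thesis by (simp add: r_def split: if_splits)
  qed
  with oe show thesis by (rule that)
qed

text \<open>Completeness is recorded as a resolution of the identity entry by entry, the form in
  which sums over eigenvectors at a fixed site occur later.\<close>

definition eigenbasis :: "'a set \<Rightarrow> ('a \<Rightarrow> 'a \<Rightarrow> real) \<Rightarrow> nat \<Rightarrow> (nat \<Rightarrow> real) \<Rightarrow> (nat \<Rightarrow> 'a \<Rightarrow> real) \<Rightarrow> bool" where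
  "eigenbasis I a n F \<phi> \<longleftrightarrow> ortho_eigen I a n F \<phi> \<and>
     (\<forall>i\<in>I. \<forall>j\<in>I. (\<Sum>k<n. \<phi> k i * \<phi> k j) = (if j = i then 1 else 0))"

section \<open>Resolvents and rank-one perturbations\<close>

definition perturb_diag :: "('a \<Rightarrow> 'a \<Rightarrow> real) \<Rightarrow> 'a \<Rightarrow> real \<Rightarrow> 'a \<Rightarrow> 'a \<Rightarrow> real" where
  "perturb_diag a p t = (\<lambda>i j. a i j + (if i = p \<and> j = p then t else 0))"

lemma eigenbasis_exists:
  assumes "finite I" "\<And>i j. i \<in> I \<Longrightarrow> j \<in> I \<Longrightarrow> a i j = a j i"
  obtains n F \<phi> where "eigenbasis I a n F \<phi>"
proof (rule symmetric_spectral[where I = I and a = a, OF assms])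
  fix n F \<phi>
  assume "ortho_eigen I a n F \<phi>"
    "\<And>i j. i \<in> I \<Longrightarrow> j \<in> I \<Longrightarrow> (\<Sum>k<n. \<phi> k i * \<phi> k j) = (if j = i then 1 else 0)"
  then show thesis by (intro that[of n F \<phi>]) (simp add: eigenbasis_def)
qed

text \<open>The entries (p, i) of the resolvent (z - a)^(-1) in spectral form.\<close>

definition green :: "nat \<Rightarrow> (nat \<Rightarrow> real) \<Rightarrow> (nat \<Rightarrow> 'a \<Rightarrow> real) \<Rightarrow> 'a \<Rightarrow> complex \<Rightarrow> 'a \<Rightarrow> complex" where
  "green n F \<phi> p z i = (\<Sum>k<n. of_real (\<phi> k p * \<phi> k i) / (z - of_real (F k)))"

lemma green_equation:
  assumes I: "finite I" and p: "p \<in> I" and eb: "eigenbasis I a n F \<phi>" and z: "Im z \<noteq> 0" and i: "i \<in> I"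
  shows "(\<Sum>j\<in>I. of_real (a i j) * green n F \<phi> p z j) = z * green n F \<phi> p z i - (if i = p then 1 else 0)"
proof -
  have zF: "z - of_real (F k) \<noteq> 0" for k using z by (auto simp: complex_eq_iff)
  have "(\<Sum>j\<in>I. of_real (a i j) * green n F \<phi> p z j)
      = (\<Sum>j\<in>I. \<Sum>k<n. of_real (\<phi> k p) / (z - of_real (F k)) * of_real (a i j * \<phi> k j))"
    by (simp add: green_def sum_distrib_left mult_ac)
  also have "\<dots> = (\<Sum>k<n. \<Sum>j\<in>I. of_real (\<phi> k p) / (z - of_real (F k)) * of_real (a i j * \<phi> k j))"
    by (rule sum.swap)
  also have "\<dots> = (\<Sum>k<n. of_real (\<phi> k p) / (z - of_real (F k)) * of_real (mat_vec I a (\<phi> k) i))"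
    by (simp add: mat_vec_def sum_distrib_left)
  also have "\<dots> = (\<Sum>k<n. z * (of_real (\<phi> k p * \<phi> k i) / (z - of_real (F k))) - of_real (\<phi> k p * \<phi> k i))"
  proof (rule sum.cong[OF refl])
    fix k assume "k \<in> {..<n}"
    then have "mat_vec I a (\<phi> k) i = F k * \<phi> k i" using eb i by (auto simp: eigenbasis_def ortho_eigen_def)
    then show "of_real (\<phi> k p) / (z - of_real (F k)) * of_real (mat_vec I a (\<phi> k) i)
       = z * (of_real (\<phi> k p * \<phi> k i) / (z - of_real (F k))) - of_real (\<phi> k p * \<phi> k i)"
      using zF[of k] by (simp add: field_simps)
  qed
  also have "\<dots> = z * green n F \<phi> p z i - of_real (\<Sum>k<n. \<phi> k p * \<phi> k i)"
    by (simp add: green_def sum_subtractf sum_distrib_left)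
  also have "(\<Sum>k<n. \<phi> k p * \<phi> k i) = (if i = p then 1 else 0)"
    using eb p i by (auto simp: eigenbasis_def)
  finally show ?thesis by (simp split: if_splits)
qed

text \<open>The resolvent identity at (p, p). The bilinear form of the perturbed matrix between the
  two resolvent rows is evaluated by letting the matrix act on either side; rank one leaves a single
  product as the difference.\<close>

lemma green_rank_one:
  assumes I: "finite I" and p: "p \<in> I" and sym: "\<And>i j. i \<in> I \<Longrightarrow> j \<in> I \<Longrightarrow> a i j = a j i"
    and eb: "eigenbasis I a n F \<phi>" and eb': "eigenbasis I (perturb_diag a p t) n' F' \<phi>'" and z: "Im z \<noteq> 0"
  shows "green n' F' \<phi>' p z p - green n F \<phi> p z p = of_real t * green n F \<phi> p z p * green n' F' \<phi>' p z p"
proof -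
  let ?y = "green n F \<phi> p z" and ?y' = "green n' F' \<phi>' p z"
  have delta: "(\<Sum>i\<in>I. f i * (if i = p then 1 else 0)) = f p" for f :: "'a \<Rightarrow> complex"
    using I p by (simp add: if_distrib cong: if_cong)
  have e1: "(\<Sum>i\<in>I. ?y i * (\<Sum>j\<in>I. of_real (perturb_diag a p t i j) * ?y' j))
      = (\<Sum>i\<in>I. ?y i * (\<Sum>j\<in>I. of_real (a i j) * ?y' j)) + of_real t * ?y p * ?y' p"
  proof -
    have row: "(\<Sum>j\<in>I. of_real (perturb_diag a p t i j) * ?y' j)
        = (\<Sum>j\<in>I. of_real (a i j) * ?y' j) + (if i = p then 1 else 0) * (of_real t * ?y' p)" for i
    proof -
      have "of_real (perturb_diag a p t i j) * ?y' j
         = of_real (a i j) * ?y' j + (if j = p then (if i = p then 1 else 0) * (of_real t * ?y' p) else 0)" for j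
        by (cases "j = p"; cases "i = p") (simp_all add: perturb_diag_def distrib_right)
      then have "(\<Sum>j\<in>I. of_real (perturb_diag a p t i j) * ?y' j)
         = (\<Sum>j\<in>I. of_real (a i j) * ?y' j + (if j = p then (if i = p then 1 else 0) * (of_real t * ?y' p) else 0))"
        by (intro sum.cong refl)
      then show ?thesis using I p by (simp only: sum.distrib sum.delta) simp
    qed
    have "(\<Sum>i\<in>I. ?y i * (\<Sum>j\<in>I. of_real (perturb_diag a p t i j) * ?y' j))
      = (\<Sum>i\<in>I. ?y i * (\<Sum>j\<in>I. of_real (a i j) * ?y' j) + (?y i * (of_real t * ?y' p)) * (if i = p then 1 else 0))"
      unfolding row by (rule sum.cong[OF refl]) (simp only: distrib_left mult_ac)
    also have "\<dots> = (\<Sum>i\<in>I. ?y i * (\<Sum>j\<in>I. of_real (a i j) * ?y' j)) + ?y p * (of_real t * ?y' p)"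
      by (simp only: sum.distrib delta)
    finally show ?thesis by (simp only: mult_ac)
  qed
  have e2: "(\<Sum>i\<in>I. ?y i * (\<Sum>j\<in>I. of_real (perturb_diag a p t i j) * ?y' j)) = (\<Sum>i\<in>I. z * (?y i * ?y' i)) - ?y p"
  proof -
    have "(\<Sum>i\<in>I. ?y i * (\<Sum>j\<in>I. of_real (perturb_diag a p t i j) * ?y' j))
       = (\<Sum>i\<in>I. z * (?y i * ?y' i) - ?y i * (if i = p then 1 else 0))"
      by (rule sum.cong[OF refl], subst green_equation[OF I p eb' z]) (auto simp: algebra_simps)
    then show ?thesis by (simp only: sum_subtractf delta)
  qed
  have e3: "(\<Sum>i\<in>I. ?y i * (\<Sum>j\<in>I. of_real (a i j) * ?y' j)) = (\<Sum>i\<in>I. z * (?y i * ?y' i)) - ?y' p"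
  proof -
    have "(\<Sum>i\<in>I. ?y i * (\<Sum>j\<in>I. of_real (a i j) * ?y' j)) = (\<Sum>i\<in>I. \<Sum>j\<in>I. ?y i * (of_real (a i j) * ?y' j))"
      by (simp add: sum_distrib_left)
    also have "\<dots> = (\<Sum>j\<in>I. \<Sum>i\<in>I. ?y i * (of_real (a i j) * ?y' j))" by (rule sum.swap)
    also have "\<dots> = (\<Sum>j\<in>I. (\<Sum>i\<in>I. of_real (a j i) * ?y i) * ?y' j)"
      unfolding sum_distrib_right by (intro sum.cong refl) (auto simp: sym mult_ac)
    also have "\<dots> = (\<Sum>j\<in>I. z * (?y j * ?y' j) - ?y' j * (if j = p then 1 else 0))"
      by (rule sum.cong[OF refl], subst green_equation[OF I p eb z]) (auto simp: algebra_simps)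
    finally show ?thesis by (simp only: sum_subtractf delta)
  qed
  show ?thesis using e1 unfolding e2 e3 by (simp add: algebra_simps)
qed

text \<open>The right side is pi times the Poisson smoothing, at width \<open>\<delta>\<close>, of
  the spectral measure at \<open>p\<close>.\<close>

lemma Im_green:
  "- Im (green n F \<phi> p (Complex E \<delta>) p) = (\<Sum>k<n. (\<phi> k p)\<^sup>2 * (\<delta> / ((E - F k)\<^sup>2 + \<delta>\<^sup>2)))"
proof -
  have "green n F \<phi> p (Complex E \<delta>) p = (\<Sum>k<n. of_real ((\<phi> k p)\<^sup>2) / Complex (E - F k) \<delta>)"
  proof -
    have "Complex E \<delta> - of_real x = Complex (E - x) \<delta>" for x by (simp add: complex_eq_iff)
    then show ?thesis by (simp add: green_def power2_eq_square)
  qed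
  then show ?thesis
    by (simp add: Im_sum sum_negf[symmetric] Im_divide power2_eq_square)
qed

lemma eigenbasis_sum_squares:
  assumes "eigenbasis I a n F \<phi>" "p \<in> I"
  shows "(\<Sum>k<n. (\<phi> k p)\<^sup>2) = 1"
  using assms by (auto simp: eigenbasis_def power2_eq_square)

lemma arctan_quotient_deriv:
  fixes x y :: real
  assumes "0 < y"
  shows "- (inverse (1 + (x / y)\<^sup>2) * (- 1 / y)) = y / (x\<^sup>2 + y\<^sup>2)"
proof -
  have "1 + (x / y)\<^sup>2 = (x\<^sup>2 + y\<^sup>2) / y\<^sup>2"
    using assms by (simp add: power_divide add_divide_distrib)
  then show ?thesis using assms by (simp add: power2_eq_square)
qed

text \<open>On average over t, the spectral measure at \<open>p\<close> is dominated by a multiple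
  of Lebesgue measure: adding t at \<open>p\<close> shifts 1/G by -t, so the smoothed measure is a
  Cauchy kernel in t, of integral at most pi. The smoothing spares any discussion of how eigenvalues
  depend on t; the -1 absorbs the oscillation of \<open>q\<close> at that scale.\<close>

theorem rank_one_averaging:
  fixes a :: "'a \<Rightarrow> 'a \<Rightarrow> real" and q :: "real \<Rightarrow> real"
  assumes I: "finite I" and p: "p \<in> I" and sym: "\<And>i j. i \<in> I \<Longrightarrow> j \<in> I \<Longrightarrow> a i j = a j i"
    and c: "0 < c" and q: "continuous_on {-R..R} q" "\<And>E. E \<in> {-R..R} \<Longrightarrow> 0 \<le> q E"
    and F: "\<And>t n F \<phi> k. t \<in> {0..c} \<Longrightarrow> eigenbasis I (perturb_diag a p t) n F \<phi> \<Longrightarrow> k < n \<Longrightarrow> \<bar>F k\<bar> \<le> R - 1"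
  shows "\<exists>t\<in>{0..c}. \<forall>n F \<phi>. eigenbasis I (perturb_diag a p t) n F \<phi> \<longrightarrow>
    (\<Sum>k<n. (\<phi> k p)\<^sup>2 * (q (F k) - 1)) \<le> pi / c * integral {-R..R} q"
proof -
  have "uniformly_continuous_on {-R..R} q"
    by (rule compact_uniformly_continuous[OF q(1)]) simp
  then obtain d where d: "d > 0" "\<And>E E'. E \<in> {-R..R} \<Longrightarrow> E' \<in> {-R..R} \<Longrightarrow> dist E' E < d \<Longrightarrow> dist (q E') (q E) < 1"
    unfolding uniformly_continuous_on_def by (elim allE[of _ 1]) auto
  \<comment> \<open>Less than the modulus of continuity of \<open>q\<close> for oscillation 1, and
    at most 1 so that the interval about F k stays inside {-R..R}.\<close>
  define \<delta> where "\<delta> = min (d / 2) 1"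
  have \<delta>: "0 < \<delta>" "\<delta> < d" "\<delta> \<le> 1" using d by (auto simp: \<delta>_def)
  obtain n0 F0 \<phi>\<^sub>0 where eb0: "eigenbasis I a n0 F0 \<phi>\<^sub>0" by (rule eigenbasis_exists[where I = I and a = a, OF I sym])
  define G where "G E = green n0 F0 \<phi>\<^sub>0 p (Complex E \<delta>) p" for E
  have ImG: "Im (G E) < 0" for E
  proof -
    have "0 < (\<Sum>k<n0. (\<phi>\<^sub>0 k p)\<^sup>2 * (\<delta> / ((E - F0 k)\<^sup>2 + \<delta>\<^sup>2)))"
    proof -
      have pos: "0 < \<delta> / ((E - F0 k)\<^sup>2 + \<delta>\<^sup>2)" for k using \<delta> by (intro divide_pos_pos add_nonneg_pos) auto
      have "\<exists>k<n0. \<phi>\<^sub>0 k p \<noteq> 0"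
      proof (rule ccontr)
        assume "\<not> ?thesis"
        then have "(\<Sum>k<n0. (\<phi>\<^sub>0 k p)\<^sup>2) = 0" by simp
        then show False using eigenbasis_sum_squares[OF eb0 p] by simp
      qed
      then obtain k where k: "k < n0" "\<phi>\<^sub>0 k p \<noteq> 0" by blast
      then show ?thesis using pos
        by (intro sum_pos2[of _ k] mult_pos_pos mult_nonneg_nonneg) (auto intro: less_imp_le)
    qed
    then show ?thesis using Im_green[of n0 F0 \<phi>\<^sub>0 p E \<delta>] by (simp add: G_def)
  qed
  have G0: "G E \<noteq> 0" for E using ImG[of E] by auto
  have contG: "continuous_on A G" for A
  proof -
    have "Complex E \<delta> - of_real (F0 k) \<noteq> 0" for E k using \<delta> by (simp add: complex_eq_iff)
    moreover have "continuous_on A (\<lambda>E. Complex E \<delta>)"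
      unfolding Complex_eq by (intro continuous_intros)
    ultimately show ?thesis unfolding G_def green_def by (intro continuous_intros) auto
  qed
  define X Y where "X E = Re (1 / G E)" and "Y E = Im (1 / G E)" for E
  have contXY: "continuous_on A X" "continuous_on A Y" for A
  proof -
    have "continuous_on A (\<lambda>E. 1 / G E)"
      using G0 by (intro continuous_on_divide continuous_on_const contG) auto
    then show "continuous_on A X" "continuous_on A Y"
      unfolding X_def Y_def by (rule continuous_on_Re, rule continuous_on_Im)
  qed
  have Y: "Y E > 0" for E
    unfolding Y_def using ImG[of E] G0[of E] by (simp add: Im_divide divide_neg_pos complex_neq_0)
  define h where "h t E = Y E / ((X E - t)\<^sup>2 + (Y E)\<^sup>2)" for t E
  have hden: "(X E - t)\<^sup>2 + (Y E)\<^sup>2 > 0" for t E using Y[of E] by (intro add_nonneg_pos) auto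
  have hne: "(X E - t)\<^sup>2 + (Y E)\<^sup>2 \<noteq> 0" for t E using hden[of E t] by linarith
  have conth: "continuous_on ({-R..R} \<times> {0..c}) (\<lambda>x. q (fst x) * h (snd x) (fst x))"
    unfolding h_def
    by (intro continuous_on_mult continuous_on_divide continuous_on_add continuous_on_power continuous_on_diff
        continuous_on_fst_comp continuous_on_snd continuous_on_id q contXY) (use hne in blast)
  have h_green: "(\<Sum>k<n. (\<phi> k p)\<^sup>2 * (\<delta> / ((E - F k)\<^sup>2 + \<delta>\<^sup>2))) = h t E"
    if eb: "eigenbasis I (perturb_diag a p t) n F \<phi>" for n F \<phi> t E
  proof -
    define G' where "G' = green n F \<phi> p (Complex E \<delta>) p"
    have "G' - G E = of_real t * G E * G'"
      unfolding G'_def G_def using \<delta> by (intro green_rank_one[OF I p sym eb0 eb]) auto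
    then have "G' * (1 / G E - of_real t) = 1" using G0[of E] by (simp add: field_simps)
    then have "G' = 1 / Complex (X E - t) (Y E)"
    proof -
      assume *: "G' * (1 / G E - of_real t) = 1"
      have "1 / G E - of_real t = Complex (X E - t) (Y E)" by (simp add: complex_eq_iff X_def Y_def)
      with * have "G' * Complex (X E - t) (Y E) = 1" by simp
      moreover from this have "Complex (X E - t) (Y E) \<noteq> 0" by auto
      ultimately show ?thesis by (simp add: eq_divide_eq)
    qed
    then have "- Im G' = h t E" by (simp add: Im_divide h_def)
    then show ?thesis using Im_green[of n F \<phi> p E \<delta>] by (simp add: G'_def)
  qed
  have int_h: "integral {0..c} (\<lambda>t. h t E) \<le> pi" for E
  proof -
    have "((\<lambda>t. h t E) has_integral (- arctan ((X E - c) / Y E) - - arctan ((X E - 0) / Y E))) {0..c}"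
    proof (rule fundamental_theorem_of_calculus)
      fix t assume "t \<in> {0..c}"
      have "((\<lambda>t. - arctan ((X E - t) / Y E)) has_real_derivative
          - (inverse (1 + ((X E - t) / Y E)\<^sup>2) * (- 1 / Y E))) (at t within {0..c})"
        using Y[of E] by (auto intro!: derivative_eq_intros)
      also have "- (inverse (1 + ((X E - t) / Y E)\<^sup>2) * (- 1 / Y E)) = h t E"
        unfolding h_def by (rule arctan_quotient_deriv[OF Y])
      finally show "((\<lambda>t. - arctan ((X E - t) / Y E)) has_vector_derivative h t E) (at t within {0..c})"
        by (simp add: has_real_derivative_iff_has_vector_derivative)
    qed (use c in auto)
    then have "integral {0..c} (\<lambda>t. h t E) = arctan (X E / Y E) - arctan ((X E - c) / Y E)"
      by (simp add: integral_unique)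
    then show ?thesis using arctan_bounded[of "X E / Y E"] arctan_bounded[of "(X E - c) / Y E"] by linarith
  qed
  have swap: "integral {0..c} (\<lambda>t. integral {-R..R} (\<lambda>E. q E * h t E)) = integral {-R..R} (\<lambda>E. integral {0..c} (\<lambda>t. q E * h t E))"
    using integral_swap_continuous[of "-R" 0 R c "\<lambda>E t. q E * h t E"] conth
    by (simp add: cbox_Pair_eq case_prod_unfold)
  have cont_t: "continuous_on {0..c} (\<lambda>t. integral {-R..R} (\<lambda>E. q E * h t E))"
  proof -
    have "continuous_on ({0..c} \<times> {-R..R}) (\<lambda>(t, E). q E * h t E)"
      using continuous_on_compose2[OF conth, of "{0..c} \<times> {-R..R}" prod.swap]
      by (simp add: case_prod_unfold continuous_on_swap product_swap)
    then show ?thesis using integral_continuous_on_param[of "{0..c}" "-R" R "\<lambda>t E. q E * h t E"] by simp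
  qed
  obtain t where t: "t \<in> {0..c}" "integral {-R..R} (\<lambda>E. q E * h t E) \<le> integral {0..c} (\<lambda>t. integral {-R..R} (\<lambda>E. q E * h t E)) / c"
    using exists_le_average[OF c cont_t] by blast
  have "integral {-R..R} (\<lambda>E. integral {0..c} (\<lambda>t. q E * h t E)) \<le> integral {-R..R} (\<lambda>E. q E * pi)"
  proof (rule integral_le)
    have "continuous_on ({-R..R} \<times> {0..c}) (\<lambda>(E, t). q E * h t E)" using conth by (simp add: case_prod_unfold)
    then have "continuous_on {-R..R} (\<lambda>E. integral {0..c} (\<lambda>t. q E * h t E))"
      using integral_continuous_on_param[of "{-R..R}" 0 c "\<lambda>E t. q E * h t E"] by simp
    then show "(\<lambda>E. integral {0..c} (\<lambda>t. q E * h t E)) integrable_on {-R..R}" by (rule integrable_continuous_real)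
    show "(\<lambda>E. q E * pi) integrable_on {-R..R}" by (intro integrable_continuous_real continuous_intros q)
    show "integral {0..c} (\<lambda>t. q E * h t E) \<le> q E * pi" if "E \<in> {-R..R}" for E
      using q(2)[OF that] int_h[of E] by (simp add: mult_left_mono)
  qed
  then have t2: "integral {-R..R} (\<lambda>E. q E * h t E) \<le> pi / c * integral {-R..R} q"
    using t(2) c unfolding swap by (simp add: field_simps)
  show ?thesis
  proof (intro bexI[OF _ t(1)] allI impI)
    fix n F' \<phi> assume eb: "eigenbasis I (perturb_diag a p t) n F' \<phi>"
    have contk: "continuous_on {-R..R} (\<lambda>E. q E * (\<delta> / ((E - F' k)\<^sup>2 + \<delta>\<^sup>2)))" for k
    proof -
      have "(E - F' k)\<^sup>2 + \<delta>\<^sup>2 \<noteq> 0" for E using \<delta> by (simp add: sum_power2_eq_zero_iff)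
      then show ?thesis by (intro continuous_intros q) auto
    qed
    \<comment> \<open>On the interval of radius \<open>\<delta>\<close> about F' k the kernel is at
      least 1 / (2 \<delta>), and \<open>q\<close> is at least q (F' k) - 1 there.\<close>
    have lower: "q (F' k) - 1 \<le> integral {-R..R} (\<lambda>E. q E * (\<delta> / ((E - F' k)\<^sup>2 + \<delta>\<^sup>2)))" if k: "k < n" for k
    proof -
      have Fk: "\<bar>F' k\<bar> \<le> R - 1" by (rule F[OF t(1) eb k])
      then have sub: "{F' k - \<delta>..F' k + \<delta>} \<subseteq> {-R..R}" using \<delta> by auto
      have "q (F' k) - 1 = integral {F' k - \<delta>..F' k + \<delta>} (\<lambda>E. (q (F' k) - 1) / (2 * \<delta>))"
        using \<delta> by (simp add: field_simps)
      also have "\<dots> \<le> integral {F' k - \<delta>..F' k + \<delta>} (\<lambda>E. q E * (\<delta> / ((E - F' k)\<^sup>2 + \<delta>\<^sup>2)))"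
      proof (rule integral_le)
        show "(\<lambda>E. q E * (\<delta> / ((E - F' k)\<^sup>2 + \<delta>\<^sup>2))) integrable_on {F' k - \<delta>..F' k + \<delta>}"
          by (rule integrable_continuous_real[OF continuous_on_subset[OF contk sub]])
        fix E assume E: "E \<in> {F' k - \<delta>..F' k + \<delta>}"
        then have ER: "E \<in> {-R..R}" using sub by blast
        have "\<bar>E - F' k\<bar> \<le> \<delta>" using E by auto
        then have sq: "(E - F' k)\<^sup>2 \<le> \<delta>\<^sup>2" by (simp add: abs_le_square_iff[symmetric])
        have "dist (q E) (q (F' k)) < 1" using E ER \<delta> Fk by (intro d) (auto simp: dist_real_def)
        then have "q (F' k) - 1 \<le> q E" by (auto simp: dist_real_def)
        then have "(q (F' k) - 1) / (2 * \<delta>) \<le> q E * (1 / (2 * \<delta>))" using \<delta> by (simp add: divide_right_mono)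
        also have "1 / (2 * \<delta>) = \<delta> / (\<delta>\<^sup>2 + \<delta>\<^sup>2)" using \<delta> by (simp add: field_simps power2_eq_square)
        also have "q E * (\<delta> / (\<delta>\<^sup>2 + \<delta>\<^sup>2)) \<le> q E * (\<delta> / ((E - F' k)\<^sup>2 + \<delta>\<^sup>2))"
          using \<delta> sq q(2)[OF ER] by (intro mult_left_mono divide_left_mono add_mono mult_pos_pos add_nonneg_pos) auto
        finally show "(q (F' k) - 1) / (2 * \<delta>) \<le> q E * (\<delta> / ((E - F' k)\<^sup>2 + \<delta>\<^sup>2))" .
      qed auto
      also have "\<dots> \<le> integral {-R..R} (\<lambda>E. q E * (\<delta> / ((E - F' k)\<^sup>2 + \<delta>\<^sup>2)))"
        using sub contk continuous_on_subset[OF contk sub] q(2) \<delta>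
        by (intro integral_subset_le integrable_continuous_real) auto
      finally show ?thesis .
    qed
    have "(\<Sum>k<n. (\<phi> k p)\<^sup>2 * (q (F' k) - 1))
       \<le> (\<Sum>k<n. (\<phi> k p)\<^sup>2 * integral {-R..R} (\<lambda>E. q E * (\<delta> / ((E - F' k)\<^sup>2 + \<delta>\<^sup>2))))"
      using lower by (intro sum_mono mult_left_mono) auto
    also have "\<dots> = integral {-R..R} (\<lambda>E. \<Sum>k<n. (\<phi> k p)\<^sup>2 * (q E * (\<delta> / ((E - F' k)\<^sup>2 + \<delta>\<^sup>2))))"
    proof -
      have int: "(\<lambda>E. (\<phi> k p)\<^sup>2 * (q E * (\<delta> / ((E - F' k)\<^sup>2 + \<delta>\<^sup>2)))) integrable_on {-R..R}" for k
        by (intro integrable_continuous_real continuous_on_mult continuous_on_const contk)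
      show ?thesis
        by (subst integral_sum[OF _ int]) (simp_all only: finite_lessThan integral_mult_right)
    qed
    also have "\<dots> = integral {-R..R} (\<lambda>E. q E * h t E)"
      unfolding h_green[OF eb, symmetric] by (simp add: sum_distrib_left mult_ac)
    also note t2
    finally show "(\<Sum>k<n. (\<phi> k p)\<^sup>2 * (q (F' k) - 1)) \<le> pi / c * integral {-R..R} q" .
  qed
qed

section \<open>Stability of expanding half-lines\<close>

lemma norm_real_pair: "norm (y :: real \<times> real) \<le> \<bar>fst y\<bar> + \<bar>snd y\<bar>"
  using norm_Pair_le[of "fst y" "snd y"] by simp

lemma abs_fst_snd_le_norm: "\<bar>fst y\<bar> \<le> norm y" "\<bar>snd y\<bar> \<le> norm (y :: real \<times> real)"
  using norm_fst_le[of "fst y" "snd y"] norm_snd_le[of "snd y" "fst y"] by auto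

lemma norm_step_le: "norm (step e y) \<le> (\<bar>e\<bar> + 2) * norm y"
proof -
  have "norm (step e y) \<le> \<bar>e * fst y - snd y\<bar> + \<bar>fst y\<bar>"
    using norm_real_pair[of "step e y"] by (simp add: step_def)
  also have "\<dots> \<le> \<bar>e\<bar> * \<bar>fst y\<bar> + \<bar>snd y\<bar> + \<bar>fst y\<bar>"
    unfolding abs_mult[symmetric] by linarith
  also have "\<dots> \<le> \<bar>e\<bar> * norm y + norm y + norm y"
    by (intro add_mono mult_left_mono abs_fst_snd_le_norm) auto
  finally show ?thesis by (simp add: algebra_simps)
qed

lemma step_diff: "step e (y - z) = step e y - step e z"
  by (simp add: step_def algebra_simps)

lemma step_add: "step e (y + z) = step e y + step e z"
  by (simp add: step_def algebra_simps)

lemma transfer_diff: "transfer E vs (y - z) = transfer E vs y - transfer E vs z"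
  by (induction vs arbitrary: y z) (simp_all add: transfer_Cons step_diff)

lemma transfer_add: "transfer E vs (y + z) = transfer E vs y + transfer E vs z"
  by (induction vs arbitrary: y z) (simp_all add: transfer_Cons step_add)

lemma transfer_scaleR: "transfer E vs (r *\<^sub>R y) = r *\<^sub>R transfer E vs y"
  by (induction vs arbitrary: y) (simp_all add: transfer_Cons step_scaleR)

lemma norm_transfer_le:
  assumes "\<And>v. v \<in> set vs \<Longrightarrow> \<bar>E - v\<bar> + 2 \<le> b" "0 \<le> b"
  shows "norm (transfer E vs y) \<le> b ^ length vs * norm y"
  using assms
proof (induction vs arbitrary: y)
  case (Cons v vs)
  have "norm (transfer E (v # vs) y) \<le> b ^ length vs * norm (step (E - v) y)"
    unfolding transfer_Cons using Cons by auto
  also have "\<dots> \<le> b ^ length vs * ((\<bar>E - v\<bar> + 2) * norm y)"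
    using Cons.prems by (intro mult_left_mono norm_step_le) auto
  also have "\<dots> \<le> b ^ length vs * (b * norm y)"
    using Cons.prems by (intro mult_left_mono mult_right_mono) auto
  finally show ?case by (simp add: mult_ac)
qed simp

text \<open>The matrices are exchanged one at a time: each exchange costs \<open>d\<close>, and the
  remaining factors are bounded by \<open>b\<close>.\<close>

lemma transfer_perturb:
  assumes "length vs = length ws" "\<And>i. i < length vs \<Longrightarrow> \<bar>(E - vs ! i) - (E' - ws ! i)\<bar> \<le> d"
    "\<And>i. i < length vs \<Longrightarrow> \<bar>E - vs ! i\<bar> + 2 \<le> b" "\<And>i. i < length vs \<Longrightarrow> \<bar>E' - ws ! i\<bar> + 2 \<le> b"
    and b: "1 \<le> b" and d: "0 \<le> d"
  shows "norm (transfer E vs y - transfer E' ws y) \<le> d * length vs * b ^ length vs * norm y"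
  using assms(1-4)
proof (induction vs ws arbitrary: y rule: list_induct2)
  case Nil
  then show ?case by simp
next
  case (Cons v vs w ws)
  have h: "\<bar>(E - v) - (E' - w)\<bar> \<le> d" "\<bar>E - v\<bar> + 2 \<le> b"
    using Cons.prems[of 0] by auto
  have t: "\<bar>(E - vs ! i) - (E' - ws ! i)\<bar> \<le> d" "\<bar>E - vs ! i\<bar> + 2 \<le> b" "\<bar>E' - ws ! i\<bar> + 2 \<le> b" if "i < length vs" for i
    using Cons.prems[of "Suc i"] that by auto
  have "transfer E (v # vs) y - transfer E' (w # ws) y
     = (transfer E vs (step (E - v) y) - transfer E' ws (step (E - v) y)) + transfer E' ws (step (E - v) y - step (E' - w) y)"
    by (simp add: transfer_Cons transfer_diff)
  also have "norm \<dots> \<le> norm (transfer E vs (step (E - v) y) - transfer E' ws (step (E - v) y))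
     + norm (transfer E' ws (step (E - v) y - step (E' - w) y))"
    by (rule norm_triangle_ineq)
  also have "\<dots> \<le> d * length vs * b ^ length vs * norm (step (E - v) y) + b ^ length vs * norm (step (E - v) y - step (E' - w) y)"
  proof (rule add_mono)
    show "norm (transfer E vs (step (E - v) y) - transfer E' ws (step (E - v) y)) \<le> d * length vs * b ^ length vs * norm (step (E - v) y)"
      by (rule Cons.IH) (use t in auto)
    show "norm (transfer E' ws (step (E - v) y - step (E' - w) y)) \<le> b ^ length vs * norm (step (E - v) y - step (E' - w) y)"
      unfolding Cons.hyps using b t(3) Cons.hyps by (intro norm_transfer_le) (auto simp: in_set_conv_nth)
  qed
  also have "\<dots> \<le> d * length vs * b ^ length vs * (b * norm y) + b ^ length vs * (b * (d * norm y))"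
  proof (intro add_mono mult_left_mono)
    show "norm (step (E - v) y) \<le> b * norm y"
      using norm_step_le[of "E - v" y] mult_right_mono[OF h(2), of "norm y"] by simp
    have "step (E - v) y - step (E' - w) y = (((E - v) - (E' - w)) * fst y, 0)"
      by (simp add: step_def algebra_simps)
    then have "norm (step (E - v) y - step (E' - w) y) = \<bar>(E - v) - (E' - w)\<bar> * \<bar>fst y\<bar>"
      by (simp add: abs_mult)
    also have "\<dots> \<le> d * norm y"
      using h d by (intro mult_mono abs_fst_snd_le_norm) auto
    also have "\<dots> \<le> b * (d * norm y)" using b d mult_right_mono[of 1 b "d * norm y"] by simp
    finally show "norm (step (E - v) y - step (E' - w) y) \<le> b * (d * norm y)" .
  qed (use b d in auto)
  also have "\<dots> = d * length (v # vs) * b ^ length (v # vs) * norm y" by (simp add: algebra_simps)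
  finally show ?case .
qed

section \<open>Cones around an expanding direction\<close>

definition wedge :: "real \<times> real \<Rightarrow> real \<times> real \<Rightarrow> real" where
  "wedge y z = fst y * snd z - snd y * fst z"

text \<open>Transfer matrices have determinant 1; an expanded direction therefore forces contraction
  across it.\<close>

lemma wedge_transfer: "wedge (transfer E vs y) (transfer E vs z) = wedge y z"
proof (induction vs arbitrary: y z)
  case (Cons v vs)
  have "wedge (step e y) (step e z) = wedge y z" for e by (simp add: wedge_def step_def algebra_simps)
  then show ?case by (simp add: transfer_Cons Cons)
qed simp

lemma wedge_scaleR: "wedge (r *\<^sub>R y) z = r * wedge y z" "wedge y (r *\<^sub>R z) = r * wedge y z"
  by (simp_all add: wedge_def algebra_simps)

lemma inner_wedge_identity: "(inner y z)\<^sup>2 + (wedge y z)\<^sup>2 = (norm y)\<^sup>2 * (norm z)\<^sup>2"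
  by (cases y; cases z) (simp add: wedge_def norm_Pair power2_eq_square algebra_simps)

lemma abs_wedge_le: "\<bar>wedge y z\<bar> \<le> norm y * norm z"
proof -
  have "(wedge y z)\<^sup>2 \<le> (norm y * norm z)\<^sup>2"
    unfolding power_mult_distrib inner_wedge_identity[symmetric] by simp
  then show ?thesis by (simp only: abs_le_square_iff[symmetric]) simp
qed

lemma unit_decomposition:
  assumes "norm x = 1"
  shows "z = inner x z *\<^sub>R x + wedge x z *\<^sub>R (- snd x, fst x)"
proof -
  obtain a b c d where xz: "x = (a, b)" "z = (c, d)" by (cases x; cases z)
  have n: "a\<^sup>2 + b\<^sup>2 = 1" using assms by (simp add: xz norm_Pair)
  have "(a * c + b * d) * a - (a * d - b * c) * b = (a\<^sup>2 + b\<^sup>2) * c"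
    "(a * c + b * d) * b + (a * d - b * c) * a = (a\<^sup>2 + b\<^sup>2) * d"
    by (simp_all add: power2_eq_square algebra_simps)
  then show ?thesis by (simp add: xz wedge_def n algebra_simps)
qed

text \<open>\<open>\<alpha>\<close> and \<open>\<beta>\<close> are coordinates along and across an
  expanded direction: up to the shear \<open>c\<close> and the perturbation \<open>d\<close>, one is
  multiplied and the other divided by \<open>l\<close>. Expansion by 4 leaves a factor 2 in both
  regimes: 4 - 1 - 1 in the cone, 1/4 + 1/4 for the contraction outside.\<close>

lemma cone_step:
  fixes \<alpha> \<beta> \<alpha>' \<beta>' l c d B :: real
  assumes l: "4 \<le> l" and c: "\<bar>c\<bar> \<le> B" and B: "1 \<le> B" and d: "0 \<le> d" "8 * (B * d) \<le> 1"
    and a: "\<bar>\<alpha>' - (l * \<alpha> + c * \<beta>)\<bar> \<le> d * (\<bar>\<alpha>\<bar> + \<bar>\<beta>\<bar>)" and b: "\<bar>\<beta>' - \<beta> / l\<bar> \<le> d * (\<bar>\<alpha>\<bar> + \<bar>\<beta>\<bar>)"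
  shows "B * \<bar>\<beta>\<bar> \<le> \<bar>\<alpha>\<bar> \<Longrightarrow> 2 * \<bar>\<alpha>\<bar> \<le> \<bar>\<alpha>'\<bar> \<and> B * \<bar>\<beta>'\<bar> \<le> \<bar>\<alpha>'\<bar>"
    and "\<bar>\<alpha>\<bar> \<le> B * \<bar>\<beta>\<bar> \<Longrightarrow> \<bar>\<beta>'\<bar> \<le> \<bar>\<beta>\<bar> / 2"
proof -
  have bl: "\<bar>\<beta> / l\<bar> \<le> \<bar>\<beta>\<bar> / 4"
    using l frac_le[of "\<bar>\<beta>\<bar>" "\<bar>\<beta>\<bar>" 4 l] by (simp add: abs_divide)
  have dB: "d \<le> B * d" using B d mult_right_mono[of 1 B d] by simp
  {
    assume cone: "B * \<bar>\<beta>\<bar> \<le> \<bar>\<alpha>\<bar>"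
    have ba: "\<bar>\<beta>\<bar> \<le> \<bar>\<alpha>\<bar>" using cone B mult_right_mono[of 1 B "\<bar>\<beta>\<bar>"] by simp
    have "\<bar>c * \<beta>\<bar> \<le> B * \<bar>\<beta>\<bar>" using c by (simp add: abs_mult mult_right_mono)
    then have cb: "\<bar>c * \<beta>\<bar> \<le> \<bar>\<alpha>\<bar>" using cone by simp
    have la: "4 * \<bar>\<alpha>\<bar> \<le> \<bar>l * \<alpha>\<bar>" using l by (simp add: abs_mult mult_right_mono)
    have "d * (\<bar>\<alpha>\<bar> + \<bar>\<beta>\<bar>) \<le> d * (2 * \<bar>\<alpha>\<bar>)" using d ba by (intro mult_left_mono) auto
    then have dab: "d * (\<bar>\<alpha>\<bar> + \<bar>\<beta>\<bar>) \<le> 2 * (d * \<bar>\<alpha>\<bar>)" by simp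
    have Bda: "8 * (B * (d * \<bar>\<alpha>\<bar>)) \<le> \<bar>\<alpha>\<bar>" using d mult_right_mono[OF d(2), of "\<bar>\<alpha>\<bar>"] by (simp add: mult.assoc)
    have da: "d * \<bar>\<alpha>\<bar> \<le> B * (d * \<bar>\<alpha>\<bar>)" using mult_right_mono[OF dB, of "\<bar>\<alpha>\<bar>"] by (simp add: mult.assoc)
    have "4 * \<bar>\<alpha>\<bar> - \<bar>\<alpha>\<bar> - d * (\<bar>\<alpha>\<bar> + \<bar>\<beta>\<bar>) \<le> \<bar>\<alpha>'\<bar>" using la cb a by linarith
    moreover have "d * (\<bar>\<alpha>\<bar> + \<bar>\<beta>\<bar>) \<le> \<bar>\<alpha>\<bar>" using dab da Bda by linarith
    ultimately have g: "2 * \<bar>\<alpha>\<bar> \<le> \<bar>\<alpha>'\<bar>" by linarith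
    have "\<bar>\<beta>'\<bar> \<le> \<bar>\<beta>\<bar> / 4 + 2 * (d * \<bar>\<alpha>\<bar>)" using bl b dab by linarith
    then have "B * \<bar>\<beta>'\<bar> \<le> B * (\<bar>\<beta>\<bar> / 4 + 2 * (d * \<bar>\<alpha>\<bar>))" using B by (intro mult_left_mono) auto
    also have "\<dots> = B * \<bar>\<beta>\<bar> / 4 + 2 * (B * (d * \<bar>\<alpha>\<bar>))" by (simp add: algebra_simps)
    also have "\<dots> \<le> \<bar>\<alpha>\<bar>" using cone Bda by linarith
    finally show "2 * \<bar>\<alpha>\<bar> \<le> \<bar>\<alpha>'\<bar> \<and> B * \<bar>\<beta>'\<bar> \<le> \<bar>\<alpha>'\<bar>" using g by linarith
  }
  {
    assume "\<bar>\<alpha>\<bar> \<le> B * \<bar>\<beta>\<bar>"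
    then have "d * (\<bar>\<alpha>\<bar> + \<bar>\<beta>\<bar>) \<le> d * (B * \<bar>\<beta>\<bar> + \<bar>\<beta>\<bar>)" using d by (intro mult_left_mono) auto
    also have "\<dots> = B * d * \<bar>\<beta>\<bar> + d * \<bar>\<beta>\<bar>" by (simp add: algebra_simps)
    also have "\<dots> \<le> B * d * \<bar>\<beta>\<bar> + B * d * \<bar>\<beta>\<bar>" using dB by (intro add_left_mono mult_right_mono) auto
    also have "\<dots> \<le> \<bar>\<beta>\<bar> / 4" using mult_right_mono[OF d(2), of "\<bar>\<beta>\<bar>"] by simp
    finally show "\<bar>\<beta>'\<bar> \<le> \<bar>\<beta>\<bar> / 2" using bl b by linarith
  }
qed

text \<open>If the orbit has entered the cone by time k, it grows from there on, so its size at k is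
  controlled by the last vector. If not, the component across has been halved since time 0 and
  dominates the other up to \<open>B\<close>.\<close>

lemma cone_decay_finite:
  fixes \<alpha> \<beta> :: "nat \<Rightarrow> real"
  assumes B: "1 \<le> B"
    and cone: "\<And>k. k < p \<Longrightarrow> B * \<bar>\<beta> k\<bar> \<le> \<bar>\<alpha> k\<bar> \<Longrightarrow> 2 * \<bar>\<alpha> k\<bar> \<le> \<bar>\<alpha> (Suc k)\<bar> \<and> B * \<bar>\<beta> (Suc k)\<bar> \<le> \<bar>\<alpha> (Suc k)\<bar>"
    and out: "\<And>k. k < p \<Longrightarrow> \<bar>\<alpha> k\<bar> \<le> B * \<bar>\<beta> k\<bar> \<Longrightarrow> \<bar>\<beta> (Suc k)\<bar> \<le> \<bar>\<beta> k\<bar> / 2"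
    and k: "k \<le> p"
  shows "(\<alpha> k)\<^sup>2 + (\<beta> k)\<^sup>2 \<le> (1 + B\<^sup>2) * (1/4) ^ k * (\<beta> 0)\<^sup>2 + 2 * (1/4) ^ (p - k) * (\<alpha> p)\<^sup>2"
proof (cases "\<exists>j\<le>k. B * \<bar>\<beta> j\<bar> \<le> \<bar>\<alpha> j\<bar>")
  case True
  then obtain j where j: "j \<le> k" "B * \<bar>\<beta> j\<bar> \<le> \<bar>\<alpha> j\<bar>" by blast
  have stay: "i \<le> p \<Longrightarrow> B * \<bar>\<beta> i\<bar> \<le> \<bar>\<alpha> i\<bar>" if "j \<le> i" for i
    using that by (induction i rule: dec_induct) (use j cone in auto)
  have grow: "i \<le> p \<Longrightarrow> 2 ^ (i - k) * \<bar>\<alpha> k\<bar> \<le> \<bar>\<alpha> i\<bar>" if "k \<le> i" for i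
    using that
  proof (induction i rule: dec_induct)
    case (step i)
    then have "2 * \<bar>\<alpha> i\<bar> \<le> \<bar>\<alpha> (Suc i)\<bar>" using cone[of i] stay[of i] j by auto
    moreover have "2 ^ (i - k) * \<bar>\<alpha> k\<bar> \<le> \<bar>\<alpha> i\<bar>" using step by auto
    ultimately show ?case using step by (simp add: Suc_diff_le)
  qed simp
  have bk: "\<bar>\<beta> k\<bar> \<le> \<bar>\<alpha> k\<bar>"
    using stay[OF j(1) k] B mult_right_mono[of 1 B "\<bar>\<beta> k\<bar>"] by simp
  have "(\<beta> k)\<^sup>2 \<le> (\<alpha> k)\<^sup>2" using bk by (simp add: abs_le_square_iff)
  moreover have "(\<alpha> k)\<^sup>2 \<le> (1/4) ^ (p - k) * (\<alpha> p)\<^sup>2"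
  proof -
    have "(2 ^ (p - k) * \<bar>\<alpha> k\<bar>)\<^sup>2 \<le> \<bar>\<alpha> p\<bar>\<^sup>2"
      using grow[OF k] by (intro power_mono) auto
    moreover have "(2 ^ (p - k) * \<bar>\<alpha> k\<bar>)\<^sup>2 = 4 ^ (p - k) * (\<alpha> k)\<^sup>2"
    proof -
      have "((2::real) ^ m)\<^sup>2 = 4 ^ m" for m by (induction m) (simp_all add: power2_eq_square)
      then show ?thesis by (simp only: power_mult_distrib power2_abs)
    qed
    ultimately have "4 ^ (p - k) * (\<alpha> k)\<^sup>2 \<le> (\<alpha> p)\<^sup>2" by (simp only: power2_abs)
    then have "(1/4) ^ (p - k) * (4 ^ (p - k) * (\<alpha> k)\<^sup>2) \<le> (1/4) ^ (p - k) * (\<alpha> p)\<^sup>2"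
      by (intro mult_left_mono) auto
    then show ?thesis by (simp only: mult.assoc[symmetric] power_mult_distrib[symmetric]) simp
  qed
  moreover have "0 \<le> (1 + B\<^sup>2) * (1/4) ^ k * (\<beta> 0)\<^sup>2" by simp
  ultimately show ?thesis by linarith
next
  case False
  then have no: "\<bar>\<alpha> j\<bar> \<le> B * \<bar>\<beta> j\<bar>" if "j \<le> k" for j using that by force
  have dec: "j \<le> k \<Longrightarrow> \<bar>\<beta> j\<bar> \<le> (1/2) ^ j * \<bar>\<beta> 0\<bar>" for j
  proof (induction j)
    case (Suc j)
    then have "\<bar>\<beta> (Suc j)\<bar> \<le> \<bar>\<beta> j\<bar> / 2" using out[of j] no[of j] k by auto
    with Suc show ?case by simp
  qed simp
  have "(\<alpha> k)\<^sup>2 \<le> (B * \<beta> k)\<^sup>2"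
    using no[of k] B by (simp add: abs_le_square_iff[symmetric] abs_mult)
  moreover have "(\<beta> k)\<^sup>2 \<le> (1/4) ^ k * (\<beta> 0)\<^sup>2"
  proof -
    have "\<bar>\<beta> k\<bar>\<^sup>2 \<le> ((1/2) ^ k * \<bar>\<beta> 0\<bar>)\<^sup>2"
      using dec[of k] by (intro power_mono) auto
    moreover have "((1/2) ^ k)\<^sup>2 = ((1/4) ^ k :: real)"
      by (induction k) (simp_all add: power2_eq_square)
    ultimately show ?thesis by (simp add: power_mult_distrib)
  qed
  ultimately have "(\<alpha> k)\<^sup>2 + (\<beta> k)\<^sup>2 \<le> (1 + B\<^sup>2) * ((1/4) ^ k * (\<beta> 0)\<^sup>2)"
    using mult_left_mono[of "(\<beta> k)\<^sup>2" "(1/4) ^ k * (\<beta> 0)\<^sup>2" "1 + B\<^sup>2"] by (simp add: power_mult_distrib distrib_right)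
  moreover have "0 \<le> 2 * ((1/4) ^ (p - k) * (\<alpha> p)\<^sup>2)" by simp
  ultimately show ?thesis unfolding mult.assoc by linarith
qed

text \<open>In the cone a nonzero component along the direction doubles forever, so a bounded orbit
  never has one and stays where the other component is halved.\<close>

lemma cone_decay_bounded:
  fixes \<alpha> \<beta> :: "nat \<Rightarrow> real"
  assumes B: "1 \<le> B"
    and cone: "\<And>k. B * \<bar>\<beta> k\<bar> \<le> \<bar>\<alpha> k\<bar> \<Longrightarrow> 2 * \<bar>\<alpha> k\<bar> \<le> \<bar>\<alpha> (Suc k)\<bar> \<and> B * \<bar>\<beta> (Suc k)\<bar> \<le> \<bar>\<alpha> (Suc k)\<bar>"
    and out: "\<And>k. \<bar>\<alpha> k\<bar> \<le> B * \<bar>\<beta> k\<bar> \<Longrightarrow> \<bar>\<beta> (Suc k)\<bar> \<le> \<bar>\<beta> k\<bar> / 2"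
    and bounded: "\<And>k. \<bar>\<alpha> k\<bar> \<le> K"
  shows "\<bar>\<alpha> k\<bar> \<le> B * \<bar>\<beta> k\<bar>" "\<bar>\<beta> k\<bar> \<le> (1/2) ^ k * \<bar>\<beta> 0\<bar>"
proof -
  show a: "\<bar>\<alpha> k\<bar> \<le> B * \<bar>\<beta> k\<bar>" for k
  proof (rule ccontr)
    assume "\<not> ?thesis"
    then have k: "B * \<bar>\<beta> k\<bar> \<le> \<bar>\<alpha> k\<bar>" "\<bar>\<alpha> k\<bar> > 0"
      using le_less_trans[of 0 "B * \<bar>\<beta> k\<bar>" "\<bar>\<alpha> k\<bar>"] B by (simp_all add: not_le)
    have "B * \<bar>\<beta> (k + i)\<bar> \<le> \<bar>\<alpha> (k + i)\<bar> \<and> 2 ^ i * \<bar>\<alpha> k\<bar> \<le> \<bar>\<alpha> (k + i)\<bar>" for i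
      by (induction i) (use k cone in \<open>force+\<close>)
    then have "2 ^ i * \<bar>\<alpha> k\<bar> \<le> K" for i using bounded[of "k + i"] order_trans by blast
    moreover obtain i where "K / \<bar>\<alpha> k\<bar> < 2 ^ i" using real_arch_pow[of 2] by auto
    ultimately show False using k(2) by (simp add: field_simps not_le[symmetric])
  qed
  show "\<bar>\<beta> k\<bar> \<le> (1/2) ^ k * \<bar>\<beta> 0\<bar>"
  proof (induction k)
    case (Suc k)
    then show ?case using out[OF a[of k]] by simp
  qed simp
qed

text \<open>A single growing orbit suffices: as area is preserved, it carries a field of invariant
  cones, and these, unlike the orbit, survive small changes of energy and potential.\<close>

definition expanding :: "real \<Rightarrow> (nat \<Rightarrow> real) \<Rightarrow> nat \<Rightarrow> nat \<Rightarrow> bool" where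
  "expanding e u s N \<longleftrightarrow> (\<exists>y. \<forall>k. y k \<noteq> 0 \<and> y (Suc k) = transfer e (map u [s + k * N..<s + Suc k * N]) (y k) \<and>
     4 * norm (y k) \<le> norm (y (Suc k)))"

lemma transfer_solution:
  assumes "1 \<le> s" "\<And>n. s \<le> n \<Longrightarrow> n < s + m \<Longrightarrow> f (Suc n) = (E - u n) * f n - f (n - 1)"
  shows "transfer E (map u [s..<s + m]) (f s, f (s - 1)) = (f (s + m), f (s + m - 1))"
  using assms
proof (induction m)
  case (Suc m)
  then have "transfer E (map u [s..<s + m]) (f s, f (s - 1)) = (f (s + m), f (s + m - 1))" by auto
  then show ?case using Suc.prems(2)[of "s + m"] by (simp add: transfer_append transfer_Cons step_def)
qed simp

text \<open>The frame moves with the normalized growing orbit. \<open>b ^ N\<close> bounds the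
  matrix of a block and hence the shear, and serves as the opening of the cone; the coordinate
  across is divided by the expansion because the block preserves \<open>wedge\<close>.\<close>

lemma expanding_cone:
  assumes y: "y \<noteq> 0" "y' = transfer e vs y" "4 * norm y \<le> norm y'"
    and len: "length vs = N" "length ws = N"
    and per: "\<And>i. i < N \<Longrightarrow> \<bar>(e - vs ! i) - (E - ws ! i)\<bar> \<le> d"
    and b: "\<And>i. i < N \<Longrightarrow> \<bar>e - vs ! i\<bar> + 2 \<le> b" "\<And>i. i < N \<Longrightarrow> \<bar>E - ws ! i\<bar> + 2 \<le> b" "1 \<le> b"
    and d: "0 \<le> d" "8 * (b ^ N * (d * N * b ^ N)) \<le> 1"
    and z': "z' = transfer E ws z"
  defines "\<alpha> \<equiv> inner (y /\<^sub>R norm y) z" and "\<beta> \<equiv> wedge (y /\<^sub>R norm y) z"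
    and "\<alpha>' \<equiv> inner (y' /\<^sub>R norm y') z'" and "\<beta>' \<equiv> wedge (y' /\<^sub>R norm y') z'"
  shows "b ^ N * \<bar>\<beta>\<bar> \<le> \<bar>\<alpha>\<bar> \<Longrightarrow> 2 * \<bar>\<alpha>\<bar> \<le> \<bar>\<alpha>'\<bar> \<and> b ^ N * \<bar>\<beta>'\<bar> \<le> \<bar>\<alpha>'\<bar>"
    and "\<bar>\<alpha>\<bar> \<le> b ^ N * \<bar>\<beta>\<bar> \<Longrightarrow> \<bar>\<beta>'\<bar> \<le> \<bar>\<beta>\<bar> / 2"
proof -
  define x x' where "x = y /\<^sub>R norm y" and "x' = y' /\<^sub>R norm y'"
  define l where "l = norm y' / norm y"
  define T where "T = transfer e vs"
  define xp where "xp = (- snd x, fst x)"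
  have ny: "norm y > 0" using y by simp
  have l: "4 \<le> l" using y(3) ny by (simp add: l_def field_simps)
  have ny': "norm y' > 0" using y(3) ny by linarith
  have y'0: "y' \<noteq> 0" using ny' by auto
  have nx: "norm x = 1" "norm x' = 1" using y(1) y'0 by (simp_all add: x_def x'_def)
  have nxp: "norm xp = 1" using nx(1) by (simp add: xp_def norm_prod_def add.commute)
  have Tx: "T x = l *\<^sub>R x'"
    using ny ny' by (simp add: T_def x_def x'_def l_def transfer_scaleR y(2)[symmetric] inverse_eq_divide)
  have z: "z = \<alpha> *\<^sub>R x + \<beta> *\<^sub>R xp"
    unfolding \<alpha>_def \<beta>_def x_def[symmetric] xp_def by (rule unit_decomposition[OF nx(1)])
  have nz: "norm z \<le> \<bar>\<alpha>\<bar> + \<bar>\<beta>\<bar>"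
    using norm_triangle_ineq[of "\<alpha> *\<^sub>R x" "\<beta> *\<^sub>R xp"] nx nxp z by simp
  have Tz: "T z = (l * \<alpha>) *\<^sub>R x' + \<beta> *\<^sub>R T xp"
    by (subst z) (simp add: T_def transfer_add transfer_scaleR Tx[unfolded T_def] mult.commute)
  have TB: "norm (T v) \<le> b ^ N * norm v" for v
    unfolding T_def using norm_transfer_le[of vs e b v] b len by (auto simp: in_set_conv_nth)
  have err: "norm (z' - T z) \<le> d * N * b ^ N * (\<bar>\<alpha>\<bar> + \<bar>\<beta>\<bar>)"
  proof -
    have "norm (z' - T z) \<le> d * N * b ^ N * norm z"
      unfolding z' T_def norm_minus_commute[of "transfer E ws z"]
      using transfer_perturb[of vs ws e E d b z] len per b d by simp
    also have "\<dots> \<le> d * N * b ^ N * (\<bar>\<alpha>\<bar> + \<bar>\<beta>\<bar>)"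
      using nz d b by (intro mult_left_mono) auto
    finally show ?thesis .
  qed
  have dnn: "0 \<le> d * N * b ^ N" using d(1) b(3) by simp
  define c where "c = inner x' (T xp)"
  have B: "1 \<le> b ^ N" using b by simp
  have c: "\<bar>c\<bar> \<le> b ^ N"
    using Cauchy_Schwarz_ineq2[of x' "T xp"] TB[of xp] nx nxp by (simp add: c_def)
  have a: "\<bar>\<alpha>' - (l * \<alpha> + c * \<beta>)\<bar> \<le> d * N * b ^ N * (\<bar>\<alpha>\<bar> + \<bar>\<beta>\<bar>)"
  proof -
    have "inner x' (T z) = l * \<alpha> + c * \<beta>"
      using nx(2) by (simp add: Tz inner_add_right c_def norm_eq_1 mult.commute)
    then have "\<alpha>' - (l * \<alpha> + c * \<beta>) = inner x' (z' - T z)"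
      by (simp add: \<alpha>'_def x'_def inner_diff_right)
    then show ?thesis using Cauchy_Schwarz_ineq2[of x' "z' - T z"] nx err by simp
  qed
  have bb: "\<bar>\<beta>' - \<beta> / l\<bar> \<le> d * N * b ^ N * (\<bar>\<alpha>\<bar> + \<bar>\<beta>\<bar>)"
  proof -
    have "x' = (1 / l) *\<^sub>R T x" using Tx l by simp
    then have "wedge x' (T z) = (1 / l) * wedge (T x) (T z)" by (simp only: wedge_scaleR)
    also have "\<dots> = \<beta> / l" by (simp add: T_def wedge_transfer \<beta>_def x_def)
    finally have "\<beta>' - \<beta> / l = wedge x' (z' - T z)"
      by (simp add: \<beta>'_def x'_def[symmetric] wedge_def algebra_simps)
    then show ?thesis using abs_wedge_le[of x' "z' - T z"] nx err by simp
  qed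
  show "b ^ N * \<bar>\<beta>\<bar> \<le> \<bar>\<alpha>\<bar> \<Longrightarrow> 2 * \<bar>\<alpha>\<bar> \<le> \<bar>\<alpha>'\<bar> \<and> b ^ N * \<bar>\<beta>'\<bar> \<le> \<bar>\<alpha>'\<bar>"
    and "\<bar>\<alpha>\<bar> \<le> b ^ N * \<bar>\<beta>\<bar> \<Longrightarrow> \<bar>\<beta>'\<bar> \<le> \<bar>\<beta>\<bar> / 2"
    using cone_step[OF l c B _ d(2) a bb] dnn by blast+
qed

text \<open>Only e - u n and E - u' n enter the matrices, so one \<open>d\<close> accounts for the
  shifts of energy and potential together. The smallness condition is that of
  \<open>cone_step\<close> for the error accumulated over a block.\<close>

locale near_expanding =
  fixes e E :: real and u u' :: "nat \<Rightarrow> real" and s N :: nat and b d :: real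
  assumes exp: "expanding e u s N"
    and s: "1 \<le> s" and N: "1 \<le> N"
    and per: "\<And>n. s \<le> n \<Longrightarrow> \<bar>(e - u n) - (E - u' n)\<bar> \<le> d"
    and b: "\<And>n. s \<le> n \<Longrightarrow> \<bar>e - u n\<bar> + 2 \<le> b" "\<And>n. s \<le> n \<Longrightarrow> \<bar>E - u' n\<bar> + 2 \<le> b" "1 \<le> b"
    and d: "0 \<le> d" "8 * (b ^ N * (d * N * b ^ N)) \<le> 1"
begin

lemma coordinates:
  obtains x :: "nat \<Rightarrow> real \<times> real" where "\<And>k. norm (x k) = 1"
    "\<And>k z. \<bar>inner (x k) z\<bar> \<ge> b ^ N * \<bar>wedge (x k) z\<bar> \<Longrightarrow>
      2 * \<bar>inner (x k) z\<bar> \<le> \<bar>inner (x (Suc k)) (transfer E (map u' [s + k * N..<s + Suc k * N]) z)\<bar> \<and>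
      b ^ N * \<bar>wedge (x (Suc k)) (transfer E (map u' [s + k * N..<s + Suc k * N]) z)\<bar>
        \<le> \<bar>inner (x (Suc k)) (transfer E (map u' [s + k * N..<s + Suc k * N]) z)\<bar>"
    "\<And>k z. \<bar>inner (x k) z\<bar> \<le> b ^ N * \<bar>wedge (x k) z\<bar> \<Longrightarrow>
      \<bar>wedge (x (Suc k)) (transfer E (map u' [s + k * N..<s + Suc k * N]) z)\<bar> \<le> \<bar>wedge (x k) z\<bar> / 2"
proof -
  obtain y where y: "\<And>k. y k \<noteq> 0" "\<And>k. y (Suc k) = transfer e (map u [s + k * N..<s + Suc k * N]) (y k)"
    "\<And>k. 4 * norm (y k) \<le> norm (y (Suc k))"
    using exp unfolding expanding_def by blast
  have 1: "norm (y k /\<^sub>R norm (y k)) = 1" for k using y(1)[of k] by simp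
  show thesis
  proof (rule that[of "\<lambda>k. y k /\<^sub>R norm (y k)"])
    fix k z
    show "b ^ N * \<bar>wedge (y k /\<^sub>R norm (y k)) z\<bar> \<le> \<bar>inner (y k /\<^sub>R norm (y k)) z\<bar> \<Longrightarrow>
      2 * \<bar>inner (y k /\<^sub>R norm (y k)) z\<bar> \<le> \<bar>inner (y (Suc k) /\<^sub>R norm (y (Suc k))) (transfer E (map u' [s + k * N..<s + Suc k * N]) z)\<bar> \<and>
      b ^ N * \<bar>wedge (y (Suc k) /\<^sub>R norm (y (Suc k))) (transfer E (map u' [s + k * N..<s + Suc k * N]) z)\<bar>
        \<le> \<bar>inner (y (Suc k) /\<^sub>R norm (y (Suc k))) (transfer E (map u' [s + k * N..<s + Suc k * N]) z)\<bar>"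
      using expanding_cone(1)[OF y(1) y(2) y(3), where N = N and ws = "map u' [s + k * N..<s + Suc k * N]" and E = E and d = d and b = b and z = z]
        per b d by simp
    show "\<bar>inner (y k /\<^sub>R norm (y k)) z\<bar> \<le> b ^ N * \<bar>wedge (y k /\<^sub>R norm (y k)) z\<bar> \<Longrightarrow>
      \<bar>wedge (y (Suc k) /\<^sub>R norm (y (Suc k))) (transfer E (map u' [s + k * N..<s + Suc k * N]) z)\<bar> \<le> \<bar>wedge (y k /\<^sub>R norm (y k)) z\<bar> / 2"
      using expanding_cone(2)[OF y(1) y(2) y(3), where N = N and ws = "map u' [s + k * N..<s + Suc k * N]" and E = E and d = d and b = b and z = z]
        per b d by simp
  qed (rule 1)
qed

lemma block_transfer:
  assumes "\<And>n. s \<le> n \<Longrightarrow> n < s + p * N \<Longrightarrow> f (Suc n) = (E - u' n) * f n - f (n - 1)" "k < p"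
  shows "transfer E (map u' [s + k * N..<s + Suc k * N]) (f (s + k * N), f (s + k * N - 1))
    = (f (s + Suc k * N), f (s + Suc k * N - 1))"
proof -
  have "s + k * N + N \<le> s + p * N" using mult_le_mono1[of "Suc k" p N] assms(2) by simp
  then show ?thesis using transfer_solution[of "s + k * N" N f E u'] assms(1) s by (simp add: add.commute add.left_commute)
qed

lemma value_in_block:
  assumes "\<And>n. s \<le> n \<Longrightarrow> n < s + p * N \<Longrightarrow> f (Suc n) = (E - u' n) * f n - f (n - 1)" "k < p" "i < N"
  shows "\<bar>f (s + k * N + i)\<bar> \<le> b ^ N * norm (f (s + k * N), f (s + k * N - 1))"
proof -
  have "s + k * N + N \<le> s + p * N" using mult_le_mono1[of "Suc k" p N] assms(2) by simp
  then have t: "transfer E (map u' [s + k * N..<s + k * N + i]) (f (s + k * N), f (s + k * N - 1))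
    = (f (s + k * N + i), f (s + k * N + i - 1))"
    using transfer_solution[of "s + k * N" i f E u'] assms s by simp
  have "\<bar>f (s + k * N + i)\<bar> \<le> norm (transfer E (map u' [s + k * N..<s + k * N + i]) (f (s + k * N), f (s + k * N - 1)))"
    unfolding t using abs_fst_snd_le_norm(1)[of "(f (s + k * N + i), f (s + k * N + i - 1))"] by simp
  also have "\<dots> \<le> b ^ i * norm (f (s + k * N), f (s + k * N - 1))"
  proof -
    have "norm (transfer E (map u' [s + k * N..<s + k * N + i]) z) \<le> b ^ length (map u' [s + k * N..<s + k * N + i]) * norm z" for z
      by (rule norm_transfer_le) (use b in auto)
    then show ?thesis by simp
  qed
  also have "\<dots> \<le> b ^ N * norm (f (s + k * N), f (s + k * N - 1))"
    using assms(3) b by (intro mult_right_mono power_increasing) auto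
  finally show ?thesis .
qed

text \<open>The contributions of both ends decay geometrically over the blocks, so the constant does
  not depend on \<open>p\<close>; this will bound the number of relevant eigenvalues of arbitrarily
  large boxes.\<close>

lemma mass_bound:
  assumes f: "\<And>n. s \<le> n \<Longrightarrow> n < s + p * N \<Longrightarrow> f (Suc n) = (E - u' n) * f n - f (n - 1)"
  shows "(\<Sum>n<p * N. (f (s + n))\<^sup>2) \<le> N * (b ^ N)\<^sup>2 * (4 * (1 + (b ^ N)\<^sup>2)) *
    ((f s)\<^sup>2 + (f (s - 1))\<^sup>2 + (f (s + p * N))\<^sup>2 + (f (s + p * N - 1))\<^sup>2)"
proof -
  define B where "B = b ^ N"
  define Z where "Z k = (f (s + k * N), f (s + k * N - 1))" for k
  have B: "1 \<le> B" using b by (simp add: B_def)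
  obtain x where x1: "\<And>k. norm (x k) = 1" and
    c1: "\<And>k z. \<bar>inner (x k) z\<bar> \<ge> b ^ N * \<bar>wedge (x k) z\<bar> \<Longrightarrow>
      2 * \<bar>inner (x k) z\<bar> \<le> \<bar>inner (x (Suc k)) (transfer E (map u' [s + k * N..<s + Suc k * N]) z)\<bar> \<and>
      b ^ N * \<bar>wedge (x (Suc k)) (transfer E (map u' [s + k * N..<s + Suc k * N]) z)\<bar>
        \<le> \<bar>inner (x (Suc k)) (transfer E (map u' [s + k * N..<s + Suc k * N]) z)\<bar>" and
    c2: "\<And>k z. \<bar>inner (x k) z\<bar> \<le> b ^ N * \<bar>wedge (x k) z\<bar> \<Longrightarrow>
      \<bar>wedge (x (Suc k)) (transfer E (map u' [s + k * N..<s + Suc k * N]) z)\<bar> \<le> \<bar>wedge (x k) z\<bar> / 2"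
    by (rule coordinates) (rule that, assumption+)
  have bt: "transfer E (map u' [s + k * N..<s + Suc k * N]) (Z k) = Z (Suc k)" if "k < p" for k
    unfolding Z_def by (rule block_transfer[OF f that])
  have x2: "2 * \<bar>inner (x k) (Z k)\<bar> \<le> \<bar>inner (x (Suc k)) (Z (Suc k))\<bar> \<and>
       B * \<bar>wedge (x (Suc k)) (Z (Suc k))\<bar> \<le> \<bar>inner (x (Suc k)) (Z (Suc k))\<bar>"
    if "k < p" "B * \<bar>wedge (x k) (Z k)\<bar> \<le> \<bar>inner (x k) (Z k)\<bar>" for k
    using c1[of k "Z k"] that(2) unfolding bt[OF that(1)] B_def by blast
  have x3: "\<bar>wedge (x (Suc k)) (Z (Suc k))\<bar> \<le> \<bar>wedge (x k) (Z k)\<bar> / 2"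
    if "k < p" "\<bar>inner (x k) (Z k)\<bar> \<le> B * \<bar>wedge (x k) (Z k)\<bar>" for k
    using c2[of k "Z k"] that(2) unfolding bt[OF that(1)] B_def by blast
  note x = x1 x2 x3
  have nZ: "(norm (Z k))\<^sup>2 = (inner (x k) (Z k))\<^sup>2 + (wedge (x k) (Z k))\<^sup>2" for k
    using inner_wedge_identity[of "x k" "Z k"] x(1) by simp
  let ?S = "(norm (Z 0))\<^sup>2 + (norm (Z p))\<^sup>2"
  have nk: "(norm (Z k))\<^sup>2 \<le> (1 + B\<^sup>2) * (1/4) ^ k * (norm (Z 0))\<^sup>2 + 2 * (1/4) ^ (p - k) * (norm (Z p))\<^sup>2" if "k \<le> p" for k
  proof -
    have "(norm (Z k))\<^sup>2 \<le> (1 + B\<^sup>2) * (1/4) ^ k * (wedge (x 0) (Z 0))\<^sup>2 + 2 * (1/4) ^ (p - k) * (inner (x p) (Z p))\<^sup>2"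
      unfolding nZ by (rule cone_decay_finite[where \<alpha> = "\<lambda>k. inner (x k) (Z k)" and \<beta> = "\<lambda>k. wedge (x k) (Z k)", OF B x(2,3) that])
    also have "\<dots> \<le> (1 + B\<^sup>2) * (1/4) ^ k * (norm (Z 0))\<^sup>2 + 2 * (1/4) ^ (p - k) * (norm (Z p))\<^sup>2"
      by (intro add_mono mult_left_mono) (auto simp: nZ)
    finally show ?thesis .
  qed
  have geo: "(\<Sum>k<m. (1/4 :: real) ^ k) \<le> 2" for m
    by (simp add: sum_gp_strict, rule order_trans[of _ 0]) simp_all
  have geo2: "(\<Sum>k<p. (1/4 :: real) ^ (p - k)) \<le> 2"
  proof -
    have "(\<Sum>k<p. (1/4 :: real) ^ (p - k)) \<le> (\<Sum>k<p. (1/4 :: real) ^ (p - Suc k))"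
      by (intro sum_mono power_decreasing) auto
    also have "\<dots> = (\<Sum>k<p. (1/4 :: real) ^ k)" by (rule sum.nat_diff_reindex)
    finally show ?thesis using geo[of p] by simp
  qed
  have "(\<Sum>n<p * N. (f (s + n))\<^sup>2) = (\<Sum>k<p. \<Sum>n\<in>{k * N..<k * N + N}. (f (s + n))\<^sup>2)"
    by (rule sum.nat_group[symmetric])
  also have "\<dots> \<le> (\<Sum>k<p. \<Sum>n\<in>{k * N..<k * N + N}. B\<^sup>2 * (norm (Z k))\<^sup>2)"
  proof (intro sum_mono)
    fix k n assume k: "k \<in> {..<p}" and n: "n \<in> {k * N..<k * N + N}"
    have "\<bar>f (s + k * N + (n - k * N))\<bar> \<le> B * norm (Z k)"
      unfolding B_def Z_def using k n by (intro value_in_block[OF f]) auto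
    then have "\<bar>f (s + n)\<bar>\<^sup>2 \<le> (B * norm (Z k))\<^sup>2"
      using n by (intro power_mono) auto
    then show "(f (s + n))\<^sup>2 \<le> B\<^sup>2 * (norm (Z k))\<^sup>2" by (simp add: power_mult_distrib)
  qed
  also have "\<dots> = N * B\<^sup>2 * (\<Sum>k<p. (norm (Z k))\<^sup>2)"
    by (simp add: sum_distrib_left mult.assoc)
  also have "(\<Sum>k<p. (norm (Z k))\<^sup>2) \<le> (\<Sum>k<p. (1 + B\<^sup>2) * (1/4) ^ k * (norm (Z 0))\<^sup>2 + 2 * (1/4) ^ (p - k) * (norm (Z p))\<^sup>2)"
    by (intro sum_mono nk) auto
  also have "\<dots> = (1 + B\<^sup>2) * (norm (Z 0))\<^sup>2 * (\<Sum>k<p. (1/4) ^ k) + 2 * (norm (Z p))\<^sup>2 * (\<Sum>k<p. (1/4) ^ (p - k))"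
    by (simp add: sum.distrib sum_distrib_left mult_ac)
  also have "\<dots> \<le> (1 + B\<^sup>2) * (norm (Z 0))\<^sup>2 * 2 + 2 * (norm (Z p))\<^sup>2 * 2"
    using geo[of p] geo2 by (intro add_mono mult_left_mono) auto
  also have "\<dots> \<le> 4 * (1 + B\<^sup>2) * ?S"
    by (simp add: algebra_simps)
  finally have "(\<Sum>n<p * N. (f (s + n))\<^sup>2) \<le> N * B\<^sup>2 * (4 * (1 + B\<^sup>2) * ?S)"
    by (simp add: mult_left_mono)
  moreover have "?S = (f s)\<^sup>2 + (f (s - 1))\<^sup>2 + (f (s + p * N))\<^sup>2 + (f (s + p * N - 1))\<^sup>2"
    by (simp add: Z_def norm_Pair)
  ultimately show ?thesis by (simp add: B_def mult.assoc)
qed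

lemma exponential_decay:
  assumes f: "\<And>n. s \<le> n \<Longrightarrow> f (Suc n) = (E - u' n) * f n - f (n - 1)" and bd: "\<And>n. \<bar>f n\<bar> \<le> K"
  shows "\<exists>C c. 0 < C \<and> 0 < c \<and> (\<forall>n. \<bar>f n\<bar> \<le> C * exp (- c * real n))"
proof -
  define B where "B = b ^ N"
  define Z where "Z k = (f (s + k * N), f (s + k * N - 1))" for k
  have B: "1 \<le> B" using b by (simp add: B_def)
  have bt: "transfer E (map u' [s + k * N..<s + Suc k * N]) (Z k) = Z (Suc k)" for k
    unfolding Z_def by (rule block_transfer[of "Suc k"]) (use f in auto)
  obtain x where x1: "\<And>k. norm (x k) = 1" and
    c1: "\<And>k z. \<bar>inner (x k) z\<bar> \<ge> b ^ N * \<bar>wedge (x k) z\<bar> \<Longrightarrow>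
      2 * \<bar>inner (x k) z\<bar> \<le> \<bar>inner (x (Suc k)) (transfer E (map u' [s + k * N..<s + Suc k * N]) z)\<bar> \<and>
      b ^ N * \<bar>wedge (x (Suc k)) (transfer E (map u' [s + k * N..<s + Suc k * N]) z)\<bar>
        \<le> \<bar>inner (x (Suc k)) (transfer E (map u' [s + k * N..<s + Suc k * N]) z)\<bar>" and
    c2: "\<And>k z. \<bar>inner (x k) z\<bar> \<le> b ^ N * \<bar>wedge (x k) z\<bar> \<Longrightarrow>
      \<bar>wedge (x (Suc k)) (transfer E (map u' [s + k * N..<s + Suc k * N]) z)\<bar> \<le> \<bar>wedge (x k) z\<bar> / 2"
    by (rule coordinates) (rule that, assumption+)
  have x2: "2 * \<bar>inner (x k) (Z k)\<bar> \<le> \<bar>inner (x (Suc k)) (Z (Suc k))\<bar> \<and>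
       B * \<bar>wedge (x (Suc k)) (Z (Suc k))\<bar> \<le> \<bar>inner (x (Suc k)) (Z (Suc k))\<bar>"
    if "B * \<bar>wedge (x k) (Z k)\<bar> \<le> \<bar>inner (x k) (Z k)\<bar>" for k
    using c1[of k "Z k"] that unfolding bt B_def by blast
  have x3: "\<bar>wedge (x (Suc k)) (Z (Suc k))\<bar> \<le> \<bar>wedge (x k) (Z k)\<bar> / 2"
    if "\<bar>inner (x k) (Z k)\<bar> \<le> B * \<bar>wedge (x k) (Z k)\<bar>" for k
    using c2[of k "Z k"] that unfolding bt B_def by blast
  note x = x1 x2 x3
  have "\<bar>inner (x k) (Z k)\<bar> \<le> 2 * K" for k
  proof -
    have "norm (Z k) \<le> 2 * K"
      using norm_real_pair[of "Z k"] bd[of "s + k * N"] bd[of "s + k * N - 1"] by (simp add: Z_def)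
    then show ?thesis using Cauchy_Schwarz_ineq2[of "x k" "Z k"] x(1) by simp
  qed
  note dec = cone_decay_bounded[where \<alpha> = "\<lambda>k. inner (x k) (Z k)" and \<beta> = "\<lambda>k. wedge (x k) (Z k)", OF B x(2,3) this]
  have nZ: "norm (Z k) \<le> (1 + B) * ((1/2) ^ k * norm (Z 0))" for k
  proof -
    have "(norm (Z k))\<^sup>2 = (inner (x k) (Z k))\<^sup>2 + (wedge (x k) (Z k))\<^sup>2"
      using inner_wedge_identity[of "x k" "Z k"] x(1) by simp
    also have "\<dots> \<le> (\<bar>inner (x k) (Z k)\<bar> + \<bar>wedge (x k) (Z k)\<bar>)\<^sup>2" by (simp add: power2_sum)
    finally have "norm (Z k) \<le> \<bar>inner (x k) (Z k)\<bar> + \<bar>wedge (x k) (Z k)\<bar>"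
      by (rule power2_le_imp_le) simp
    also have "\<dots> \<le> (1 + B) * \<bar>wedge (x k) (Z k)\<bar>" using dec(1)[of k] by (simp add: algebra_simps)
    also have "\<dots> \<le> (1 + B) * ((1/2) ^ k * \<bar>wedge (x 0) (Z 0)\<bar>)"
      using dec(2)[of k] B by (intro mult_left_mono) auto
    also have "\<dots> \<le> (1 + B) * ((1/2) ^ k * norm (Z 0))"
      using abs_wedge_le[of "x 0" "Z 0"] x(1)[of 0] B by (intro mult_left_mono) auto
    finally show ?thesis .
  qed
  \<comment> \<open>Halving once per block of length N. The incomplete block costs the factor 2 in
    \<open>C0\<close>, the offset of the starting site the factor exp (c s).\<close>
  define c where "c = ln 2 / N"
  have c: "c > 0" using N by (simp add: c_def)
  define C0 where "C0 = B * ((1 + B) * norm (Z 0)) * 2 * exp (c * s)"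
  have far: "\<bar>f n\<bar> \<le> C0 * exp (- c * n)" if "s \<le> n" for n
  proof -
    define k where "k = (n - s) div N"
    define i where "i = (n - s) mod N"
    have n: "n = s + k * N + i" "i < N" using that N by (auto simp: k_def i_def)
    have "\<bar>f (s + k * N + i)\<bar> \<le> B * norm (Z k)"
      unfolding B_def Z_def using n f by (intro value_in_block[of "Suc k"]) auto
    also have "\<dots> \<le> B * ((1 + B) * ((1/2) ^ k * norm (Z 0)))" using B by (intro mult_left_mono nZ) auto
    also have "\<dots> = B * ((1 + B) * norm (Z 0)) * (1/2) ^ k" by simp
    also have "\<dots> \<le> B * ((1 + B) * norm (Z 0)) * (2 * exp (c * s) * exp (- c * n))"
    proof (rule mult_left_mono)
      have "(1/2 :: real) ^ k = exp (- ln 2 * k)"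
        using exp_of_nat_mult[of k "- ln 2 :: real"] by (simp add: exp_minus mult.commute inverse_eq_divide)
      also have "\<dots> \<le> exp (ln 2 + c * s - c * n)"
      proof -
        have "real n - s \<le> (k + 1) * N" using n by (simp add: algebra_simps)
        then have "c * (real n - s) \<le> c * ((k + 1) * N)" using c by (intro mult_left_mono) auto
        also have "\<dots> = ln 2 * (k + 1)"
        proof -
          have "real N \<noteq> 0" using N by simp
          then show ?thesis by (simp add: c_def field_simps)
        qed
        finally show ?thesis by (simp add: algebra_simps)
      qed
      also have "\<dots> = 2 * exp (c * s) * exp (- c * n)" by (simp add: exp_add exp_diff exp_minus divide_inverse)
      finally show "(1/2) ^ k \<le> 2 * exp (c * s) * exp (- c * n)" .
    qed (use B in auto)
    finally show ?thesis using n by (simp add: C0_def mult_ac)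
  qed
  define C where "C = C0 + \<bar>K\<bar> * exp (c * s) + 1"
  have C0: "0 \<le> C0" using B by (simp add: C0_def)
  have "\<bar>f n\<bar> \<le> C * exp (- c * n)" for n
  proof (cases "s \<le> n")
    case True
    have "C0 \<le> C" by (simp add: C_def)
    then have "C0 * exp (- c * n) \<le> C * exp (- c * n)" by (intro mult_right_mono) auto
    with far[OF True] show ?thesis by (rule order_trans)
  next
    case False
    have "\<bar>f n\<bar> \<le> \<bar>K\<bar>" using bd[of n] by simp
    also have "\<dots> \<le> \<bar>K\<bar> * exp (c * s) * exp (- c * n)"
      using False c by (simp add: mult.assoc mult_exp_exp mult_le_cancel_left1)
    also have "\<dots> \<le> C * exp (- c * n)" using C0 by (intro mult_right_mono) (auto simp: C_def)
    finally show ?thesis .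
  qed
  moreover have "C > 0" using C0 by (simp add: C_def add_nonneg_pos)
  ultimately show ?thesis using c by blast
qed

end

section \<open>Operators on boxes\<close>

definition jacobi :: "(int \<Rightarrow> real) \<Rightarrow> int \<Rightarrow> int \<Rightarrow> real" where
  "jacobi v i j = (if i = j then v i else if \<bar>i - j\<bar> = 1 then 1 else 0)"

lemma jacobi_sym: "jacobi v i j = jacobi v j i"
  by (auto simp: jacobi_def)

lemma perturb_diag_jacobi: "perturb_diag (jacobi v) p t = jacobi (v(p := v p + t))"
  by (auto simp: perturb_diag_def jacobi_def fun_eq_iff)

text \<open>The boundary condition of the box is encoded in \<open>f\<close> vanishing outside, so
  the three-term formula holds at the end sites too.\<close>

lemma mat_vec_jacobi:
  assumes f: "\<And>j. j \<notin> {-L..L} \<Longrightarrow> f j = 0" and i: "i \<in> {-L..L}"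
  shows "mat_vec {-L..L} (jacobi v) f i = f (i + 1) + f (i - 1) + v i * f i"
proof -
  have "mat_vec {-L..L} (jacobi v) f i = (\<Sum>j\<in>{-L..L} \<union> {i - 1, i, i + 1}. jacobi v i j * f j)"
    unfolding mat_vec_def using f by (intro sum.mono_neutral_left) auto
  also have "\<dots> = (\<Sum>j\<in>{i - 1, i, i + 1}. jacobi v i j * f j)"
    by (intro sum.mono_neutral_right) (auto simp: jacobi_def)
  also have "\<dots> = f (i + 1) + f (i - 1) + v i * f i" by (simp add: jacobi_def)
  finally show ?thesis .
qed

lemma box_eigenvector:
  assumes "ortho_eigen {-L..L} (jacobi v) n F \<phi>" "k < n"
  shows "\<And>i. i \<notin> {-L..L} \<Longrightarrow> \<phi> k i = 0"
    and "\<And>i. i \<in> {-L..L} \<Longrightarrow> \<phi> k (i + 1) + \<phi> k (i - 1) + v i * \<phi> k i = F k * \<phi> k i"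
    and "(\<Sum>i\<in>{-L..L}. (\<phi> k i)\<^sup>2) = 1"
proof -
  show 0: "\<And>i. i \<notin> {-L..L} \<Longrightarrow> \<phi> k i = 0" using assms by (auto simp: ortho_eigen_def)
  show "\<phi> k (i + 1) + \<phi> k (i - 1) + v i * \<phi> k i = F k * \<phi> k i" if "i \<in> {-L..L}" for i
    using assms that mat_vec_jacobi[of L "\<phi> k" i v] 0 by (auto simp: ortho_eigen_def)
  show "(\<Sum>i\<in>{-L..L}. (\<phi> k i)\<^sup>2) = 1"
    using assms by (auto simp: ortho_eigen_def inner_on_def power2_eq_square)
qed

text \<open>The eigenvalue equation at a site where the eigenvector has its largest modulus.\<close>

lemma box_eigenvalue_bound:
  assumes oe: "ortho_eigen {-L..L} (jacobi v) n F \<phi>" "k < n" and v: "\<And>i. i \<in> {-L..L} \<Longrightarrow> \<bar>v i\<bar> \<le> M"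
  shows "\<bar>F k\<bar> \<le> M + 2"
proof -
  note ev = box_eigenvector[OF oe]
  have ne: "{-L..L} \<noteq> {}" using ev(3) by force
  obtain m where m: "m \<in> {-L..L}" "\<And>i. i \<in> {-L..L} \<Longrightarrow> \<bar>\<phi> k i\<bar> \<le> \<bar>\<phi> k m\<bar>"
  proof -
    let ?A = "(\<lambda>i. \<bar>\<phi> k i\<bar>) ` {-L..L}"
    have "Max ?A \<in> ?A" using ne by (intro Max_in) auto
    then obtain m where "m \<in> {-L..L}" "\<bar>\<phi> k m\<bar> = Max ?A" by auto
    moreover have "\<bar>\<phi> k i\<bar> \<le> Max ?A" if "i \<in> {-L..L}" for i using that by (intro Max_ge) auto
    ultimately show thesis using that by metis
  qed
  have le: "\<bar>\<phi> k i\<bar> \<le> \<bar>\<phi> k m\<bar>" for i using m ev(1) by (cases "i \<in> {-L..L}") auto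
  have pos: "\<bar>\<phi> k m\<bar> > 0"
  proof (rule ccontr)
    assume "\<not> ?thesis"
    then have "\<phi> k i = 0" for i using le[of i] by simp
    then show False using ev(3) by simp
  qed
  have "\<bar>F k\<bar> * \<bar>\<phi> k m\<bar> = \<bar>\<phi> k (m + 1) + \<phi> k (m - 1) + v m * \<phi> k m\<bar>"
    using ev(2)[OF m(1)] by (simp add: abs_mult)
  also have "\<dots> \<le> \<bar>\<phi> k (m + 1)\<bar> + \<bar>\<phi> k (m - 1)\<bar> + \<bar>v m\<bar> * \<bar>\<phi> k m\<bar>"
    unfolding abs_mult[symmetric] by linarith
  also have "\<dots> \<le> \<bar>\<phi> k m\<bar> + \<bar>\<phi> k m\<bar> + M * \<bar>\<phi> k m\<bar>"
    using v[OF m(1)] by (intro add_mono le mult_right_mono) auto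
  also have "\<dots> = (M + 2) * \<bar>\<phi> k m\<bar>" by (simp add: algebra_simps)
  finally show ?thesis using pos by simp
qed

lemma eigenbasis_parseval:
  assumes I: "finite I" and eb: "eigenbasis I a n F \<phi>"
  shows "(\<Sum>k<n. (inner_on I (\<phi> k) h)\<^sup>2) = inner_on I h h"
proof -
  have "(\<Sum>k<n. (inner_on I (\<phi> k) h)\<^sup>2) = (\<Sum>k<n. \<Sum>i\<in>I. \<Sum>j\<in>I. h i * h j * (\<phi> k i * \<phi> k j))"
    by (simp add: inner_on_def power2_eq_square sum_product mult_ac)
  also have "\<dots> = (\<Sum>i\<in>I. \<Sum>k<n. \<Sum>j\<in>I. h i * h j * (\<phi> k i * \<phi> k j))" by (rule sum.swap)
  also have "\<dots> = (\<Sum>i\<in>I. \<Sum>j\<in>I. \<Sum>k<n. h i * h j * (\<phi> k i * \<phi> k j))" by (intro sum.cong refl sum.swap)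
  also have "\<dots> = (\<Sum>i\<in>I. \<Sum>j\<in>I. h i * h j * (if j = i then 1 else 0))"
    using eb by (intro sum.cong refl) (simp add: sum_distrib_left[symmetric] eigenbasis_def)
  also have "\<dots> = inner_on I h h"
    using I by (simp add: inner_on_def if_distrib cong: if_cong)
  finally show ?thesis .
qed

text \<open>Parseval for the residual; it converts the small weight of discarded eigenvectors at
  \<open>p\<close> into an approximation of the unit vector, and back.\<close>

lemma eigenbasis_partial_residual:
  assumes I: "finite I" "p \<in> I" and eb: "eigenbasis I a n F \<phi>" and G: "G \<subseteq> {..<n}"
  defines "h \<equiv> \<lambda>i. (if i = p then 1 else 0) - (\<Sum>k\<in>G. \<phi> k p * \<phi> k i)"
  shows "inner_on I h h = (\<Sum>k\<in>{..<n} - G. (\<phi> k p)\<^sup>2)"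
proof -
  have finG: "finite G" using G finite_subset by blast
  have "inner_on I (\<phi> k) h = (if k \<in> G then 0 else \<phi> k p)" if k: "k < n" for k
  proof -
    have e: "inner_on I (\<phi> k) (\<lambda>i. if i = p then 1 else 0) = \<phi> k p"
      using I by (simp add: inner_on_def if_distrib[of "\<lambda>x. _ * x"] cong: if_cong)
    have "inner_on I (\<phi> k) (\<lambda>i. \<Sum>l\<in>G. \<phi> l p * \<phi> l i) = (\<Sum>l\<in>G. \<phi> l p * inner_on I (\<phi> l) (\<phi> k))"
      unfolding inner_on_commute[of I "\<phi> k"] inner_on_sum_left inner_on_scale_left ..
    also have "\<dots> = (\<Sum>l\<in>G. \<phi> l p * (if l = k then 1 else 0))"
      using eb G k by (intro sum.cong refl) (auto simp: eigenbasis_def ortho_eigen_def)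
    also have "\<dots> = (if k \<in> G then \<phi> k p else 0)"
      using finG by (simp add: if_distrib cong: if_cong)
    finally show ?thesis unfolding h_def inner_on_diff_right e by simp
  qed
  then have "inner_on I h h = (\<Sum>k<n. (if k \<in> G then 0 else \<phi> k p)\<^sup>2)"
    using eigenbasis_parseval[OF I(1) eb, of h] by simp
  also have "\<dots> = (\<Sum>k\<in>{..<n} - G. (\<phi> k p)\<^sup>2)"
    by (rule sum.mono_neutral_cong_right) auto
  finally show ?thesis .
qed

section \<open>Passage to the whole line and continuation beyond a box\<close>

lemma tendsto_apply_fun:
  fixes X :: "nat \<Rightarrow> 'a :: countable \<Rightarrow> real"
  assumes "X \<longlonglongrightarrow> l"
  shows "(\<lambda>n. X n i) \<longlonglongrightarrow> l i"
proof -
  have "isCont (\<lambda>f :: 'a \<Rightarrow> real. f i) l"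
    by (rule continuous_on_interior[of UNIV]) auto
  then show ?thesis using assms by (rule isCont_tendsto_compose)
qed

text \<open>Energies and vectors are packed into one function on a countable index type,
  \<open>None\<close> standing for the energy, so that one convergent subsequence serves them all.
  Mass may escape in the limit, hence only upper bounds on finite sums are required; the alternative
  of a zero vector admits padding to exactly \<open>K\<close> vectors.\<close>

lemma box_limit:
  fixes W :: "int \<Rightarrow> real" and e :: "nat \<Rightarrow> nat \<Rightarrow> real" and \<psi> :: "nat \<Rightarrow> nat \<Rightarrow> int \<Rightarrow> real" and K :: nat
  assumes e: "\<And>p j. \<bar>e p j\<bar> \<le> R" and C: "closed C" "\<And>p j. j < K \<Longrightarrow> e p j \<in> C \<or> (\<forall>i. \<psi> p j i = 0)"
    and bnd: "\<And>p j S. finite S \<Longrightarrow> (\<Sum>i\<in>S. (\<psi> p j i)\<^sup>2) \<le> 1"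
    and eig: "\<And>p j i. j < K \<Longrightarrow> \<bar>i\<bar> \<le> int p \<Longrightarrow> \<psi> p j (i + 1) + \<psi> p j (i - 1) + W i * \<psi> p j i = e p j * \<psi> p j i"
    and approx: "\<And>p S. finite S \<Longrightarrow> (\<Sum>i\<in>S. ((if i = 0 then 1 else 0) - (\<Sum>j<K. \<psi> p j 0 * \<psi> p j i))\<^sup>2) \<le> \<eta>"
  obtains E \<phi> where "\<And>j. j < K \<Longrightarrow> E j \<in> C \<or> (\<forall>i. \<phi> j i = 0)"
    "\<And>j S. finite S \<Longrightarrow> (\<Sum>i\<in>S. (\<phi> j i)\<^sup>2) \<le> 1"
    "\<And>j i. j < K \<Longrightarrow> \<phi> j (i + 1) + \<phi> j (i - 1) + W i * \<phi> j i = E j * \<phi> j i"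
    "\<And>S. finite S \<Longrightarrow> (\<Sum>i\<in>S. ((if i = 0 then 1 else 0) - (\<Sum>j<K. \<phi> j 0 * \<phi> j i))\<^sup>2) \<le> (\<eta> :: real)"
proof -
  define g :: "nat \<Rightarrow> nat \<times> int option \<Rightarrow> real"
    where "g p = (\<lambda>(j, x). case x of None \<Rightarrow> e p j | Some i \<Rightarrow> \<psi> p j i)" for p
  let ?S = "\<lambda>_ :: nat \<times> int option. {- (\<bar>R\<bar> + 1)..\<bar>R\<bar> + 1}"
  have \<psi>1: "\<bar>\<psi> p j i\<bar> \<le> 1" for p j i
  proof -
    have "(\<psi> p j i)\<^sup>2 \<le> 1\<^sup>2" using bnd[of "{i}" p j] by simp
    then show ?thesis by (simp only: abs_le_square_iff[symmetric] abs_one)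
  qed
  have "g p x \<in> ?S x" for p x
  proof -
    have "\<bar>g p x\<bar> \<le> \<bar>R\<bar> + 1"
    proof (cases "snd x")
      case None
      then show ?thesis using e[of p "fst x"] by (simp add: g_def case_prod_unfold)
    next
      case (Some i)
      then show ?thesis using \<psi>1[of p "fst x" i] by (simp add: g_def case_prod_unfold)
    qed
    then show ?thesis by (simp add: abs_le_iff) 
  qed
  then have mem: "\<forall>p. g p \<in> Pi\<^sub>E UNIV ?S" by auto
  have "seq_compact (Pi\<^sub>E UNIV ?S)"
    by (rule compact_imp_seq_compact[OF compact_functions_PiE]) simp
  then obtain l r where r: "strict_mono r" "(g \<circ> r) \<longlonglongrightarrow> l"
    using mem unfolding seq_compact_def by metis
  define E where "E j = l (j, None)" for j
  define \<phi> where "\<phi> j i = l (j, Some i)" for j i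
  have E: "(\<lambda>p. e (r p) j) \<longlonglongrightarrow> E j" for j
    using tendsto_apply_fun[OF r(2), of "(j, None)"] by (simp add: g_def E_def)
  have \<phi>: "(\<lambda>p. \<psi> (r p) j i) \<longlonglongrightarrow> \<phi> j i" for j i
    using tendsto_apply_fun[OF r(2), of "(j, Some i)"] by (simp add: g_def \<phi>_def)
  have inf: "\<forall>\<^sub>F p in sequentially. m \<le> r p" for m
    using seq_suble[OF r(1)] by (intro eventually_sequentiallyI[of m]) (meson order_trans)
  show thesis
  proof
    show "E j \<in> C \<or> (\<forall>i. \<phi> j i = 0)" if j: "j < K" for j
    proof (rule disjCI)
      assume nz: "\<not> (\<forall>i. \<phi> j i = 0)"
      then obtain i where i: "\<phi> j i \<noteq> 0" by blast
      have "\<forall>\<^sub>F p in sequentially. \<psi> (r p) j i \<noteq> 0"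
        using tendsto_imp_eventually_ne[OF \<phi> i] .
      then have "\<forall>\<^sub>F p in sequentially. e (r p) j \<in> C"
        by eventually_elim (use C(2)[OF j] in blast)
      then show "E j \<in> C" using Lim_in_closed_set[OF C(1) _ _ E] by simp
    qed
    show "(\<Sum>i\<in>S. (\<phi> j i)\<^sup>2) \<le> 1" if "finite S" for j S
    proof (rule tendsto_upperbound[OF _ _ sequentially_bot])
      show "(\<lambda>p. \<Sum>i\<in>S. (\<psi> (r p) j i)\<^sup>2) \<longlonglongrightarrow> (\<Sum>i\<in>S. (\<phi> j i)\<^sup>2)"
        by (intro tendsto_intros \<phi>)
    qed (simp add: bnd that)
    show "\<phi> j (i + 1) + \<phi> j (i - 1) + W i * \<phi> j i = E j * \<phi> j i" if j: "j < K" for j i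
    proof (rule tendsto_unique[OF sequentially_bot])
      show "(\<lambda>p. \<psi> (r p) j (i + 1) + \<psi> (r p) j (i - 1) + W i * \<psi> (r p) j i) \<longlonglongrightarrow> \<phi> j (i + 1) + \<phi> j (i - 1) + W i * \<phi> j i"
        by (intro tendsto_intros \<phi>)
      have "\<forall>\<^sub>F p in sequentially. e (r p) j * \<psi> (r p) j i = \<psi> (r p) j (i + 1) + \<psi> (r p) j (i - 1) + W i * \<psi> (r p) j i"
        using inf[of "nat \<bar>i\<bar>"] by eventually_elim (simp add: eig[OF j] nat_le_iff)
      then show "(\<lambda>p. \<psi> (r p) j (i + 1) + \<psi> (r p) j (i - 1) + W i * \<psi> (r p) j i) \<longlonglongrightarrow> E j * \<phi> j i"
        using tendsto_mult[OF E[of j] \<phi>[of j i]] by (rule Lim_transform_eventually[rotated])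
    qed
    show "(\<Sum>i\<in>S. ((if i = 0 then 1 else 0) - (\<Sum>j<K. \<phi> j 0 * \<phi> j i))\<^sup>2) \<le> \<eta>" if "finite S" for S
    proof (rule tendsto_upperbound[OF _ _ sequentially_bot])
      show "(\<lambda>p. \<Sum>i\<in>S. ((if i = 0 then 1 else 0) - (\<Sum>j<K. \<psi> (r p) j 0 * \<psi> (r p) j i))\<^sup>2)
          \<longlonglongrightarrow> (\<Sum>i\<in>S. ((if i = 0 then 1 else 0) - (\<Sum>j<K. \<phi> j 0 * \<phi> j i))\<^sup>2)"
        by (intro tendsto_intros \<phi>)
    qed (intro always_eventually allI approx that)
  qed
qed

text \<open>The recursion carries the current vector for every energy in \<open>X\<close>, starting
  from (1, 0), so each new block is chosen for all orbits simultaneously.\<close>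

lemma expanding_extension:
  fixes u :: "nat \<Rightarrow> real"
  assumes N: "2 \<le> N"
    and block: "\<And>vs y. length vs = N \<Longrightarrow> set vs \<subseteq> range u \<Longrightarrow> (\<And>E. E \<in> X \<Longrightarrow> y E \<noteq> 0) \<Longrightarrow>
      \<exists>ws. lifted c vs ws \<and> (\<forall>E\<in>X. 4 * norm (y E) \<le> norm (transfer E ws (y E)))"
    and c: "0 \<le> c"
  obtains u' where "\<And>n. u n \<le> u' n \<and> u' n \<le> u n + c" "\<And>n. n < s \<Longrightarrow> u' n = u n"
    "\<And>E. E \<in> X \<Longrightarrow> expanding E u' s N"
proof -
  define vs where "vs k = map u [s + k * N..<s + Suc k * N]" for k
  define P where "P k (w :: real list \<times> (real \<Rightarrow> real \<times> real)) \<longleftrightarrow> (\<forall>E\<in>X. snd w E \<noteq> 0)" for k :: nat and w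
  define Q where "Q k w w' \<longleftrightarrow> lifted c (vs k) (fst w') \<and>
     (\<forall>E\<in>X. snd w' E = transfer E (fst w') (snd w E) \<and> 4 * norm (snd w E) \<le> norm (snd w' E))"
    for k and w w' :: "real list \<times> (real \<Rightarrow> real \<times> real)"
  have "\<exists>f. \<forall>k. P k (f k) \<and> Q k (f k) (f (Suc k))"
  proof (rule dependent_nat_choice)
    show "\<exists>w. P 0 w" by (rule exI[of _ "([], \<lambda>_. (1, 0))"]) (simp add: P_def unit_nonzero)
    fix w k assume w: "P k w"
    have "length (vs k) = N" "set (vs k) \<subseteq> range u" by (auto simp: vs_def)
    from block[OF this, of "snd w"] w obtain ws where ws: "lifted c (vs k) ws"
      "\<forall>E\<in>X. 4 * norm (snd w E) \<le> norm (transfer E ws (snd w E))" by (auto simp: P_def)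
    then have "P (Suc k) (ws, \<lambda>E. transfer E ws (snd w E)) \<and> Q k w (ws, \<lambda>E. transfer E ws (snd w E))"
      using w by (simp add: P_def Q_def)
    then show "\<exists>w'. P (Suc k) w' \<and> Q k w w'" by blast
  qed
  then obtain f where f: "\<And>k. P k (f k)" "\<And>k. Q k (f k) (f (Suc k))" by blast
  define ws where "ws k = fst (f (Suc k))" for k
  define y where "y k = snd (f k)" for k
  have lif: "lifted c (vs k) (ws k)" for k using f(2) by (simp add: Q_def ws_def)
  have len: "length (ws k) = N" for k
    using list_all2_lengthD[OF lif[unfolded lifted_def]] by (simp add: vs_def)
  define u' where "u' n = (if n < s then u n else ws ((n - s) div N) ! ((n - s) mod N))" for n
  have ws: "map u' [s + k * N..<s + Suc k * N] = ws k" for k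
  proof (rule nth_equalityI)
    fix i assume "i < length (map u' [s + k * N..<s + Suc k * N])"
    then have i: "i < N" by simp
    have "(s + k * N + i - s) div N = k" "(s + k * N + i - s) mod N = i"
      using i by (simp_all add: add.assoc)
    then show "map u' [s + k * N..<s + Suc k * N] ! i = ws k ! i"
      using i by (simp add: u'_def)
  qed (simp add: len)
  show thesis
  proof
    show "u n \<le> u' n \<and> u' n \<le> u n + c" for n
    proof (cases "n < s")
      case False
      define k i where "k = (n - s) div N" and "i = (n - s) mod N"
      have i: "i < N" "n = s + k * N + i" using N False by (auto simp: k_def i_def)
      have "vs k ! i \<le> ws k ! i \<and> ws k ! i \<le> vs k ! i + c"
        using list_all2_nthD2[OF lif[of k, unfolded lifted_def], of i] i len by simp
      moreover have "vs k ! i = u n" using i by (simp add: vs_def)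
      ultimately show ?thesis using False by (simp add: u'_def k_def i_def)
    qed (use c in \<open>simp add: u'_def\<close>)
    show "u' n = u n" if "n < s" for n using that by (simp add: u'_def)
    show "expanding E u' s N" if "E \<in> X" for E
      unfolding expanding_def ws
    proof (intro exI[of _ "\<lambda>k. y k E"] allI conjI)
      fix k
      show "y k E \<noteq> 0" using f(1)[of k] that by (simp add: P_def y_def)
      show "y (Suc k) E = transfer E (ws k) (y k E)" "4 * norm (y k E) \<le> norm (y (Suc k) E)"
        using f(2)[of k, unfolded Q_def] that unfolding y_def ws_def by blast+
    qed
  qed
qed

section \<open>Decay of eigenvectors inside a box\<close>

lemma transfer_solution_inward:
  assumes "\<And>n. 1 \<le> n \<Longrightarrow> n \<le> L \<Longrightarrow> f (n - 1) = (E - u n) * f n - f (Suc n)" "i \<le> L"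
  shows "transfer E (map (\<lambda>j. u (L - j)) [0..<i]) (f L, f (Suc L)) = (f (L - i), f (Suc (L - i)))"
  using assms(2)
proof (induction i)
  case (Suc i)
  then have "f (L - i - 1) = (E - u (L - i)) * f (L - i) - f (Suc (L - i))" using assms(1)[of "L - i"] by simp
  moreover have "Suc (L - Suc i) = L - i" using Suc.prems by simp
  ultimately show ?case using Suc by (simp add: transfer_append transfer_Cons step_def)
qed simp

text \<open>As f vanishes beyond the end, the solution read inwards is a multiple of the orbit of
  (1, 0); growth of that orbit towards 0 is decay of f away from 0. Passing from square roots to
  norms turns 2 ^ m and \<open>K\<close> into 4 ^ m and K^2.\<close>

lemma inward_decay:
  fixes f :: "nat \<Rightarrow> real" and N p :: nat and q K b E :: real
  defines "L \<equiv> p * N"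
  assumes f: "\<And>n. 1 \<le> n \<Longrightarrow> n \<le> L \<Longrightarrow> f (n - 1) = (E - u n) * f n - f (Suc n)" "f (Suc L) = 0"
    and dec: "\<And>m. m \<le> p \<Longrightarrow> 2 ^ m * sqrt (norm (transfer E (take ((p - m) * N) (map (\<lambda>j. u (L - j)) [0..<L])) (1, 0)))
            \<le> q * sqrt (norm (transfer E (map (\<lambda>j. u (L - j)) [0..<L]) (1, 0)))"
    and q: "0 \<le> q" "q \<le> K" and b: "1 \<le> b" "\<And>n. 1 \<le> n \<Longrightarrow> n \<le> L \<Longrightarrow> \<bar>E - u n\<bar> + 2 \<le> b"
  shows "(\<Sum>n<L. (f (Suc n))\<^sup>2) \<le> N * (b ^ N * K\<^sup>2)\<^sup>2 * ((f 0)\<^sup>2 + (f 1)\<^sup>2)"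
    and "(f L)\<^sup>2 \<le> (K\<^sup>2 * (1/4) ^ p)\<^sup>2 * ((f 0)\<^sup>2 + (f 1)\<^sup>2)"
proof -
  define X where "X n = (f n, f (Suc n))" for n
  have K: "0 \<le> K" using q by simp
  have X: "X (L - i) = f L *\<^sub>R transfer E (map (\<lambda>j. u (L - j)) [0..<i]) (1, 0)" if "i \<le> L" for i
    using transfer_solution_inward[OF f(1) that] f(2)
    by (simp add: X_def flip: transfer_scaleR)
  have Xm: "norm (X (m * N)) \<le> K\<^sup>2 * (1/4) ^ m * norm (X 0)" if m: "m \<le> p" for m
  proof -
    have mL: "m * N \<le> L" using m by (simp add: L_def)
    have take: "take ((p - m) * N) (map (\<lambda>j. u (L - j)) [0..<L]) = map (\<lambda>j. u (L - j)) [0..<(p - m) * N]"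
      by (simp add: take_map L_def)
    have Lm: "L - (p - m) * N = m * N" using m by (simp add: L_def diff_mult_distrib)
    have A: "norm (X (m * N)) = \<bar>f L\<bar> * norm (transfer E (take ((p - m) * N) (map (\<lambda>j. u (L - j)) [0..<L])) (1, 0))"
      using X[of "(p - m) * N"] unfolding take Lm by (simp add: L_def)
    have B: "norm (X 0) = \<bar>f L\<bar> * norm (transfer E (map (\<lambda>j. u (L - j)) [0..<L]) (1, 0))"
      using X[of L] by simp
    have "sqrt \<bar>f L\<bar> * (2 ^ m * sqrt (norm (transfer E (take ((p - m) * N) (map (\<lambda>j. u (L - j)) [0..<L])) (1, 0))))
       \<le> sqrt \<bar>f L\<bar> * (q * sqrt (norm (transfer E (map (\<lambda>j. u (L - j)) [0..<L]) (1, 0))))"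
      by (intro mult_left_mono dec m) auto
    then have "2 ^ m * sqrt (norm (X (m * N))) \<le> q * sqrt (norm (X 0))"
      unfolding A B real_sqrt_mult by (simp add: mult_ac)
    also have "\<dots> \<le> K * sqrt (norm (X 0))" using q by (intro mult_right_mono) auto
    finally have "(2 ^ m * sqrt (norm (X (m * N))))\<^sup>2 \<le> (K * sqrt (norm (X 0)))\<^sup>2"
      by (intro power_mono) auto
    moreover have "((2::real) ^ m)\<^sup>2 = 4 ^ m" by (induction m) (simp_all add: power2_eq_square)
    ultimately have "4 ^ m * norm (X (m * N)) \<le> K\<^sup>2 * norm (X 0)"
      by (simp add: power_mult_distrib)
    then have "(1/4) ^ m * (4 ^ m * norm (X (m * N))) \<le> (1/4) ^ m * (K\<^sup>2 * norm (X 0))"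
      by (intro mult_left_mono) auto
    moreover have "(1/4) ^ m * (4 ^ m * norm (X (m * N))) = norm (X (m * N))"
      by (simp only: mult.assoc[symmetric] power_mult_distrib[symmetric]) simp
    ultimately show ?thesis by (simp only: mult_ac)
  qed
  have X0: "(norm (X 0))\<^sup>2 = (f 0)\<^sup>2 + (f 1)\<^sup>2" by (simp add: X_def norm_Pair)
  have site: "(f (m * N + Suc i))\<^sup>2 \<le> (b ^ N * K\<^sup>2)\<^sup>2 * (1/4) ^ Suc m * (norm (X 0))\<^sup>2" if m: "m < p" and i: "i < N" for m i
  proof -
    define j where "j = N - Suc i"
    have m1: "Suc m * N \<le> L" using m unfolding L_def by (intro mult_le_mono1) simp
    have "transfer E (map (\<lambda>k. u (Suc m * N - k)) [0..<j]) (X (Suc m * N)) = X (Suc m * N - j)"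
      unfolding X_def by (rule transfer_solution_inward) (use f(1) m1 i in \<open>auto simp: j_def\<close>)
    moreover have "Suc m * N - j = m * N + Suc i" using i by (simp add: j_def)
    ultimately have "norm (X (m * N + Suc i)) = norm (transfer E (map (\<lambda>k. u (Suc m * N - k)) [0..<j]) (X (Suc m * N)))" by simp
    also have "\<dots> \<le> b ^ length (map (\<lambda>k. u (Suc m * N - k)) [0..<j]) * norm (X (Suc m * N))"
    proof (rule norm_transfer_le)
      fix v assume "v \<in> set (map (\<lambda>k. u (Suc m * N - k)) [0..<j])"
      then obtain k where k: "k < j" "v = u (Suc m * N - k)" by auto
      have "1 \<le> Suc m * N - k" "Suc m * N - k \<le> L" using k(1) m1 i by (auto simp: j_def)
      then show "\<bar>E - v\<bar> + 2 \<le> b" unfolding k(2) by (rule b(2))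
    qed (use b in auto)
    also have "\<dots> \<le> b ^ N * norm (X (Suc m * N))"
      using b i by (intro mult_right_mono power_increasing) (auto simp: j_def)
    also have "\<dots> \<le> b ^ N * (K\<^sup>2 * (1/4) ^ Suc m * norm (X 0))"
      using b m by (intro mult_left_mono Xm) auto
    finally have n: "norm (X (m * N + Suc i)) \<le> b ^ N * K\<^sup>2 * (1/4) ^ Suc m * norm (X 0)" by (simp add: mult_ac)
    have "\<bar>f (m * N + Suc i)\<bar> \<le> norm (X (m * N + Suc i))"
      using abs_fst_snd_le_norm(1)[of "X (m * N + Suc i)"] by (simp add: X_def)
    with n have "\<bar>f (m * N + Suc i)\<bar> \<le> b ^ N * K\<^sup>2 * (1/4) ^ Suc m * norm (X 0)" by linarith
    then have "\<bar>f (m * N + Suc i)\<bar>\<^sup>2 \<le> (b ^ N * K\<^sup>2 * (1/4) ^ Suc m * norm (X 0))\<^sup>2"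
      by (intro power_mono) auto
    also have "\<dots> = (b ^ N * K\<^sup>2)\<^sup>2 * ((1/4) ^ Suc m)\<^sup>2 * (norm (X 0))\<^sup>2" by (simp only: power_mult_distrib)
    also have "\<dots> \<le> (b ^ N * K\<^sup>2)\<^sup>2 * (1/4) ^ Suc m * (norm (X 0))\<^sup>2"
    proof (intro mult_right_mono mult_left_mono)
      have "((1/4::real) ^ Suc m)\<^sup>2 \<le> (1/4) ^ Suc m * 1"
        unfolding power2_eq_square by (intro mult_left_mono power_le_one) auto
      then show "((1/4::real) ^ Suc m)\<^sup>2 \<le> (1/4) ^ Suc m" by simp
    qed auto
    finally show ?thesis by simp
  qed
  have "(\<Sum>n<L. (f (Suc n))\<^sup>2) = (\<Sum>m<p. \<Sum>n\<in>{m * N..<m * N + N}. (f (Suc n))\<^sup>2)"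
    unfolding L_def by (rule sum.nat_group[symmetric])
  also have "\<dots> \<le> (\<Sum>m<p. \<Sum>n\<in>{m * N..<m * N + N}. (b ^ N * K\<^sup>2)\<^sup>2 * (1/4) ^ Suc m * (norm (X 0))\<^sup>2)"
  proof (intro sum_mono)
    fix m n assume mn: "m \<in> {..<p}" "n \<in> {m * N..<m * N + N}"
    then show "(f (Suc n))\<^sup>2 \<le> (b ^ N * K\<^sup>2)\<^sup>2 * (1/4) ^ Suc m * (norm (X 0))\<^sup>2"
    proof -
      have "n - m * N < N" "m * N + Suc (n - m * N) = Suc n" using mn by auto
      then show ?thesis using site[of m "n - m * N"] mn(1) by simp
    qed
  qed
  also have "\<dots> = N * (b ^ N * K\<^sup>2)\<^sup>2 * (norm (X 0))\<^sup>2 * (\<Sum>m<p. (1/4) ^ Suc m)"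
    by (simp add: sum_distrib_left mult_ac)
  also have "\<dots> \<le> N * (b ^ N * K\<^sup>2)\<^sup>2 * (norm (X 0))\<^sup>2 * 1"
  proof (rule mult_left_mono)
    have "(\<Sum>m<p. x ^ Suc m) = (1 - x ^ p) / 3" if "4 * x = 1" for x :: real
    proof (induction p)
      case (Suc p)
      have "4 * (x * x ^ p) = x ^ p" using that by (metis mult.assoc mult_1)
      with Suc show ?case by simp
    qed simp
    from this[of "1/4"] have "(\<Sum>m<p. (1/4::real) ^ Suc m) = (1 - (1/4) ^ p) / 3" by simp
    also have "\<dots> \<le> 1 / 3" by (intro divide_right_mono) auto
    also have "\<dots> \<le> 1" by simp
    finally show "(\<Sum>m<p. (1/4::real) ^ Suc m) \<le> 1" .
  qed auto
  finally show "(\<Sum>n<L. (f (Suc n))\<^sup>2) \<le> N * (b ^ N * K\<^sup>2)\<^sup>2 * ((f 0)\<^sup>2 + (f 1)\<^sup>2)"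
    by (simp add: X0)
  have "\<bar>f L\<bar> \<le> norm (X L)" using abs_fst_snd_le_norm(1)[of "X L"] by (simp add: X_def)
  also have "\<dots> \<le> K\<^sup>2 * (1/4) ^ p * norm (X 0)" using Xm[of p] by (simp add: L_def)
  finally have "\<bar>f L\<bar>\<^sup>2 \<le> (K\<^sup>2 * (1/4) ^ p * norm (X 0))\<^sup>2" by (intro power_mono) auto
  then show "(f L)\<^sup>2 \<le> (K\<^sup>2 * (1/4) ^ p)\<^sup>2 * ((f 0)\<^sup>2 + (f 1)\<^sup>2)"
    by (simp add: power_mult_distrib X0)
qed

lemma sum_symmetric_interval:
  fixes g :: "int \<Rightarrow> real"
  shows "(\<Sum>i\<in>{- int L..int L}. g i) = g 0 + (\<Sum>n<L. g (int (Suc n))) + (\<Sum>n<L. g (- int (Suc n)))"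
proof (induction L)
  case (Suc L)
  have "{- int (Suc L)..int (Suc L)} = insert (- int (Suc L)) (insert (int (Suc L)) {- int L..int L})" by auto
  then show ?case using Suc by simp
qed simp

lemma eigenbasis_column_le:
  assumes "finite I" "eigenbasis I a n F \<phi>" "G \<subseteq> {..<n}"
  shows "(\<Sum>k\<in>G. (\<phi> k i)\<^sup>2) \<le> 1"
proof -
  have "(\<Sum>k\<in>G. (\<phi> k i)\<^sup>2) \<le> (\<Sum>k<n. (\<phi> k i)\<^sup>2)"
    using assms(3) by (intro sum_mono2) auto
  also have "\<dots> \<le> 1"
  proof (cases "i \<in> I")
    case True
    then show ?thesis using eigenbasis_sum_squares[OF assms(2)] by simp
  next
    case False
    then show ?thesis using assms(2) by (simp add: eigenbasis_def ortho_eigen_def)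
  qed
  finally show ?thesis .
qed

text \<open>Double counting: each chosen eigenvector puts at least 1 / C on \<open>T\<close>, and by
  Bessel no site can receive more than 1 in total.\<close>

lemma card_le_of_concentration:
  assumes I: "finite I" and eb: "eigenbasis I a n F \<phi>" and G: "G \<subseteq> {..<n}" and T: "finite T" and C: "0 \<le> C"
    and conc: "\<And>k. k \<in> G \<Longrightarrow> 1 \<le> C * (\<Sum>i\<in>T. (\<phi> k i)\<^sup>2)"
  shows "real (card G) \<le> C * card T"
proof -
  have "real (card G) \<le> (\<Sum>k\<in>G. C * (\<Sum>i\<in>T. (\<phi> k i)\<^sup>2))"
    using sum_mono[of G "\<lambda>_. 1::real", OF conc] by simp
  also have "\<dots> = C * (\<Sum>i\<in>T. \<Sum>k\<in>G. (\<phi> k i)\<^sup>2)"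
    unfolding sum_distrib_left[symmetric] by (subst sum.swap) simp
  also have "\<dots> \<le> C * (\<Sum>i\<in>T. 1)"
    using C by (intro mult_left_mono sum_mono eigenbasis_column_le[OF I eb G]) auto
  finally show ?thesis by simp
qed

text \<open>All three constants are fixed before \<open>p\<close>. The sides of 0 are built
  independently of each other and of the value at 0, which stays free for rank-one averaging;
  changing it does not affect the transfer matrices of the sides.\<close>

lemma box_localization:
  fixes V :: "int \<Rightarrow> real" and M \<epsilon> \<eta> :: real
  assumes V: "\<And>i. \<bar>V i\<bar> \<le> M" and \<epsilon>: "0 < \<epsilon>" "\<epsilon> \<le> 1" and \<eta>: "0 < \<eta>"
  shows "\<exists>N k0 K. \<forall>p. \<exists>v n F \<phi> G. (\<forall>i. V i \<le> v i \<and> v i \<le> V i + \<epsilon>) \<and> (\<forall>i. int (p * N) < \<bar>i\<bar> \<longrightarrow> v i = V i) \<and>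
     eigenbasis {- int (p * N)..int (p * N)} (jacobi v) n F \<phi> \<and> G \<subseteq> {..<n} \<and> real (card G) \<le> k0 \<and>
     (\<Sum>k\<in>{..<n} - G. (\<phi> k 0)\<^sup>2) \<le> \<eta> \<and>
     (\<forall>k\<in>G. (\<phi> k (int (p * N)))\<^sup>2 \<le> (K * (1/4) ^ p)\<^sup>2 \<and> (\<phi> k (- int (p * N)))\<^sup>2 \<le> (K * (1/4) ^ p)\<^sup>2)"
proof -
  have M: "0 \<le> M" using V[of 0] by simp
  \<comment> \<open>Potentials bounded by M + 1 have eigenvalues bounded by M + 3 = R - 1, the
    margin required for averaging.\<close>
  define R where "R = M + 4"
  have R: "0 \<le> R" using M by (simp add: R_def)
  obtain N where N: "2 \<le> N" and inward: "\<And>p vs. length vs = p * N \<Longrightarrow> (\<And>v. v \<in> set vs \<Longrightarrow> \<bar>v\<bar> \<le> M) \<Longrightarrow>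
      \<exists>ws q. lifted \<epsilon> vs ws \<and> continuous_on {-R..R} q \<and> (\<forall>E\<in>{-R..R}. 0 \<le> q E) \<and> integral {-R..R} q \<le> 4 * R \<and>
        (\<forall>E\<in>{-R..R}. \<forall>m\<le>p. 2 ^ m * sqrt (norm (transfer E (take ((p - m) * N) ws) (1, 0)))
            \<le> q E * sqrt (norm (transfer E ws (1, 0))))"
  proof (rule inward_blocks[OF \<epsilon> M R], goal_cases)
    case (1 N)
    show ?case by (rule 1(1)[OF 1(2,3)])
  qed
  \<comment> \<open>8 R bounds the integral of the losses of both sides together. By Markov's
    inequality the eigenvectors with loss above \<open>Kq\<close> then have weight at most (Q + 1) /
    Kq = \<eta> at 0.\<close>
  define Q where "Q = pi / \<epsilon> * (8 * R)"
  define Kq where "Kq = (Q + 1) / \<eta>"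
  have Q: "0 \<le> Q" using R \<epsilon> by (simp add: Q_def)
  have Kq: "0 < Kq" using Q \<eta> by (simp add: Kq_def add_nonneg_pos)
  define b where "b = 2 * M + 6"
  define C1 where "C1 = N * (b ^ N * Kq\<^sup>2)\<^sup>2"
  have C1: "0 \<le> C1" by (simp add: C1_def)
  have "\<exists>v n F \<phi> G. (\<forall>i. V i \<le> v i \<and> v i \<le> V i + \<epsilon>) \<and> (\<forall>i. int (p * N) < \<bar>i\<bar> \<longrightarrow> v i = V i) \<and>
     eigenbasis {- int (p * N)..int (p * N)} (jacobi v) n F \<phi> \<and> G \<subseteq> {..<n} \<and> real (card G) \<le> (1 + 2 * C1) * 3 \<and>
     (\<Sum>k\<in>{..<n} - G. (\<phi> k 0)\<^sup>2) \<le> \<eta> \<and>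
     (\<forall>k\<in>G. (\<phi> k (int (p * N)))\<^sup>2 \<le> (Kq\<^sup>2 * (1/4) ^ p)\<^sup>2 \<and> (\<phi> k (- int (p * N)))\<^sup>2 \<le> (Kq\<^sup>2 * (1/4) ^ p)\<^sup>2)" for p
  proof -
    define L where "L = p * N"
    let ?I = "{- int L..int L}"
    \<comment> \<open>Listed from the end of the box towards 0, the direction in which the blocks
      are selected.\<close>
    define vR where "vR = map (\<lambda>j. V (int (L - j))) [0..<L]"
    define vL where "vL = map (\<lambda>j. V (- int (L - j))) [0..<L]"
    have len: "length vR = p * N" "length vL = p * N" by (simp_all add: vR_def vL_def L_def)
    have bnd: "\<bar>x\<bar> \<le> M" if "x \<in> set vR \<union> set vL" for x using that V by (auto simp: vR_def vL_def)
    obtain wR qR where wR: "lifted \<epsilon> vR wR" and qR: "continuous_on {-R..R} qR" "\<forall>E\<in>{-R..R}. 0 \<le> qR E" "integral {-R..R} qR \<le> 4 * R"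
      and dR: "\<forall>E\<in>{-R..R}. \<forall>m\<le>p. 2 ^ m * sqrt (norm (transfer E (take ((p - m) * N) wR) (1, 0)))
            \<le> qR E * sqrt (norm (transfer E wR (1, 0)))"
      using inward[OF len(1)] bnd by blast
    obtain wL qL where wL: "lifted \<epsilon> vL wL" and qL: "continuous_on {-R..R} qL" "\<forall>E\<in>{-R..R}. 0 \<le> qL E" "integral {-R..R} qL \<le> 4 * R"
      and dL: "\<forall>E\<in>{-R..R}. \<forall>m\<le>p. 2 ^ m * sqrt (norm (transfer E (take ((p - m) * N) wL) (1, 0)))
            \<le> qL E * sqrt (norm (transfer E wL (1, 0)))"
      using inward[OF len(2)] bnd by blast
    define v where "v i = (if 1 \<le> i \<and> i \<le> int L then wR ! nat (int L - i)
       else if - int L \<le> i \<and> i \<le> -1 then wL ! nat (int L + i) else V i)" for i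
    have lR: "length wR = L" "\<And>j. j < L \<Longrightarrow> V (int (L - j)) \<le> wR ! j \<and> wR ! j \<le> V (int (L - j)) + \<epsilon>"
      using wR by (auto simp: lifted_def list_all2_conv_all_nth vR_def)
    have lL: "length wL = L" "\<And>j. j < L \<Longrightarrow> V (- int (L - j)) \<le> wL ! j \<and> wL ! j \<le> V (- int (L - j)) + \<epsilon>"
      using wL by (auto simp: lifted_def list_all2_conv_all_nth vL_def)
    have v_near: "V i \<le> v i \<and> v i \<le> V i + \<epsilon>" for i
    proof -
      consider "1 \<le> i \<and> i \<le> int L" | "- int L \<le> i \<and> i \<le> -1" | "\<not> (1 \<le> i \<and> i \<le> int L)" "\<not> (- int L \<le> i \<and> i \<le> -1)" by blast
      then show ?thesis
      proof cases
        case 1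
        then have "nat (int L - i) < L" "int (L - nat (int L - i)) = i" by auto
        then show ?thesis using lR(2)[of "nat (int L - i)"] 1 by (simp add: v_def)
      next
        case 2
        then have "nat (int L + i) < L" "- int (L - nat (int L + i)) = i" by auto
        then show ?thesis using lL(2)[of "nat (int L + i)"] 2 by (simp add: v_def)
      qed (use \<epsilon> in \<open>auto simp: v_def\<close>)
    qed
    define vt where "vt t = v(0 := v 0 + t)" for t
    have vt0: "v 0 = V 0" by (simp add: v_def)
    have vt_near: "V i \<le> vt t i \<and> vt t i \<le> V i + \<epsilon>" if "t \<in> {0..\<epsilon>}" for t i
      using that v_near[of i] vt0 by (auto simp: vt_def)
    have vt_bnd: "\<bar>vt t i\<bar> \<le> M + 1" if "t \<in> {0..\<epsilon>}" for t i
      using vt_near[OF that, of i] V[of i] \<epsilon> by linarith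
    have mapR: "map (\<lambda>j. vt t (int (L - j))) [0..<L] = wR" for t
      by (rule nth_equalityI) (auto simp: lR vt_def v_def)
    have mapL: "map (\<lambda>j. vt t (- int (L - j))) [0..<L] = wL" for t
      by (rule nth_equalityI) (auto simp: lL vt_def v_def)
    define q where "q E = qR E + qL E" for E
    have q: "continuous_on {-R..R} q" "\<And>E. E \<in> {-R..R} \<Longrightarrow> 0 \<le> q E"
      unfolding q_def using qR qL by (auto intro!: continuous_intros)
    have "integral {-R..R} q = integral {-R..R} qR + integral {-R..R} qL"
      unfolding q_def using qR qL by (intro integral_add integrable_continuous_real) auto
    then have qint: "integral {-R..R} q \<le> 8 * R" using qR qL by simp
    have Fb: "\<bar>F k\<bar> \<le> R - 1" if "t \<in> {0..\<epsilon>}" "eigenbasis ?I (perturb_diag (jacobi v) 0 t) n F \<phi>" "k < n" for t n F \<phi> k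
      using box_eigenvalue_bound[of "int L" "vt t" n F \<phi> k "M + 1"] that vt_bnd
      by (auto simp: perturb_diag_jacobi vt_def[symmetric] eigenbasis_def R_def)
    have "\<exists>t\<in>{0..\<epsilon>}. \<forall>n F \<phi>. eigenbasis ?I (perturb_diag (jacobi v) 0 t) n F \<phi> \<longrightarrow>
        (\<Sum>k<n. (\<phi> k 0)\<^sup>2 * (q (F k) - 1)) \<le> pi / \<epsilon> * integral {-R..R} q"
    proof (rule rank_one_averaging)
      show "\<bar>F k\<bar> \<le> R - 1" if "t \<in> {0..\<epsilon>}" "eigenbasis ?I (perturb_diag (jacobi v) 0 t) n F \<phi>" "k < n" for t n F \<phi> k
        by (rule Fb[OF that])
    qed (use \<epsilon> q in \<open>auto intro: jacobi_sym\<close>)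
    then obtain t where t: "t \<in> {0..\<epsilon>}" and av: "\<And>n F \<phi>. eigenbasis ?I (perturb_diag (jacobi v) 0 t) n F \<phi> \<Longrightarrow>
        (\<Sum>k<n. (\<phi> k 0)\<^sup>2 * (q (F k) - 1)) \<le> pi / \<epsilon> * integral {-R..R} q"
      by blast
    obtain n F \<phi> where eb: "eigenbasis ?I (jacobi (vt t)) n F \<phi>"
      by (rule eigenbasis_exists[where I = ?I and a = "jacobi (vt t)"]) (auto intro: jacobi_sym)
    have eb': "eigenbasis ?I (perturb_diag (jacobi v) 0 t) n F \<phi>"
      using eb by (simp add: perturb_diag_jacobi vt_def)
    have FR: "F k \<in> {-R..R}" if "k < n" for k using Fb[OF t eb' that] by (auto simp: abs_le_iff)
    have one: "(\<Sum>k<n. (\<phi> k 0)\<^sup>2) = 1" using eigenbasis_sum_squares[OF eb, of 0] by simp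
    have "(\<Sum>k<n. (\<phi> k 0)\<^sup>2 * q (F k)) - 1 = (\<Sum>k<n. (\<phi> k 0)\<^sup>2 * (q (F k) - 1))"
      using one by (simp add: right_diff_distrib sum_subtractf)
    also have "\<dots> \<le> pi / \<epsilon> * integral {-R..R} q" by (rule av[OF eb'])
    also have "\<dots> \<le> Q" unfolding Q_def using qint \<epsilon> by (intro mult_left_mono) auto
    finally have wq: "(\<Sum>k<n. (\<phi> k 0)\<^sup>2 * q (F k)) \<le> Q + 1" by simp
    define G where "G = {k. k < n \<and> q (F k) \<le> Kq}"
    have G: "G \<subseteq> {..<n}" by (auto simp: G_def)
    have weight: "(\<Sum>k\<in>{..<n} - G. (\<phi> k 0)\<^sup>2) \<le> \<eta>"
    proof -
      have "Kq * (\<Sum>k\<in>{..<n} - G. (\<phi> k 0)\<^sup>2) = (\<Sum>k\<in>{..<n} - G. (\<phi> k 0)\<^sup>2 * Kq)"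
        by (simp add: sum_distrib_left mult.commute)
      also have "\<dots> \<le> (\<Sum>k\<in>{..<n} - G. (\<phi> k 0)\<^sup>2 * q (F k))"
        by (intro sum_mono mult_left_mono) (auto simp: G_def)
      also have "\<dots> \<le> (\<Sum>k<n. (\<phi> k 0)\<^sup>2 * q (F k))"
        using q(2) FR by (intro sum_mono2) auto
      also have "\<dots> \<le> Kq * \<eta>" using wq \<eta> by (simp add: Kq_def)
      finally show ?thesis using Kq by simp
    qed
    have sides: "(\<Sum>n<L. (\<phi> k (int (Suc n)))\<^sup>2) \<le> C1 * ((\<phi> k 0)\<^sup>2 + (\<phi> k 1)\<^sup>2)
        \<and> (\<phi> k (int L))\<^sup>2 \<le> (Kq\<^sup>2 * (1/4) ^ p)\<^sup>2 * ((\<phi> k 0)\<^sup>2 + (\<phi> k 1)\<^sup>2)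
        \<and> (\<Sum>n<L. (\<phi> k (- int (Suc n)))\<^sup>2) \<le> C1 * ((\<phi> k 0)\<^sup>2 + (\<phi> k (-1))\<^sup>2)
        \<and> (\<phi> k (- int L))\<^sup>2 \<le> (Kq\<^sup>2 * (1/4) ^ p)\<^sup>2 * ((\<phi> k 0)\<^sup>2 + (\<phi> k (-1))\<^sup>2)" if k: "k \<in> G" for k
    proof -
      have kn: "k < n" "q (F k) \<le> Kq" using k by (auto simp: G_def)
      note ev = box_eigenvector[OF eb[unfolded eigenbasis_def, THEN conjunct1] kn(1)]
      have qs: "0 \<le> qR (F k)" "0 \<le> qL (F k)" "qR (F k) \<le> Kq" "qL (F k) \<le> Kq"
        using FR[OF kn(1)] qR(2) qL(2) kn(2) by (force simp: q_def)+
      have b: "1 \<le> b" "\<bar>F k - vt t i\<bar> + 2 \<le> b" for i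
        using M Fb[OF t eb' kn(1)] vt_bnd[OF t, of i] by (auto simp: b_def R_def)
      have recR: "\<phi> k (int (n - 1)) = (F k - vt t (int n)) * \<phi> k (int n) - \<phi> k (int (Suc n))" if "1 \<le> n" "n \<le> L" for n
        using ev(2)[of "int n"] that by (simp add: of_nat_diff algebra_simps)
      have recL: "\<phi> k (- int (n - 1)) = (F k - vt t (- int n)) * \<phi> k (- int n) - \<phi> k (- int (Suc n))" if "1 \<le> n" "n \<le> L" for n
      proof -
        have e: "- int n + 1 = - int (n - 1)" "- int n - 1 = - int (Suc n)" using that by auto
        have "- int n \<in> ?I" using that by simp
        from ev(2)[OF this, unfolded e] show ?thesis by (simp only: left_diff_distrib)
      qed
      have 0: "\<phi> k (int (Suc L)) = 0" "\<phi> k (- int (Suc L)) = 0" using ev(1) by auto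
      have "2 ^ m * sqrt (norm (transfer (F k) (take ((p - m) * N) (map (\<lambda>j. vt t (int (p * N - j))) [0..<p * N])) (1, 0)))
            \<le> qR (F k) * sqrt (norm (transfer (F k) (map (\<lambda>j. vt t (int (p * N - j))) [0..<p * N]) (1, 0)))" if "m \<le> p" for m
        using dR FR[OF kn(1)] that unfolding mapR[unfolded L_def] by blast
      note right = inward_decay[where f = "\<lambda>n. \<phi> k (int n)" and u = "\<lambda>n. vt t (int n)" and E = "F k" and q = "qR (F k)" and K = Kq and b = b and N = N and p = p,
          folded L_def, OF recR 0(1) this[folded L_def] qs(1,3) b]
      have "2 ^ m * sqrt (norm (transfer (F k) (take ((p - m) * N) (map (\<lambda>j. vt t (- int (p * N - j))) [0..<p * N])) (1, 0)))
            \<le> qL (F k) * sqrt (norm (transfer (F k) (map (\<lambda>j. vt t (- int (p * N - j))) [0..<p * N]) (1, 0)))" if "m \<le> p" for m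
        using dL FR[OF kn(1)] that unfolding mapL[unfolded L_def] by blast
      note left = inward_decay[where f = "\<lambda>n. \<phi> k (- int n)" and u = "\<lambda>n. vt t (- int n)" and E = "F k" and q = "qL (F k)" and K = Kq and b = b and N = N and p = p,
          folded L_def, OF recL 0(2) this[folded L_def] qs(2,4) b]
      show ?thesis using right left by (simp add: C1_def)
    qed
    \<comment> \<open>Each side is controlled by 0 and its neighbour, so the three central sites
      carry a fixed share of the unit mass; this is the 3 in the bound on
      \<open>card G\<close>.\<close>
    have conc: "1 \<le> (1 + 2 * C1) * (\<Sum>i\<in>{-1, 0, 1}. (\<phi> k i)\<^sup>2)" if k: "k \<in> G" for k
    proof -
      have "k < n" using k by (simp add: G_def)
      then have "1 = (\<Sum>i\<in>?I. (\<phi> k i)\<^sup>2)"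
        using box_eigenvector(3)[of "int L" "vt t" n F \<phi> k] eb by (simp add: eigenbasis_def)
      also have "\<dots> \<le> (\<phi> k 0)\<^sup>2 + C1 * ((\<phi> k 0)\<^sup>2 + (\<phi> k 1)\<^sup>2) + C1 * ((\<phi> k 0)\<^sup>2 + (\<phi> k (-1))\<^sup>2)"
        unfolding sum_symmetric_interval using sides[OF k] by (intro add_mono) auto
      also have "\<dots> \<le> (1 + 2 * C1) * ((\<phi> k (-1))\<^sup>2 + ((\<phi> k 0)\<^sup>2 + (\<phi> k 1)\<^sup>2))"
        using C1 by (simp add: algebra_simps)
      finally show ?thesis by simp
    qed
    have "real (card G) \<le> (1 + 2 * C1) * card {-1, 0, 1::int}"
      using C1 by (intro card_le_of_concentration[OF _ eb G _ _ conc]) auto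
    then have cardG: "real (card G) \<le> (1 + 2 * C1) * 3" by simp
    have two: "(\<phi> k 0)\<^sup>2 + (\<phi> k 1)\<^sup>2 \<le> 1" "(\<phi> k 0)\<^sup>2 + (\<phi> k (-1))\<^sup>2 \<le> 1" if k: "k < n" for k
    proof -
      note ev = box_eigenvector[OF eb[unfolded eigenbasis_def, THEN conjunct1] k]
      have fin: "(\<Sum>i\<in>S. (\<phi> k i)\<^sup>2) \<le> 1" if "finite S" for S
      proof -
        have "(\<Sum>i\<in>S. (\<phi> k i)\<^sup>2) \<le> (\<Sum>i\<in>S \<union> ?I. (\<phi> k i)\<^sup>2)"
          using that by (intro sum_mono2) auto
        also have "\<dots> = (\<Sum>i\<in>?I. (\<phi> k i)\<^sup>2)"
          using that ev(1) by (intro sum.mono_neutral_right) auto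
        finally show ?thesis using ev(3) by simp
      qed
      show "(\<phi> k 0)\<^sup>2 + (\<phi> k 1)\<^sup>2 \<le> 1" "(\<phi> k 0)\<^sup>2 + (\<phi> k (-1))\<^sup>2 \<le> 1"
        using fin[of "{0, 1}"] fin[of "{0, -1}"] by simp_all
    qed
    have bdry: "(\<phi> k (int L))\<^sup>2 \<le> (Kq\<^sup>2 * (1/4) ^ p)\<^sup>2 \<and> (\<phi> k (- int L))\<^sup>2 \<le> (Kq\<^sup>2 * (1/4) ^ p)\<^sup>2" if k: "k \<in> G" for k
    proof -
      have "k < n" using k by (simp add: G_def)
      note two = two[OF this]
      have le: "x \<le> A" if "x \<le> A * y" "y \<le> 1" "0 \<le> A" for x A y :: real
        using that mult_left_mono[of y 1 A] by simp
      show ?thesis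
        using sides[OF k] le[of "(\<phi> k (int L))\<^sup>2", OF _ two(1)] le[of "(\<phi> k (- int L))\<^sup>2", OF _ two(2)] by simp
    qed
    show ?thesis
    proof (rule exI[of _ "vt t"], rule exI[of _ n], rule exI[of _ F], rule exI[of _ \<phi>], rule exI[of _ G], intro conjI)
      show "\<forall>i. V i \<le> vt t i \<and> vt t i \<le> V i + \<epsilon>" using vt_near[OF t] by blast
      show "\<forall>i. int (p * N) < \<bar>i\<bar> \<longrightarrow> vt t i = V i"
      proof (intro allI impI)
        fix i assume "int (p * N) < \<bar>i\<bar>"
        then have "int L < \<bar>i\<bar>" by (simp only: L_def)
        then have "i \<noteq> 0" "\<not> (1 \<le> i \<and> i \<le> int L)" "\<not> (- int L \<le> i \<and> i \<le> -1)" by linarith+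
        then show "vt t i = V i" by (auto simp: vt_def v_def)
      qed
      show "eigenbasis {- int (p * N)..int (p * N)} (jacobi (vt t)) n F \<phi>" using eb by (simp only: L_def)
      show "G \<subseteq> {..<n}" by (rule G)
      show "real (card G) \<le> (1 + 2 * C1) * 3" by (rule cardG)
      show "(\<Sum>k\<in>{..<n} - G. (\<phi> k 0)\<^sup>2) \<le> \<eta>" by (rule weight)
      show "\<forall>k\<in>G. (\<phi> k (int (p * N)))\<^sup>2 \<le> (Kq\<^sup>2 * (1/4) ^ p)\<^sup>2 \<and> (\<phi> k (- int (p * N)))\<^sup>2 \<le> (Kq\<^sup>2 * (1/4) ^ p)\<^sup>2"
        using bdry by (simp only: L_def) blast
    qed
  qed
  then show ?thesis
    by (intro exI[of _ N] exI[of _ "(1 + 2 * C1) * 3"] exI[of _ "Kq\<^sup>2"] allI)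
qed

text \<open>If \<open>F k\<close> is far from every \<open>e j\<close>, then \<open>\<phi> k\<close> is almost orthogonal to all the approximate
  eigenvectors \<open>\<psi>' j\<close>, hence almost orthogonal to the unit vector at \<open>p\<close>, which they nearly span.\<close>

lemma off_spectrum_mass:
  assumes I: "finite I" and p: "p \<in> I" and eb: "eigenbasis I a n F \<phi>"
    and sym: "\<And>i j. i \<in> I \<Longrightarrow> j \<in> I \<Longrightarrow> a i j = a j i"
    and G: "finite G" "(\<Sum>j\<in>G. (\<psi>' j p)\<^sup>2) \<le> 1"
    and h: "inner_on I (\<lambda>i. (if i = p then 1 else 0) - (\<Sum>j\<in>G. \<psi>' j p * \<psi>' j i))
       (\<lambda>i. (if i = p then 1 else 0) - (\<Sum>j\<in>G. \<psi>' j p * \<psi>' j i)) \<le> \<eta>"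
    and res: "\<And>j. j \<in> G \<Longrightarrow> inner_on I (\<lambda>i. mat_vec I a (\<psi>' j) i - e j * \<psi>' j i) (\<lambda>i. mat_vec I a (\<psi>' j) i - e j * \<psi>' j i) \<le> \<rho>"
    and J: "J \<subseteq> {..<n}" "\<And>k j. k \<in> J \<Longrightarrow> j \<in> G \<Longrightarrow> g \<le> \<bar>F k - e j\<bar>" and g: "0 < g"
  shows "(\<Sum>k\<in>J. (\<phi> k p)\<^sup>2) \<le> 2 * (card G * (\<rho> / g\<^sup>2)) + 2 * \<eta>"
proof -
  define h' where "h' = (\<lambda>i. (if i = p then 1 else 0) - (\<Sum>j\<in>G. \<psi>' j p * \<psi>' j i))"
  have finJ: "finite J" using J(1) finite_subset by blast
  have split: "(\<phi> k p)\<^sup>2 \<le> 2 * (\<Sum>j\<in>G. (inner_on I (\<phi> k) (\<psi>' j))\<^sup>2) + 2 * (inner_on I (\<phi> k) h')\<^sup>2" for k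
  proof -
    have "inner_on I (\<phi> k) (\<lambda>i. if i = p then 1 else 0) = \<phi> k p"
      using I p by (simp add: inner_on_def if_distrib[of "\<lambda>x. _ * x"] cong: if_cong)
    moreover have "inner_on I (\<phi> k) (\<lambda>i. \<Sum>j\<in>G. \<psi>' j p * \<psi>' j i) = (\<Sum>j\<in>G. \<psi>' j p * inner_on I (\<phi> k) (\<psi>' j))"
      unfolding inner_on_commute[of I "\<phi> k"] inner_on_sum_left inner_on_scale_left ..
    ultimately have "\<phi> k p = (\<Sum>j\<in>G. \<psi>' j p * inner_on I (\<phi> k) (\<psi>' j)) + inner_on I (\<phi> k) h'"
      by (simp add: h'_def inner_on_diff_right)
    moreover have "(x + y)\<^sup>2 \<le> 2 * x\<^sup>2 + 2 * y\<^sup>2" for x y :: real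
      using zero_le_power2[of "x - y"] by (simp add: power2_eq_square algebra_simps)
    ultimately have "(\<phi> k p)\<^sup>2 \<le> 2 * (\<Sum>j\<in>G. \<psi>' j p * inner_on I (\<phi> k) (\<psi>' j))\<^sup>2 + 2 * (inner_on I (\<phi> k) h')\<^sup>2"
      by metis
    moreover have "(\<Sum>j\<in>G. \<psi>' j p * inner_on I (\<phi> k) (\<psi>' j))\<^sup>2 \<le> (\<Sum>j\<in>G. (\<psi>' j p)\<^sup>2) * (\<Sum>j\<in>G. (inner_on I (\<phi> k) (\<psi>' j))\<^sup>2)"
      by (rule Cauchy_Schwarz_ineq_sum)
    moreover have "\<dots> \<le> 1 * (\<Sum>j\<in>G. (inner_on I (\<phi> k) (\<psi>' j))\<^sup>2)"
      using G(2) by (intro mult_right_mono sum_nonneg) auto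
    ultimately show ?thesis by linarith
  qed
  have one: "(\<Sum>k\<in>J. (inner_on I (\<phi> k) (\<psi>' j))\<^sup>2) \<le> \<rho> / g\<^sup>2" if j: "j \<in> G" for j
  proof -
    let ?r = "\<lambda>i. mat_vec I a (\<psi>' j) i - e j * \<psi>' j i"
    have "g\<^sup>2 * (inner_on I (\<phi> k) (\<psi>' j))\<^sup>2 \<le> (inner_on I (\<phi> k) ?r)\<^sup>2" if k: "k \<in> J" for k
    proof -
      have "inner_on I (\<phi> k) (mat_vec I a (\<psi>' j)) = inner_on I (mat_vec I a (\<phi> k)) (\<psi>' j)"
        by (rule inner_on_mat_vec_commute[OF sym])
      also have "\<dots> = inner_on I (\<lambda>i. F k * \<phi> k i) (\<psi>' j)"
        using eb k J(1) by (intro inner_on_cong) (auto simp: eigenbasis_def ortho_eigen_def)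
      \<comment> \<open>Symmetry moves the matrix onto the true eigenvector, so the energy gap
        \<open>g\<close> divides the overlap with the residual.\<close>
      finally have "inner_on I (\<phi> k) ?r = (F k - e j) * inner_on I (\<phi> k) (\<psi>' j)"
        by (simp add: inner_on_linear algebra_simps)
      moreover have "g\<^sup>2 \<le> (F k - e j)\<^sup>2"
        using J(2)[OF k j] g by (simp add: abs_le_square_iff[symmetric])
      ultimately show ?thesis by (simp add: power_mult_distrib mult_right_mono)
    qed
    then have "(\<Sum>k\<in>J. g\<^sup>2 * (inner_on I (\<phi> k) (\<psi>' j))\<^sup>2) \<le> (\<Sum>k\<in>J. (inner_on I (\<phi> k) ?r)\<^sup>2)"
      by (rule sum_mono)
    also have "\<dots> \<le> (\<Sum>k<n. (inner_on I (\<phi> k) ?r)\<^sup>2)" using J(1) by (intro sum_mono2) auto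
    also have "\<dots> \<le> \<rho>" unfolding eigenbasis_parseval[OF I eb] by (rule res[OF j])
    finally show ?thesis using g by (simp add: sum_distrib_left[symmetric] field_simps)
  qed
  have "(\<Sum>k\<in>J. (\<phi> k p)\<^sup>2) \<le> (\<Sum>k\<in>J. 2 * (\<Sum>j\<in>G. (inner_on I (\<phi> k) (\<psi>' j))\<^sup>2) + 2 * (inner_on I (\<phi> k) h')\<^sup>2)"
    by (intro sum_mono split)
  also have "\<dots> = 2 * (\<Sum>j\<in>G. \<Sum>k\<in>J. (inner_on I (\<phi> k) (\<psi>' j))\<^sup>2) + 2 * (\<Sum>k\<in>J. (inner_on I (\<phi> k) h')\<^sup>2)"
    unfolding sum.distrib sum_distrib_left[symmetric] by (subst sum.swap) simp
  also have "\<dots> \<le> 2 * (\<Sum>j\<in>G. \<rho> / g\<^sup>2) + 2 * \<eta>"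
  proof (intro add_mono mult_left_mono sum_mono one)
    have "(\<Sum>k\<in>J. (inner_on I (\<phi> k) h')\<^sup>2) \<le> (\<Sum>k<n. (inner_on I (\<phi> k) h')\<^sup>2)"
      using J(1) by (intro sum_mono2) auto
    then show "(\<Sum>k\<in>J. (inner_on I (\<phi> k) h')\<^sup>2) \<le> \<eta>"
      unfolding eigenbasis_parseval[OF I eb] using h by (simp add: h'_def)
  qed auto
  finally show ?thesis by simp
qed

text \<open>Extended by zero, the eigenvector violates the equation only through W - v inside the
  box and at the two sites next to it, where its end values appear and W multiplies 0.\<close>

lemma box_residual:
  fixes \<phi> :: "int \<Rightarrow> real"
  assumes supp: "\<And>i. i \<notin> {-L..L} \<Longrightarrow> \<phi> i = 0"
    and eig: "\<And>i. i \<in> {-L..L} \<Longrightarrow> \<phi> (i + 1) + \<phi> (i - 1) + v i * \<phi> i = e * \<phi> i"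
    and norm: "(\<Sum>i\<in>{-L..L}. (\<phi> i)\<^sup>2) = 1"
    and near: "\<And>i. i \<in> {-L..L} \<Longrightarrow> \<bar>W i - v i\<bar> \<le> r" and L: "0 \<le> L" "L \<le> L'"
    and bdry: "(\<phi> L)\<^sup>2 \<le> A" "(\<phi> (-L))\<^sup>2 \<le> A"
  shows "inner_on {-L'..L'} (\<lambda>i. mat_vec {-L'..L'} (jacobi W) \<phi> i - e * \<phi> i) (\<lambda>i. mat_vec {-L'..L'} (jacobi W) \<phi> i - e * \<phi> i)
    \<le> r\<^sup>2 + 2 * A"
proof -
  let ?r = "\<lambda>i. \<phi> (i + 1) + \<phi> (i - 1) + W i * \<phi> i - e * \<phi> i"
  have r: "0 \<le> r" using near[of 0] L by (auto intro: order_trans[OF abs_ge_zero])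
  have A: "0 \<le> A" using bdry(1) zero_le_power2 order_trans by blast
  have "inner_on {-L'..L'} (\<lambda>i. mat_vec {-L'..L'} (jacobi W) \<phi> i - e * \<phi> i) (\<lambda>i. mat_vec {-L'..L'} (jacobi W) \<phi> i - e * \<phi> i)
     = (\<Sum>i\<in>{-L'..L'}. (?r i)\<^sup>2)"
    unfolding inner_on_def power2_eq_square
  proof (rule sum.cong[OF refl])
    fix i assume "i \<in> {-L'..L'}"
    then have "mat_vec {-L'..L'} (jacobi W) \<phi> i = \<phi> (i + 1) + \<phi> (i - 1) + W i * \<phi> i"
      using supp L by (intro mat_vec_jacobi) auto
    then show "(mat_vec {-L'..L'} (jacobi W) \<phi> i - e * \<phi> i) * (mat_vec {-L'..L'} (jacobi W) \<phi> i - e * \<phi> i) = ?r i * ?r i"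
      by simp
  qed
  \<comment> \<open>The union covers L' = L as well, when the adjacent sites lie outside the larger
    box.\<close>
  also have "\<dots> \<le> (\<Sum>i\<in>{-L'..L'} \<union> {-(L+1)..L+1}. (?r i)\<^sup>2)"
    by (intro sum_mono2) auto
  also have "\<dots> = (\<Sum>i\<in>{-(L+1)..L+1}. (?r i)\<^sup>2)"
    by (intro sum.mono_neutral_right) (auto simp: supp)
  also have "{-(L+1)..L+1} = insert (L + 1) (insert (-(L+1)) {-L..L})" using L by auto
  also have "(\<Sum>i\<in>insert (L + 1) (insert (-(L+1)) {-L..L}). (?r i)\<^sup>2)
      = (?r (L + 1))\<^sup>2 + ((?r (-(L+1)))\<^sup>2 + (\<Sum>i\<in>{-L..L}. (?r i)\<^sup>2))"
    using L by simp
  also have "?r (L + 1) = \<phi> L" using supp[of "L + 1"] supp[of "L + 1 + 1"] by simp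
  also have "?r (-(L+1)) = \<phi> (-L)" using supp[of "-(L+1)"] supp[of "-(L+1) - 1"] by simp
  also have "(\<Sum>i\<in>{-L..L}. (?r i)\<^sup>2) \<le> (\<Sum>i\<in>{-L..L}. r\<^sup>2 * (\<phi> i)\<^sup>2)"
  proof (rule sum_mono)
    fix i assume i: "i \<in> {-L..L}"
    have "?r i = (W i - v i) * \<phi> i" using eig[OF i] by (simp add: algebra_simps)
    moreover have "(W i - v i)\<^sup>2 \<le> r\<^sup>2" using near[OF i] r by (simp add: abs_le_square_iff[symmetric])
    ultimately show "(?r i)\<^sup>2 \<le> r\<^sup>2 * (\<phi> i)\<^sup>2" by (simp add: power_mult_distrib mult_right_mono)
  qed
  also have "\<dots> = r\<^sup>2" using norm by (simp add: sum_distrib_left[symmetric])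
  finally show ?thesis using bdry by simp
qed

lemma sum_Un_nonneg_le:
  fixes f :: "'a \<Rightarrow> real"
  assumes "finite A" "finite B" "\<And>x. 0 \<le> f x"
  shows "sum f (A \<union> B) \<le> sum f A + sum f B"
  using assms by (simp add: sum_Un sum_nonneg)

text \<open>On each half-line \<open>mass_bound\<close> charges the mass to the values at both of
  its ends, so an eigenvector may also live at the ends of the large box. Two end sites are
  therefore added to the centre, and the size of \<open>T\<close> stays bounded in
  \<open>P\<close>.\<close>

lemma two_sided_concentration:
  fixes \<phi> :: "int \<Rightarrow> real" and W :: "int \<Rightarrow> real" and L P N :: nat and b d E :: real
  assumes R: "near_expanding e E uR (\<lambda>n. W (int n)) (Suc L) N b d"
    and Lft: "near_expanding e' E uL (\<lambda>n. W (- int n)) (Suc L) N b d"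
    and supp: "\<And>i. int (L + P * N) < \<bar>i\<bar> \<Longrightarrow> \<phi> i = 0"
    and eig: "\<And>i. \<bar>i\<bar> \<le> int (L + P * N) \<Longrightarrow> \<phi> (i + 1) + \<phi> (i - 1) + W i * \<phi> i = E * \<phi> i"
    and norm: "(\<Sum>i\<in>{- int (L + P * N)..int (L + P * N)}. (\<phi> i)\<^sup>2) = 1"
  defines "T \<equiv> {- int (Suc L)..int (Suc L)} \<union> {int (L + P * N), - int (L + P * N)}"
  shows "1 \<le> (1 + 6 * (N * (b ^ N)\<^sup>2 * (4 * (1 + (b ^ N)\<^sup>2)))) * (\<Sum>i\<in>T. (\<phi> i)\<^sup>2)"
proof -
  define C where "C = N * (b ^ N)\<^sup>2 * (4 * (1 + (b ^ N)\<^sup>2))"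
  have C: "0 \<le> C" by (simp add: C_def)
  define \<sigma> where "\<sigma> = (\<Sum>i\<in>T. (\<phi> i)\<^sup>2)"
  have finT: "finite T" by (simp add: T_def)
  have mem: "(\<phi> i)\<^sup>2 \<le> \<sigma>" if "i \<in> T" for i
    unfolding \<sigma>_def by (rule member_le_sum[OF that]) (use finT in auto)
  have \<sigma>: "0 \<le> \<sigma>" by (simp add: \<sigma>_def sum_nonneg)
  have side: "(\<Sum>n<P * N. (f (Suc L + n))\<^sup>2) \<le> 3 * C * \<sigma>"
    if ne: "near_expanding e E u u' (Suc L) N b d" and f: "\<And>n. Suc L \<le> n \<Longrightarrow> n < Suc L + P * N \<Longrightarrow> f (Suc n) = (E - u' n) * f n - f (n - 1)"
      and z: "f (Suc L + P * N) = 0" and t: "(f L)\<^sup>2 \<le> \<sigma>" "(f (Suc L))\<^sup>2 \<le> \<sigma>" "(f (L + P * N))\<^sup>2 \<le> \<sigma>"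
    for f u u' e
  proof -
    interpret near_expanding e E u u' "Suc L" N b d by (rule ne)
    have "(\<Sum>n<P * N. (f (Suc L + n))\<^sup>2) \<le> C * ((f (Suc L))\<^sup>2 + (f (Suc L - 1))\<^sup>2 + (f (Suc L + P * N))\<^sup>2 + (f (Suc L + P * N - 1))\<^sup>2)"
      using mass_bound[of P f] f unfolding C_def by simp
    \<comment> \<open>The site just beyond the box contributes 0 by the boundary condition; the
      other three belong to \<open>T\<close>.\<close>
    also have "\<dots> \<le> C * (\<sigma> + \<sigma> + 0 + \<sigma>)"
      using t z C by (intro mult_left_mono add_mono) auto
    finally show ?thesis by simp
  qed
  have right: "(\<Sum>n<P * N. (\<phi> (int (Suc L + n)))\<^sup>2) \<le> 3 * C * \<sigma>"
  proof (rule side[OF R])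
    fix n assume n: "Suc L \<le> n" "n < Suc L + P * N"
    have e: "int n + 1 = int (Suc n)" "int n - 1 = int (n - 1)" using n by auto
    have "\<bar>int n\<bar> \<le> int (L + P * N)" using n by linarith
    from eig[OF this, unfolded e] show "\<phi> (int (Suc n)) = (E - W (int n)) * \<phi> (int n) - \<phi> (int (n - 1))"
      by (simp only: left_diff_distrib)
  qed (auto intro!: mem supp simp: T_def)
  have left: "(\<Sum>n<P * N. (\<phi> (- int (Suc L + n)))\<^sup>2) \<le> 3 * C * \<sigma>"
  proof (rule side[OF Lft])
    fix n assume n: "Suc L \<le> n" "n < Suc L + P * N"
    have e: "- int n + 1 = - int (n - 1)" "- int n - 1 = - int (Suc n)" using n by auto
    have "\<bar>- int n\<bar> \<le> int (L + P * N)" using n by linarith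
    from eig[OF this, unfolded e] show "\<phi> (- int (Suc n)) = (E - W (- int n)) * \<phi> (- int n) - \<phi> (- int (n - 1))"
      by (simp only: left_diff_distrib)
  qed (auto intro!: mem supp simp: T_def)
  have "1 = (\<Sum>i\<in>{- int (L + P * N)..int (L + P * N)}. (\<phi> i)\<^sup>2)" using norm by simp
  also have "\<dots> \<le> (\<Sum>i\<in>T \<union> (\<lambda>n. int (Suc L + n)) ` {..<P * N} \<union> (\<lambda>n. - int (Suc L + n)) ` {..<P * N}. (\<phi> i)\<^sup>2)"
  proof (rule sum_mono2)
    show "{- int (L + P * N)..int (L + P * N)} \<subseteq> T \<union> (\<lambda>n. int (Suc L + n)) ` {..<P * N} \<union> (\<lambda>n. - int (Suc L + n)) ` {..<P * N}"
    proof
      fix i assume i: "i \<in> {- int (L + P * N)..int (L + P * N)}"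
      obtain m where m: "P * N = m" by blast
      consider "\<bar>i\<bar> \<le> int (Suc L)" | "int (Suc L) < i" | "i < - int (Suc L)" by linarith
      then show "i \<in> T \<union> (\<lambda>n. int (Suc L + n)) ` {..<P * N} \<union> (\<lambda>n. - int (Suc L + n)) ` {..<P * N}"
      proof cases
        case 1
        then show ?thesis by (auto simp: T_def)
      next
        case 2
        then have "i = int (Suc L + (nat i - Suc L))" "nat i - Suc L < P * N" using i unfolding m by auto
        then show ?thesis by blast
      next
        case 3
        then have "i = - int (Suc L + (nat (-i) - Suc L))" "nat (-i) - Suc L < P * N" using i unfolding m by auto
        then show ?thesis by blast
      qed
    qed
  qed (use finT in auto)
  also have "\<dots> \<le> (\<Sum>i\<in>T \<union> (\<lambda>n. int (Suc L + n)) ` {..<P * N}. (\<phi> i)\<^sup>2) + (\<Sum>i\<in>(\<lambda>n. - int (Suc L + n)) ` {..<P * N}. (\<phi> i)\<^sup>2)"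
    using finT by (intro sum_Un_nonneg_le) auto
  also have "\<dots> \<le> (\<sigma> + (\<Sum>i\<in>(\<lambda>n. int (Suc L + n)) ` {..<P * N}. (\<phi> i)\<^sup>2)) + (\<Sum>i\<in>(\<lambda>n. - int (Suc L + n)) ` {..<P * N}. (\<phi> i)\<^sup>2)"
    unfolding \<sigma>_def using finT by (intro add_right_mono sum_Un_nonneg_le) auto
  also have "(\<Sum>i\<in>(\<lambda>n. int (Suc L + n)) ` {..<P * N}. (\<phi> i)\<^sup>2) = (\<Sum>n<P * N. (\<phi> (int (Suc L + n)))\<^sup>2)"
    by (subst sum.reindex) (auto simp: inj_on_def)
  also have "(\<Sum>i\<in>(\<lambda>n. - int (Suc L + n)) ` {..<P * N}. (\<phi> i)\<^sup>2) = (\<Sum>n<P * N. (\<phi> (- int (Suc L + n)))\<^sup>2)"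
    by (subst sum.reindex) (auto simp: inj_on_def)
  finally have "1 \<le> \<sigma> + (\<Sum>n<P * N. (\<phi> (int (Suc L + n)))\<^sup>2) + (\<Sum>n<P * N. (\<phi> (- int (Suc L + n)))\<^sup>2)" .
  then have "1 \<le> \<sigma> + 3 * C * \<sigma> + 3 * C * \<sigma>" using left right by linarith
  then show ?thesis by (simp add: \<sigma>_def C_def algebra_simps)
qed

section \<open>Robust localized eigenvectors\<close>

text \<open>The order of the constants is decisive: the number of energies, the block length
  \<open>N\<close> for that many energies, the trapping width \<open>g\<close>, the tolerance
  \<open>r\<close>, and only then the box, so large that its boundary values are negligible against
  \<open>g\<close>. This is not circular because the number of energies does not depend on the
  box.\<close>

theorem robust_eigenvectors:
  fixes V :: "int \<Rightarrow> real" and M \<epsilon> \<eta> :: real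
  assumes V: "\<And>i. \<bar>V i\<bar> \<le> M" and \<epsilon>: "0 < \<epsilon>" "\<epsilon> \<le> 1" and \<eta>: "0 < \<eta>"
  shows "\<exists>V0 r. 0 < r \<and> (\<forall>i. V i \<le> V0 i \<and> V0 i \<le> V i + \<epsilon>) \<and>
    (\<forall>W. (\<forall>i. \<bar>W i - V0 i\<bar> \<le> r) \<longrightarrow>
      (\<exists>(K::nat) E \<phi>. (\<forall>j<K. (\<forall>i. \<phi> j (i + 1) + \<phi> j (i - 1) + W i * \<phi> j i = E j * \<phi> j i) \<and>
          (\<exists>C c. 0 < C \<and> 0 < c \<and> (\<forall>i. \<bar>\<phi> j i\<bar> \<le> C * exp (- c * \<bar>real_of_int i\<bar>)))) \<and>
        (\<forall>j<K. \<forall>S. finite S \<longrightarrow> (\<Sum>i\<in>S. (\<phi> j i)\<^sup>2) \<le> 1) \<and>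
        (\<forall>S. finite S \<longrightarrow> (\<Sum>i\<in>S. ((if i = 0 then 1 else 0) - (\<Sum>j<K. \<phi> j 0 * \<phi> j i))\<^sup>2) \<le> 6 * \<eta>)))"
proof -
  have M: "0 \<le> M" using V[of 0] by simp
  obtain N0 k0 A where box: "\<And>p. \<exists>v n F \<phi> G. (\<forall>i. V i \<le> v i \<and> v i \<le> V i + \<epsilon>) \<and> (\<forall>i. int (p * N0) < \<bar>i\<bar> \<longrightarrow> v i = V i) \<and>
     eigenbasis {- int (p * N0)..int (p * N0)} (jacobi v) n F \<phi> \<and> G \<subseteq> {..<n} \<and> real (card G) \<le> k0 \<and>
     (\<Sum>k\<in>{..<n} - G. (\<phi> k 0)\<^sup>2) \<le> \<eta> \<and>
     (\<forall>k\<in>G. (\<phi> k (int (p * N0)))\<^sup>2 \<le> (A * (1/4) ^ p)\<^sup>2 \<and> (\<phi> k (- int (p * N0)))\<^sup>2 \<le> (A * (1/4) ^ p)\<^sup>2)"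
    using box_localization[where V = V and M = M, OF V \<epsilon> \<eta>] by blast
  define k1 where "k1 = nat \<lceil>\<bar>k0\<bar>\<rceil>"
  have k1: "k0 \<le> real k1" unfolding k1_def by linarith
  define R where "R = M + 3"
  have RM: "0 \<le> R + M + 1" using M by (simp add: R_def)
  obtain N where N: "2 \<le> N" and block: "\<And>X vs y. finite X \<Longrightarrow> card X \<le> k1 \<Longrightarrow> length vs = N \<Longrightarrow>
      (\<And>E v. E \<in> X \<Longrightarrow> v \<in> set vs \<Longrightarrow> \<bar>E - v\<bar> \<le> R + M + 1) \<Longrightarrow> (\<And>E. E \<in> X \<Longrightarrow> y E \<noteq> 0) \<Longrightarrow>
      \<exists>ws. lifted \<epsilon> vs ws \<and> (\<forall>E\<in>X. 4 * norm (y E) \<le> norm (transfer E ws (y E)))"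
  proof (rule outward_block[OF \<epsilon> RM, of k1], goal_cases)
    case (1 N)
    show ?case by (rule 1(1)[OF 1(2,3)])
  qed
  \<comment> \<open>The largest |E - W i| + 2: trapped energies reach R + 1 = M + 4, potentials M +
    2.\<close>
  define b where "b = 2 * M + 8"
  define B where "B = b ^ N"
  have b: "1 \<le> b" using M by (simp add: b_def)
  have B: "1 \<le> B" using b by (simp add: B_def)
  \<comment> \<open>Allows a drift of 2 g, one \<open>g\<close> for the energy and another for the
    potential, in blocks with matrices bounded by \<open>B\<close>.\<close>
  define g where "g = min 1 (1 / (16 * N * B\<^sup>2))"
  have NB: "0 < 16 * real N * B\<^sup>2" using N B by simp
  have g: "0 < g" "g \<le> 1" using NB by (auto simp: g_def)
  have gB: "8 * (b ^ N * ((2 * g) * N * b ^ N)) \<le> 1"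
  proof -
    have "g * (16 * N * B\<^sup>2) \<le> 1 / (16 * N * B\<^sup>2) * (16 * N * B\<^sup>2)"
      using NB by (intro mult_right_mono) (auto simp: g_def)
    also have "\<dots> = 1" using N B by simp
    finally have "8 * (B * ((2 * g) * N * B)) \<le> 1" by (simp add: power2_eq_square mult_ac)
    then show ?thesis unfolding B_def .
  qed
  \<comment> \<open>Summed over at most \<open>k1\<close> vectors, the residual from the potential
    then costs at most \<eta> / 2; the boundary values get the other half through the choice of
    \<open>p\<close>.\<close>
  define r where "r = g * min 1 (\<eta> / (2 * (real k1 + 1)))"
  have r: "0 < r" "r \<le> g" "real k1 * (r\<^sup>2 / g\<^sup>2) \<le> \<eta> / 2"
  proof -
    define m where "m = min 1 (\<eta> / (2 * (real k1 + 1)))"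
    have m: "0 < m" "m \<le> 1" "m \<le> \<eta> / (2 * (real k1 + 1))" using \<eta> by (auto simp: m_def)
    have rm: "r = g * m" unfolding r_def m_def ..
    show "0 < r" using g m by (simp add: rm)
    show "r \<le> g" using g m by (simp add: rm mult_left_le)
    have "r\<^sup>2 / g\<^sup>2 = m\<^sup>2" using g by (simp add: rm power_mult_distrib)
    also have "\<dots> \<le> m" using m by (simp add: power2_eq_square mult_left_le)
    also have "\<dots> \<le> \<eta> / (2 * (real k1 + 1))" by (rule m)
    finally have "real k1 * (r\<^sup>2 / g\<^sup>2) \<le> real k1 * (\<eta> / (2 * (real k1 + 1)))" by (intro mult_left_mono) auto
    also have "\<dots> \<le> \<eta> / 2" using \<eta> by (simp add: field_simps)
    finally show "real k1 * (r\<^sup>2 / g\<^sup>2) \<le> \<eta> / 2" .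
  qed
  have "(\<lambda>p. real k1 * ((2 * (A * (1/4) ^ p)\<^sup>2) / g\<^sup>2)) \<longlonglongrightarrow> real k1 * ((2 * (A * 0)\<^sup>2) / g\<^sup>2)"
    using g by (intro tendsto_intros LIMSEQ_power_zero) auto
  then have "\<forall>\<^sub>F p in sequentially. real k1 * ((2 * (A * (1/4) ^ p)\<^sup>2) / g\<^sup>2) < \<eta> / 2"
    using \<eta> by (intro order_tendstoD(2)) auto
  then obtain p where p: "real k1 * ((2 * (A * (1/4) ^ p)\<^sup>2) / g\<^sup>2) < \<eta> / 2" by (auto simp: eventually_sequentially)
  define a where "a = (A * (1/4) ^ p)\<^sup>2"
  define L where "L = p * N0"
  obtain v n F \<phi> G where v: "\<And>i. V i \<le> v i \<and> v i \<le> V i + \<epsilon>" "\<And>i. int L < \<bar>i\<bar> \<Longrightarrow> v i = V i"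
     and eb: "eigenbasis {- int L..int L} (jacobi v) n F \<phi>" and G: "G \<subseteq> {..<n}" "real (card G) \<le> k0"
     and weight: "(\<Sum>k\<in>{..<n} - G. (\<phi> k 0)\<^sup>2) \<le> \<eta>"
     and bdry: "\<And>k. k \<in> G \<Longrightarrow> (\<phi> k (int L))\<^sup>2 \<le> a" "\<And>k. k \<in> G \<Longrightarrow> (\<phi> k (- int L))\<^sup>2 \<le> a"
    using box[of p] unfolding L_def[symmetric] a_def[symmetric] by blast
  have finG: "finite G" using G finite_subset by blast
  have vM: "\<bar>v i\<bar> \<le> M + 1" for i using v(1)[of i] V[of i] \<epsilon> by linarith
  define X where "X = F ` G"
  have X: "finite X" "card X \<le> k1"
  proof -
    show "finite X" using finG by (simp add: X_def)
    have "card X \<le> card G" using finG by (simp add: X_def card_image_le)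
    then show "card X \<le> k1" using G(2) k1 by linarith
  qed
  have XR: "\<bar>e\<bar> \<le> R" if "e \<in> X" for e
  proof -
    obtain k where "k \<in> G" "e = F k" using \<open>e \<in> X\<close> unfolding X_def by blast
    moreover from this have "k < n" using G(1) by blast
    ultimately show ?thesis
      using box_eigenvalue_bound[OF eb[unfolded eigenbasis_def, THEN conjunct1], of k "M + 1"] vM by (simp add: R_def)
  qed
  have blockX: "\<exists>ws. lifted \<epsilon> vs ws \<and> (\<forall>E\<in>X. 4 * norm (y E) \<le> norm (transfer E ws (y E)))"
    if len: "length vs = N" and sub: "set vs \<subseteq> range (\<lambda>n. v (s n))" and nz: "\<And>E. E \<in> X \<Longrightarrow> y E \<noteq> 0"
    for vs y and s :: "nat \<Rightarrow> int"
  proof (rule block[OF X len _ nz])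
    fix E x assume E: "E \<in> X" and "x \<in> set vs"
    then obtain i where "x = v i" using sub by blast
    then show "\<bar>E - x\<bar> \<le> R + M + 1" using XR[OF E] vM[of i] by linarith
  qed
  have \<epsilon>0: "0 \<le> \<epsilon>" using \<epsilon> by simp
  have ext: "\<exists>u'. (\<forall>n. v (s n) \<le> u' n \<and> u' n \<le> v (s n) + \<epsilon>) \<and> (\<forall>n<Suc L. u' n = v (s n)) \<and>
      (\<forall>E\<in>X. expanding E u' (Suc L) N)" for s :: "nat \<Rightarrow> int"
  proof (rule expanding_extension[where N = N and X = X and c = \<epsilon> and u = "\<lambda>n. v (s n)" and s = "Suc L"])
    show "\<exists>ws. lifted \<epsilon> vs ws \<and> (\<forall>E\<in>X. 4 * norm (y E) \<le> norm (transfer E ws (y E)))"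
      if "length vs = N" "set vs \<subseteq> range (\<lambda>n. v (s n))" "\<And>E. E \<in> X \<Longrightarrow> y E \<noteq> 0" for vs y
      by (rule blockX[OF that])
  qed (use N \<epsilon>0 in blast)+
  obtain uR where uR: "\<And>n. v (int n) \<le> uR n \<and> uR n \<le> v (int n) + \<epsilon>" "\<And>n. n < Suc L \<Longrightarrow> uR n = v (int n)"
    "\<And>E. E \<in> X \<Longrightarrow> expanding E uR (Suc L) N"
    using ext[of int] by blast
  obtain uL where uL: "\<And>n. v (- int n) \<le> uL n \<and> uL n \<le> v (- int n) + \<epsilon>" "\<And>n. n < Suc L \<Longrightarrow> uL n = v (- int n)"
    "\<And>E. E \<in> X \<Longrightarrow> expanding E uL (Suc L) N"
    using ext[of "\<lambda>n. - int n"] by blast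
  \<comment> \<open>Both continuations leave the potential unchanged up to distance
    \<open>L\<close>, so they agree at 0 and the box keeps its eigenvectors.\<close>
  define V0 where "V0 i = (if 0 \<le> i then uR (nat i) else uL (nat (- i)))" for i
  have V0R: "V0 (int n) = uR n" for n by (simp add: V0_def)
  have V0L: "V0 (- int n) = uL n" for n using uR(2)[of 0] uL(2)[of 0] by (cases "n = 0") (auto simp: V0_def)
  have V0in: "V0 i = v i" if "\<bar>i\<bar> \<le> int L" for i
  proof (cases "0 \<le> i")
    case True
    then show ?thesis using uR(2)[of "nat i"] that by (simp add: V0_def)
  next
    case False
    then show ?thesis using uL(2)[of "nat (- i)"] that by (simp add: V0_def)
  qed
  have V0near: "V i \<le> V0 i \<and> V0 i \<le> V i + \<epsilon>" for i
  proof (cases "\<bar>i\<bar> \<le> int L")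
    case True
    then show ?thesis using V0in v(1) by simp
  next
    case False
    then have vi: "v i = V i" using v(2)[of i] by simp
    show ?thesis
    proof (cases "0 \<le> i")
      case True
      then show ?thesis using uR(1)[of "nat i"] vi by (simp add: V0_def)
    next
      case False
      then show ?thesis using uL(1)[of "nat (- i)"] vi by (simp add: V0_def)
    qed
  qed
  have "\<exists>(K::nat) E \<phi>. (\<forall>j<K. (\<forall>i. \<phi> j (i + 1) + \<phi> j (i - 1) + W i * \<phi> j i = E j * \<phi> j i) \<and>
          (\<exists>C c. 0 < C \<and> 0 < c \<and> (\<forall>i. \<bar>\<phi> j i\<bar> \<le> C * exp (- c * \<bar>real_of_int i\<bar>)))) \<and>
        (\<forall>j<K. \<forall>S. finite S \<longrightarrow> (\<Sum>i\<in>S. (\<phi> j i)\<^sup>2) \<le> 1) \<and>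
        (\<forall>S. finite S \<longrightarrow> (\<Sum>i\<in>S. ((if i = 0 then 1 else 0) - (\<Sum>j<K. \<phi> j 0 * \<phi> j i))\<^sup>2) \<le> 6 * \<eta>)"
    if W: "\<And>i. \<bar>W i - V0 i\<bar> \<le> r" for W :: "int \<Rightarrow> real"
  proof -
    have WM: "\<bar>W i\<bar> \<le> M + 2" for i using W[of i] V0near[of i] V[of i] r g \<epsilon> by linarith
    have neR: "near_expanding e E uR (\<lambda>n. W (int n)) (Suc L) N b (2 * g)"
      and neL: "near_expanding e E uL (\<lambda>n. W (- int n)) (Suc L) N b (2 * g)"
      if e: "e \<in> X" "\<bar>E - e\<bar> \<le> g" for e E
    proof -
      have u: "\<bar>uR n\<bar> \<le> M + 1" "\<bar>uL n\<bar> \<le> M + 1" for n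
        using V0near[of "int n"] V[of "int n"] V0near[of "- int n"] V[of "- int n"] \<epsilon> unfolding V0R V0L by linarith+
      show "near_expanding e E uR (\<lambda>n. W (int n)) (Suc L) N b (2 * g)"
      proof
        fix n :: nat
        show "\<bar>e - uR n - (E - W (int n))\<bar> \<le> 2 * g" using W[of "int n"] e(2) r(2) unfolding V0R by linarith
        show "\<bar>e - uR n\<bar> + 2 \<le> b" using XR[OF e(1)] u(1)[of n] unfolding b_def R_def by linarith
        show "\<bar>E - W (int n)\<bar> + 2 \<le> b" using XR[OF e(1)] e(2) WM[of "int n"] g(2) unfolding b_def R_def by linarith
      qed (use uR(3)[OF e(1)] N b gB g in auto)
      show "near_expanding e E uL (\<lambda>n. W (- int n)) (Suc L) N b (2 * g)"
      proof
        fix n :: nat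
        show "\<bar>e - uL n - (E - W (- int n))\<bar> \<le> 2 * g" using W[of "- int n"] e(2) r(2) unfolding V0L by linarith
        show "\<bar>e - uL n\<bar> + 2 \<le> b" using XR[OF e(1)] u(2)[of n] unfolding b_def R_def by linarith
        show "\<bar>E - W (- int n)\<bar> + 2 \<le> b" using XR[OF e(1)] e(2) WM[of "- int n"] g(2) unfolding b_def R_def by linarith
      qed (use uL(3)[OF e(1)] N b gB g in auto)
    qed
    define C2 where "C2 = 1 + 6 * (N * (b ^ N)\<^sup>2 * (4 * (1 + (b ^ N)\<^sup>2)))"
    have C2: "0 \<le> C2" by (simp add: C2_def)
    \<comment> \<open>2 L + 5 bounds the size of \<open>T\<close>: 2 L + 3 central sites and two
      ends.\<close>
    define K where "K = nat \<lceil>C2 * (2 * L + 5)\<rceil>"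
    \<comment> \<open>Closed, so that energies remain trapped in the limit of large boxes.\<close>
    define Cs where "Cs = (\<Union>e\<in>X. {e - g..e + g})"
    have Cs: "closed Cs" unfolding Cs_def using X(1) by (intro closed_UN) auto
    have Cs_iff: "x \<in> Cs \<longleftrightarrow> (\<exists>e\<in>X. \<bar>x - e\<bar> \<le> g)" for x
    proof -
      have "x \<in> {e - g..e + g} \<longleftrightarrow> \<bar>x - e\<bar> \<le> g" for e by auto
      then show ?thesis unfolding Cs_def by blast
    qed
    have data: "\<exists>e \<psi>. (\<forall>j. \<bar>e j\<bar> \<le> M + 4) \<and> (\<forall>j<K. e j \<in> Cs \<or> (\<forall>i. \<psi> j i = 0)) \<and>
       (\<forall>j S. finite S \<longrightarrow> (\<Sum>i\<in>S. (\<psi> j i)\<^sup>2) \<le> 1) \<and>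
       (\<forall>j<K. \<forall>i. \<bar>i\<bar> \<le> int P \<longrightarrow> \<psi> j (i + 1) + \<psi> j (i - 1) + W i * \<psi> j i = e j * \<psi> j i) \<and>
       (\<forall>S. finite S \<longrightarrow> (\<Sum>i\<in>S. ((if i = 0 then 1 else 0) - (\<Sum>j<K. \<psi> j 0 * \<psi> j i))\<^sup>2) \<le> 6 * \<eta>)" for P
    proof -
      define L' where "L' = L + P * N"
      let ?I = "{- int L'..int L'}"
      have LL: "L \<le> L'" "P \<le> L'" using N by (auto simp: L'_def intro: trans_le_add2)
      obtain n' F' \<psi>' where eb': "eigenbasis ?I (jacobi W) n' F' \<psi>'"
        by (rule eigenbasis_exists[where I = ?I and a = "jacobi W"]) (auto intro: jacobi_sym)
      note oe' = eb'[unfolded eigenbasis_def, THEN conjunct1]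
      note ev' = box_eigenvector[OF oe']
      define J where "J = {k. k < n' \<and> F' k \<in> Cs}"
      have J: "J \<subseteq> {..<n'}" "finite J" by (auto simp: J_def)
      \<comment> \<open>The eigenvectors of the small box, extended by zero, act as approximate
        eigenvectors for \<open>W\<close> on the large box; they nearly span the unit vector at 0,
        whatever the size of the large box.\<close>
      have off: "(\<Sum>k\<in>{..<n'} - J. (\<psi>' k 0)\<^sup>2) \<le> 6 * \<eta>"
      proof -
        have "(\<Sum>k\<in>{..<n'} - J. (\<psi>' k 0)\<^sup>2) \<le> 2 * (card G * ((r\<^sup>2 + 2 * a) / g\<^sup>2)) + 2 * \<eta>"
        proof (rule off_spectrum_mass[where \<psi>' = \<phi> and e = F and p = 0, OF _ _ eb' jacobi_sym finG])
          show "(\<Sum>j\<in>G. (\<phi> j 0)\<^sup>2) \<le> 1"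
            by (rule eigenbasis_column_le[OF _ eb G(1)]) simp
          let ?h = "\<lambda>i. (if i = 0 then 1 else 0) - (\<Sum>j\<in>G. \<phi> j 0 * \<phi> j i)"
          have "\<phi> j i = 0" if "j \<in> G" "i \<notin> {- int L..int L}" for i j
            using eb that G(1) by (auto simp: eigenbasis_def ortho_eigen_def)
          then have "inner_on ?I ?h ?h = inner_on {- int L..int L} ?h ?h"
            unfolding inner_on_def using LL by (intro sum.mono_neutral_right) auto
          also have "\<dots> = (\<Sum>k\<in>{..<n} - G. (\<phi> k 0)\<^sup>2)"
            by (rule eigenbasis_partial_residual[OF _ _ eb G(1)]) auto
          finally show "inner_on ?I ?h ?h \<le> \<eta>" using weight by simp
        next
          fix j assume j: "j \<in> G"
          then have "j < n" using G by auto
          note ev = box_eigenvector[OF eb[unfolded eigenbasis_def, THEN conjunct1] this]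
          show "inner_on ?I (\<lambda>i. mat_vec ?I (jacobi W) (\<phi> j) i - F j * \<phi> j i) (\<lambda>i. mat_vec ?I (jacobi W) (\<phi> j) i - F j * \<phi> j i) \<le> r\<^sup>2 + 2 * a"
          proof (rule box_residual[OF ev])
            show "\<bar>W i - v i\<bar> \<le> r" if "i \<in> {- int L..int L}" for i using W[of i] V0in[of i] that by auto
          qed (use LL bdry j in auto)
        next
          fix k j assume "k \<in> {..<n'} - J" "j \<in> G"
          then have "F' k \<notin> Cs" "F j \<in> X" by (auto simp: J_def X_def)
          then show "g \<le> \<bar>F' k - F j\<bar>" unfolding Cs_iff by force
        qed (use g in auto)
        also have "real (card G) * ((r\<^sup>2 + 2 * a) / g\<^sup>2) \<le> real k1 * ((r\<^sup>2 + 2 * a) / g\<^sup>2)"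
          using G(2) k1 by (intro mult_right_mono) (auto simp: a_def)
        also have "\<dots> = real k1 * (r\<^sup>2 / g\<^sup>2) + real k1 * ((2 * a) / g\<^sup>2)"
          by (simp add: add_divide_distrib distrib_left)
        also have "\<dots> \<le> \<eta>" using r(3) p unfolding a_def by linarith
        finally show ?thesis using \<eta> by simp
      qed
      have cardJ: "card J \<le> K"
      proof -
        define T where "T = {- int (Suc L)..int (Suc L)} \<union> {int (L + P * N), - int (L + P * N)}"
        have "1 \<le> C2 * (\<Sum>i\<in>T. (\<psi>' k i)\<^sup>2)" if k: "k \<in> J" for k
        proof -
          obtain e where e: "e \<in> X" "\<bar>F' k - e\<bar> \<le> g" using k unfolding J_def Cs_iff by blast
          have kn: "k < n'" using k by (simp add: J_def)
          show ?thesis unfolding C2_def T_def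
          proof (rule two_sided_concentration[OF neR[OF e] neL[OF e]])
            show "\<psi>' k i = 0" if "int (L + P * N) < \<bar>i\<bar>" for i
            proof (rule ev'(1)[OF kn])
              show "i \<notin> ?I" using that unfolding L'_def atLeastAtMost_iff by linarith
            qed
            show "\<psi>' k (i + 1) + \<psi>' k (i - 1) + W i * \<psi>' k i = F' k * \<psi>' k i" if "\<bar>i\<bar> \<le> int (L + P * N)" for i
            proof (rule ev'(2)[OF kn])
              show "i \<in> ?I" using that unfolding L'_def atLeastAtMost_iff by linarith
            qed
            show "(\<Sum>i\<in>{- int (L + P * N)..int (L + P * N)}. (\<psi>' k i)\<^sup>2) = 1" using ev'(3)[OF kn] by (simp only: L'_def)
          qed
        qed
        then have "real (card J) \<le> C2 * card T"
          using C2 by (intro card_le_of_concentration[OF _ eb' J(1)]) (auto simp: T_def)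
        also have "card T \<le> 2 * L + 5"
        proof -
          have "card T \<le> card {- int (Suc L)..int (Suc L)} + card {int (L + P * N), - int (L + P * N)}"
            unfolding T_def by (rule card_Un_le)
          also have "card {int (L + P * N), - int (L + P * N)} \<le> 2" by (simp add: card_insert_if)
          finally show ?thesis by simp
        qed
        then have "C2 * card T \<le> C2 * (2 * L + 5)" using C2 by (intro mult_left_mono) auto
        finally show ?thesis unfolding K_def by linarith
      qed
      obtain f where f: "bij_betw f {..<card J} J"
        using ex_bij_betw_nat_finite[OF J(2)] by (auto simp: lessThan_atLeast0)
      have fJ: "f j \<in> J" "f j < n'" if "j < card J" for j
        using f that J(1) by (auto simp: bij_betw_def)
      define e where "e j = (if j < card J then F' (f j) else 0)" for j
      define \<psi> where "\<psi> j i = (if j < card J then \<psi>' (f j) i else 0)" for j i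
      have sumJ: "(\<Sum>j<K. \<psi> j 0 * \<psi> j i) = (\<Sum>k\<in>J. \<psi>' k 0 * \<psi>' k i)" for i
      proof -
        have "(\<Sum>j<K. \<psi> j 0 * \<psi> j i) = (\<Sum>j<card J. \<psi>' (f j) 0 * \<psi>' (f j) i)"
          using cardJ by (intro sum.mono_neutral_cong_right) (auto simp: \<psi>_def)
        also have "\<dots> = (\<Sum>k\<in>J. \<psi>' k 0 * \<psi>' k i)" by (rule sum.reindex_bij_betw[OF f])
        finally show ?thesis .
      qed
      show ?thesis
      proof (intro exI conjI allI impI)
        show "\<bar>e j\<bar> \<le> M + 4" for j
          using box_eigenvalue_bound[OF oe' fJ(2), of j "M + 2"] WM M by (auto simp: e_def)
        show "e j \<in> Cs \<or> (\<forall>i. \<psi> j i = 0)" for j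
          using fJ(1)[of j] by (auto simp: e_def \<psi>_def J_def)
        show "(\<Sum>i\<in>S. (\<psi> j i)\<^sup>2) \<le> 1" if "finite S" for j S
        proof (cases "j < card J")
          case True
          have "(\<Sum>i\<in>S. (\<psi> j i)\<^sup>2) \<le> (\<Sum>i\<in>S \<union> ?I. (\<psi> j i)\<^sup>2)" using that by (intro sum_mono2) auto
          also have "\<dots> = (\<Sum>i\<in>?I. (\<psi> j i)\<^sup>2)"
            using that ev'(1)[OF fJ(2)[OF True]] by (intro sum.mono_neutral_right) (auto simp: \<psi>_def)
          also have "\<dots> = 1" using True ev'(3)[OF fJ(2)[OF True]] by (simp add: \<psi>_def)
          finally show ?thesis by simp
        qed (simp add: \<psi>_def)
        show "\<psi> j (i + 1) + \<psi> j (i - 1) + W i * \<psi> j i = e j * \<psi> j i" if "\<bar>i\<bar> \<le> int P" for j i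
        proof (cases "j < card J")
          case True
          have "i \<in> ?I" using that LL(2) unfolding atLeastAtMost_iff by linarith
          then show ?thesis using ev'(2)[OF fJ(2)[OF True], of i] True by (simp add: \<psi>_def e_def)
        qed (simp add: \<psi>_def e_def)
        show "(\<Sum>i\<in>S. ((if i = 0 then 1 else 0) - (\<Sum>j<K. \<psi> j 0 * \<psi> j i))\<^sup>2) \<le> 6 * \<eta>" if "finite S" for S
        proof -
          let ?h = "\<lambda>i. (if i = 0 then 1 else 0) - (\<Sum>k\<in>J. \<psi>' k 0 * \<psi>' k i)"
          have "(\<Sum>i\<in>S. (?h i)\<^sup>2) \<le> (\<Sum>i\<in>S \<union> ?I. (?h i)\<^sup>2)" using that by (intro sum_mono2) auto
          also have "\<dots> = (\<Sum>i\<in>?I. (?h i)\<^sup>2)"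
            using that ev'(1) J(1) by (intro sum.mono_neutral_right) (auto simp: subset_iff)
          also have "\<dots> = inner_on ?I ?h ?h" by (simp add: inner_on_def power2_eq_square)
          also have "\<dots> = (\<Sum>k\<in>{..<n'} - J. (\<psi>' k 0)\<^sup>2)"
            by (rule eigenbasis_partial_residual[OF _ _ eb' J(1)]) auto
          also note off
          finally show ?thesis unfolding sumJ .
        qed
      qed
    qed
    define D where "D P e \<psi> \<longleftrightarrow> (\<forall>j. \<bar>e j\<bar> \<le> M + 4) \<and> (\<forall>j<K. e j \<in> Cs \<or> (\<forall>i. \<psi> j i = 0)) \<and>
       (\<forall>j S. finite S \<longrightarrow> (\<Sum>i\<in>S. (\<psi> j i)\<^sup>2) \<le> 1) \<and>
       (\<forall>j<K. \<forall>i. \<bar>i\<bar> \<le> int P \<longrightarrow> \<psi> j (i + 1) + \<psi> j (i - 1) + W i * \<psi> j i = e j * \<psi> j i) \<and>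
       (\<forall>S. finite S \<longrightarrow> (\<Sum>i\<in>S. ((if i = 0 then 1 else 0) - (\<Sum>j<K. \<psi> j 0 * \<psi> j i))\<^sup>2) \<le> 6 * \<eta>)"
      for P :: nat and e :: "nat \<Rightarrow> real" and \<psi> :: "nat \<Rightarrow> int \<Rightarrow> real"
    have "\<forall>P. \<exists>e \<psi>. D P e \<psi>" unfolding D_def by (intro allI data)
    then obtain e where "\<forall>P. \<exists>\<psi>. D P (e P) \<psi>" by (rule choice[THEN exE])
    then obtain \<psi> where "\<forall>P. D P (e P) (\<psi> P)" by (rule choice[THEN exE])
    then have D: "D P (e P) (\<psi> P)" for P ..
    have e\<psi>1: "\<bar>e P j\<bar> \<le> M + 4" for P j
      using D[of P] unfolding D_def by simp
    have e\<psi>2: "e P j \<in> Cs \<or> (\<forall>i. \<psi> P j i = 0)" if "j < K" for P j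
      using D[of P] that unfolding D_def by simp
    have e\<psi>3: "(\<Sum>i\<in>S. (\<psi> P j i)\<^sup>2) \<le> 1" if "finite S" for P j S
      using D[of P] that unfolding D_def by simp
    have e\<psi>4: "\<psi> P j (i + 1) + \<psi> P j (i - 1) + W i * \<psi> P j i = e P j * \<psi> P j i"
      if "j < K" "\<bar>i\<bar> \<le> int P" for P j i
      using D[of P] that unfolding D_def by simp
    have e\<psi>5: "(\<Sum>i\<in>S. ((if i = 0 then 1 else 0) - (\<Sum>j<K. \<psi> P j 0 * \<psi> P j i))\<^sup>2) \<le> 6 * \<eta>"
      if "finite S" for P S
      using D[of P, unfolded D_def, THEN conjunct2, THEN conjunct2, THEN conjunct2, THEN conjunct2] that by blast
    obtain E \<theta> where E: "\<And>j. j < K \<Longrightarrow> E j \<in> Cs \<or> (\<forall>i. \<theta> j i = 0)"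
      and sq: "\<And>j S. finite S \<Longrightarrow> (\<Sum>i\<in>S. (\<theta> j i)\<^sup>2) \<le> 1"
      and eig: "\<And>j i. j < K \<Longrightarrow> \<theta> j (i + 1) + \<theta> j (i - 1) + W i * \<theta> j i = E j * \<theta> j i"
      and approx: "\<And>S. finite S \<Longrightarrow> (\<Sum>i\<in>S. ((if i = 0 then 1 else 0) - (\<Sum>j<K. \<theta> j 0 * \<theta> j i))\<^sup>2) \<le> 6 * \<eta>"
    proof (rule box_limit[where e = e and \<psi> = \<psi> and W = W and C = Cs and K = K and R = "M + 4" and \<eta> = "6 * \<eta>"], goal_cases)
      case (1 p j)
      show ?case by (rule e\<psi>1)
    next
      case 2
      show ?case by (rule Cs)
    next
      case (3 p j)
      show ?case by (rule e\<psi>2[OF 3(2)])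
    next
      case (4 p j S)
      show ?case by (rule e\<psi>3[OF 4(2)])
    next
      case (5 p j i)
      show ?case by (rule e\<psi>4[OF 5(2,3)])
    next
      case (6 p S)
      show ?case by (rule e\<psi>5[OF 6(2)])
    next
      case (7 E \<theta>)
      show ?case by (rule 7(1)[OF 7(2-5)])
    qed
    \<comment> \<open>A nonzero limit has a trapped energy, at which both half-lines still expand;
      being bounded, it has to decay on both.\<close>
    have decay: "\<exists>C c. 0 < C \<and> 0 < c \<and> (\<forall>i. \<bar>\<theta> j i\<bar> \<le> C * exp (- c * \<bar>real_of_int i\<bar>))" if j: "j < K" for j
    proof (cases "\<forall>i. \<theta> j i = 0")
      case True
      then show ?thesis by (intro exI[of _ 1]) auto
    next
      case False
      then obtain x where x: "x \<in> X" "\<bar>E j - x\<bar> \<le> g" using E[OF j] unfolding Cs_iff by blast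
      have bd: "\<bar>\<theta> j i\<bar> \<le> 1" for i
      proof -
        have "(\<theta> j i)\<^sup>2 \<le> 1\<^sup>2" using sq[of "{i}" j] by simp
        then show ?thesis by (simp only: abs_le_square_iff[symmetric] abs_one)
      qed
      have "\<theta> j (int (Suc n)) = (E j - W (int n)) * \<theta> j (int n) - \<theta> j (int (n - 1))" if "Suc L \<le> n" for n
      proof -
        have e: "int n + 1 = int (Suc n)" "int n - 1 = int (n - 1)" using that by auto
        from eig[OF j, of "int n", unfolded e] show ?thesis by (simp only: left_diff_distrib)
      qed
      from near_expanding.exponential_decay[OF neR[OF x], of "\<lambda>n. \<theta> j (int n)", OF this bd]
      obtain C1 c1 where 1: "0 < C1" "0 < c1" "\<And>n. \<bar>\<theta> j (int n)\<bar> \<le> C1 * exp (- c1 * real n)" by blast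
      have "\<theta> j (- int (Suc n)) = (E j - W (- int n)) * \<theta> j (- int n) - \<theta> j (- int (n - 1))" if "Suc L \<le> n" for n
      proof -
        have e: "- int n + 1 = - int (n - 1)" "- int n - 1 = - int (Suc n)" using that by auto
        from eig[OF j, of "- int n", unfolded e] show ?thesis by (simp only: left_diff_distrib)
      qed
      from near_expanding.exponential_decay[OF neL[OF x], of "\<lambda>n. \<theta> j (- int n)", OF this bd]
      obtain C2 c2 where 2: "0 < C2" "0 < c2" "\<And>n. \<bar>\<theta> j (- int n)\<bar> \<le> C2 * exp (- c2 * real n)" by blast
      have "\<bar>\<theta> j i\<bar> \<le> max C1 C2 * exp (- min c1 c2 * \<bar>real_of_int i\<bar>)" for i
      proof (cases "0 \<le> i")
        case True
        have "\<bar>\<theta> j i\<bar> \<le> C1 * exp (- c1 * real (nat i))" using 1(3)[of "nat i"] True by simp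
        also have "\<dots> \<le> max C1 C2 * exp (- min c1 c2 * \<bar>real_of_int i\<bar>)"
          using 1 True by (intro mult_mono) (auto intro!: mult_right_mono)
        finally show ?thesis .
      next
        case False
        have "\<bar>\<theta> j i\<bar> \<le> C2 * exp (- c2 * real (nat (- i)))" using 2(3)[of "nat (- i)"] False by simp
        also have "\<dots> \<le> max C1 C2 * exp (- min c1 c2 * \<bar>real_of_int i\<bar>)"
        proof (intro mult_mono)
          have "min c1 c2 * real (nat (- i)) \<le> c2 * real (nat (- i))" by (intro mult_right_mono) auto
          then show "exp (- c2 * real (nat (- i))) \<le> exp (- min c1 c2 * \<bar>real_of_int i\<bar>)"
            using False by simp
        qed (use 2 in auto)
        finally show ?thesis .
      qed
      moreover have "0 < max C1 C2" "0 < min c1 c2" using 1 2 by auto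
      ultimately show ?thesis by blast
    qed
    show ?thesis
      by (rule exI[of _ K], rule exI[of _ E], rule exI[of _ \<theta>]) (use eig decay approx sq in simp)
  qed
  then show ?thesis using r(1) V0near
    by (intro exI[of _ V0] exI[of _ r] conjI allI impI) auto
qed

section \<open>Generic potentials\<close>

lemma ell2_L2_set_le:
  assumes "f \<in> ell2" "finite S"
  shows "L2_set (\<lambda>n. cmod (f n)) S \<le> ell2_norm f"
  unfolding L2_set_def ell2_norm_def
  using assms by (intro real_sqrt_le_mono finite_sum_le_infsum) (auto simp: ell2_def)

lemma ell2_norm_nonneg: "0 \<le> ell2_norm f"
  by (simp add: ell2_norm_def infsum_nonneg)

lemma ell2_boundI:
  assumes "\<And>S. finite S \<Longrightarrow> (\<Sum>n\<in>S. (cmod (f n))\<^sup>2) \<le> b\<^sup>2" "0 \<le> b"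
  shows "f \<in> ell2" "ell2_norm f \<le> b"
proof -
  have sm: "(\<lambda>n. (cmod (f n))\<^sup>2) summable_on UNIV"
    using assms(1) by (intro nonneg_bdd_above_summable_on) (auto simp: bdd_above_def)
  then show "f \<in> ell2" by (simp add: ell2_def)
  have "(\<Sum>\<^sub>\<infinity>n. (cmod (f n))\<^sup>2) \<le> b\<^sup>2"
    using assms(1) by (intro infsum_le_finite_sums[OF sm]) auto
  then show "ell2_norm f \<le> b" unfolding ell2_norm_def using assms(2) by (intro real_le_lsqrt infsum_nonneg) auto
qed

lemma ell2_norm_triangle:
  assumes "f \<in> ell2" "g \<in> ell2"
  shows "ell2_norm (\<lambda>n. f n + g n) \<le> ell2_norm f + ell2_norm g"
proof (rule ell2_boundI(2))
  fix S :: "int set" assume S: "finite S"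
  have "L2_set (\<lambda>n. cmod (f n + g n)) S \<le> L2_set (\<lambda>n. cmod (f n) + cmod (g n)) S"
    by (intro L2_set_mono norm_triangle_ineq) auto
  also have "\<dots> \<le> L2_set (\<lambda>n. cmod (f n)) S + L2_set (\<lambda>n. cmod (g n)) S"
    by (rule L2_set_triangle_ineq)
  also have "\<dots> \<le> ell2_norm f + ell2_norm g"
    by (intro add_mono ell2_L2_set_le assms S)
  finally have "sqrt (\<Sum>n\<in>S. (cmod (f n + g n))\<^sup>2) \<le> ell2_norm f + ell2_norm g"
    by (simp add: L2_set_def)
  then show "(\<Sum>n\<in>S. (cmod (f n + g n))\<^sup>2) \<le> (ell2_norm f + ell2_norm g)\<^sup>2"
    by (rule sqrt_le_D)
qed (simp add: ell2_norm_nonneg)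

lemma ell2_scale:
  assumes "f \<in> ell2"
  shows "(\<lambda>n. a * f n) \<in> ell2" "ell2_norm (\<lambda>n. a * f n) \<le> cmod a * ell2_norm f"
proof -
  have "(\<Sum>n\<in>S. (cmod (a * f n))\<^sup>2) \<le> (cmod a * ell2_norm f)\<^sup>2" if "finite S" for S
  proof -
    have "sqrt (\<Sum>n\<in>S. (cmod (f n))\<^sup>2) \<le> ell2_norm f"
      using ell2_L2_set_le[OF assms that] by (simp add: L2_set_def)
    then have "(\<Sum>n\<in>S. (cmod (f n))\<^sup>2) \<le> (ell2_norm f)\<^sup>2" by (rule sqrt_le_D)
    then show ?thesis
      by (simp add: norm_mult power_mult_distrib sum_distrib_left[symmetric] mult_left_mono)
  qed
  from ell2_boundI[OF this] show "(\<lambda>n. a * f n) \<in> ell2" "ell2_norm (\<lambda>n. a * f n) \<le> cmod a * ell2_norm f"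
    by (auto simp: ell2_norm_nonneg)
qed

lemma ell2_sum: "finite F \<Longrightarrow> (\<And>x. x \<in> F \<Longrightarrow> f x \<in> ell2) \<Longrightarrow> (\<lambda>n. \<Sum>x\<in>F. c x * f x n) \<in> ell2"
proof (induction F rule: finite_induct)
  case empty
  then show ?case by (simp add: ell2_def)
next
  case (insert x F)
  then show ?case by (simp add: ell2_add ell2_scale)
qed

lemma ell2_diff: "f \<in> ell2 \<Longrightarrow> g \<in> ell2 \<Longrightarrow> (\<lambda>n. f n - g n) \<in> ell2"
  using ell2_add[of f "\<lambda>n. (-1) * g n"] ell2_scale(1)[of g "-1"] by simp

lemma ell2_mult_summable:
  assumes "f \<in> ell2" "g \<in> ell2"
  shows "(\<lambda>n. cmod (f n * g n)) summable_on UNIV" "cmod (\<Sum>\<^sub>\<infinity>n. f n * g n) \<le> ell2_norm f * ell2_norm g"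
proof -
  have b: "(\<Sum>n\<in>S. cmod (f n * g n)) \<le> ell2_norm f * ell2_norm g" if "finite S" for S
  proof -
    have "(\<Sum>n\<in>S. cmod (f n * g n)) \<le> L2_set (\<lambda>n. cmod (f n)) S * L2_set (\<lambda>n. cmod (g n)) S"
      using L2_set_mult_ineq[of "\<lambda>n. cmod (f n)" "\<lambda>n. cmod (g n)" S] by (simp add: norm_mult)
    also have "\<dots> \<le> ell2_norm f * ell2_norm g"
      by (intro mult_mono ell2_L2_set_le assms that) (auto simp: ell2_norm_nonneg)
    finally show ?thesis .
  qed
  then show s: "(\<lambda>n. cmod (f n * g n)) summable_on UNIV"
    by (intro nonneg_bdd_above_summable_on) (auto simp: bdd_above_def)
  have "cmod (\<Sum>\<^sub>\<infinity>n. f n * g n) \<le> (\<Sum>\<^sub>\<infinity>n. cmod (f n * g n))" by (rule norm_infsum_bound[OF s])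
  also have "\<dots> \<le> ell2_norm f * ell2_norm g" by (rule infsum_le_finite_sums[OF s]) (rule b)
  finally show "cmod (\<Sum>\<^sub>\<infinity>n. f n * g n) \<le> ell2_norm f * ell2_norm g" .
qed

lemma infsum_complex_diff:
  fixes f g :: "'a \<Rightarrow> complex"
  assumes "f summable_on A" "g summable_on A"
  shows "infsum (\<lambda>x. f x - g x) A = infsum f A - infsum g A"
  using infsum_add[OF assms(1), of "\<lambda>x. - g x"] assms(2) by (simp add: summable_on_uminus infsum_uminus)

lemma infsum_complex_finite_sum:
  fixes f :: "'b \<Rightarrow> 'a \<Rightarrow> complex"
  assumes "finite F" "\<And>y. y \<in> F \<Longrightarrow> f y summable_on A"
  shows "infsum (\<lambda>x. \<Sum>y\<in>F. f y x) A = (\<Sum>y\<in>F. infsum (f y) A)"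
    and "(\<lambda>x. \<Sum>y\<in>F. f y x) summable_on A"
  using assms by (induction F rule: finite_induct) (auto simp: infsum_add summable_on_add)

section \<open>Density of good potentials and reduction to unit vectors\<close>

definition localized :: "potential \<Rightarrow> (int \<Rightarrow> complex) \<Rightarrow> bool" where
  "localized V \<phi> \<longleftrightarrow> eigenvector V \<phi> \<and> exponentially_decaying \<phi>"

text \<open>The approximating vectors are required to be localized and not just eigenvectors, since
  the decay of all eigenvectors will be derived from theirs.\<close>

definition near_basis :: "potential \<Rightarrow> int \<Rightarrow> real \<Rightarrow> bool" where
  "near_basis V m \<delta> \<longleftrightarrow> (\<exists>F c. finite F \<and> (\<forall>\<phi>\<in>F. localized V \<phi>) \<and>
     ell2_norm (\<lambda>n. (if n = m then 1 else 0) - (\<Sum>\<phi>\<in>F. c \<phi> * \<phi> n)) < \<delta>)"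

text \<open>The given family may contain zero vectors and repetitions, while
  \<open>near_basis\<close> sums over a set of eigenvectors. Zero vectors are dropped, and the
  coefficients of equal vectors are added up.\<close>

lemma near_basisI:
  fixes W :: potential and \<theta> :: "nat \<Rightarrow> int \<Rightarrow> real" and K :: nat and \<delta> :: real
  assumes eig: "\<And>j i. j < K \<Longrightarrow> \<theta> j (i + 1) + \<theta> j (i - 1) + apply_bcontfun W i * \<theta> j i = E j * \<theta> j i"
    and decay: "\<And>j. j < K \<Longrightarrow> \<exists>C c. 0 < C \<and> 0 < c \<and> (\<forall>i. \<bar>\<theta> j i\<bar> \<le> C * exp (- c * \<bar>real_of_int i\<bar>))"
    and sq: "\<And>j S. j < K \<Longrightarrow> finite S \<Longrightarrow> (\<Sum>i\<in>S. (\<theta> j i)\<^sup>2) \<le> 1"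
    and approx: "\<And>S. finite S \<Longrightarrow> (\<Sum>i\<in>S. ((if i = m then 1 else 0) - (\<Sum>j<K. \<theta> j m * \<theta> j i))\<^sup>2) \<le> \<eta>\<^sup>2"
    and \<eta>: "0 \<le> \<eta>" "\<eta> < \<delta>"
  shows "near_basis W m \<delta>"
proof -
  define J where "J = {j. j < K \<and> \<theta> j \<noteq> (\<lambda>_. 0)}"
  define g where "g j = (\<lambda>i. complex_of_real (\<theta> j i))" for j
  have J: "finite J" by (simp add: J_def)
  define c where "c \<phi> = (\<Sum>j\<in>{j\<in>J. g j = \<phi>}. complex_of_real (\<theta> j m))" for \<phi>
  have loc: "localized W \<phi>" if \<phi>: "\<phi> \<in> g ` J" for \<phi>
  proof -
    obtain j where j: "j < K" "\<theta> j \<noteq> (\<lambda>_. 0)" "\<phi> = g j" using \<phi> by (auto simp: J_def)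
    have "\<phi> \<in> ell2"
      by (rule ell2_boundI[where b = 1]) (use sq[OF j(1)] in \<open>auto simp: j(3) g_def\<close>)
    moreover have "\<phi> \<noteq> (\<lambda>n. 0)" using j(2) by (auto simp: j(3) g_def fun_eq_iff)
    moreover have "schrodinger W \<phi> = (\<lambda>n. of_real (E j) * \<phi> n)"
    proof
      fix n
      have "schrodinger W \<phi> n = of_real (\<theta> j (n + 1) + \<theta> j (n - 1) + apply_bcontfun W n * \<theta> j n)"
        by (simp add: schrodinger_def j(3) g_def)
      then show "schrodinger W \<phi> n = of_real (E j) * \<phi> n" unfolding eig[OF j(1)] by (simp add: j(3) g_def)
    qed
    ultimately have "eigenvector W \<phi>" unfolding eigenvector_def by blast
    moreover have "exponentially_decaying \<phi>"
      using decay[OF j(1)] by (simp add: exponentially_decaying_def j(3) g_def)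
    ultimately show ?thesis by (simp add: localized_def)
  qed
  have sum: "(\<Sum>\<phi>\<in>g ` J. c \<phi> * \<phi> n) = of_real (\<Sum>j<K. \<theta> j m * \<theta> j n)" for n
  proof -
    have "(\<Sum>\<phi>\<in>g ` J. c \<phi> * \<phi> n) = (\<Sum>\<phi>\<in>g ` J. \<Sum>j\<in>{j\<in>J. g j = \<phi>}. complex_of_real (\<theta> j m) * g j n)"
      unfolding c_def sum_distrib_right by (intro sum.cong refl) auto
    also have "\<dots> = (\<Sum>j\<in>J. complex_of_real (\<theta> j m) * g j n)"
      by (rule sum.image_gen[OF J, symmetric])
    also have "\<dots> = (\<Sum>j<K. complex_of_real (\<theta> j m) * g j n)"
      by (rule sum.mono_neutral_left) (auto simp: J_def g_def)
    finally show ?thesis by (simp add: g_def)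
  qed
  have "ell2_norm (\<lambda>n. (if n = m then 1 else 0) - (\<Sum>\<phi>\<in>g ` J. c \<phi> * \<phi> n)) \<le> \<eta>"
  proof (rule ell2_boundI(2)[OF _ \<eta>(1)])
    fix S :: "int set" assume S: "finite S"
    have "(if n = m then 1 else 0) - (\<Sum>\<phi>\<in>g ` J. c \<phi> * \<phi> n) = of_real ((if n = m then 1 else 0) - (\<Sum>j<K. \<theta> j m * \<theta> j n))" for n
      unfolding sum by simp
    then show "(\<Sum>n\<in>S. (cmod ((if n = m then 1 else 0) - (\<Sum>\<phi>\<in>g ` J. c \<phi> * \<phi> n)))\<^sup>2) \<le> \<eta>\<^sup>2"
      using approx[OF S] by (simp only: norm_of_real power2_abs)
  qed
  then show ?thesis unfolding near_basis_def using \<eta>(2) J loc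
    by (intro exI[of _ "g ` J"] exI[of _ c]) auto
qed

text \<open>Translation covariance reduces \<open>m\<close> to 0. The perturbation is small at every
  site, hence in the supremum norm, and the uniform tolerance \<open>r\<close> is a ball around the
  new potential.\<close>

lemma near_basis_dense:
  fixes V :: potential
  assumes \<epsilon>: "0 < \<epsilon>" and \<delta>: "0 < \<delta>"
  shows "\<exists>V1 r. 0 < r \<and> dist V1 V \<le> \<epsilon> \<and> (\<forall>W\<in>ball V1 r. near_basis W m \<delta>)"
proof -
  define v where "v i = apply_bcontfun V (i + m)" for i
  have v: "\<bar>v i\<bar> \<le> norm V" for i using norm_bounded[of V "i + m"] by (simp add: v_def)
  define \<epsilon>' where "\<epsilon>' = min \<epsilon> 1"
  have \<epsilon>': "0 < \<epsilon>'" "\<epsilon>' \<le> 1" "\<epsilon>' \<le> \<epsilon>" using \<epsilon> by (auto simp: \<epsilon>'_def)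
  \<comment> \<open>A strict margin below \<open>\<delta>\<close>; the argument \<eta>^2 / 6 cancels
    the factor 6 in the bound on the squared error.\<close>
  define \<eta> where "\<eta> = \<delta> / 2"
  have \<eta>: "0 < \<eta>\<^sup>2 / 6" "0 \<le> \<eta>" "\<eta> < \<delta>" using \<delta> by (auto simp: \<eta>_def)
  from robust_eigenvectors[where V = v and M = "norm V" and \<epsilon> = \<epsilon>' and \<eta> = "\<eta>\<^sup>2 / 6", OF v \<epsilon>'(1,2) \<eta>(1)]
  obtain v0 r where r: "0 < r" and v0: "\<forall>i. v i \<le> v0 i \<and> v0 i \<le> v i + \<epsilon>'"
    and rob: "\<forall>w. (\<forall>i. \<bar>w i - v0 i\<bar> \<le> r) \<longrightarrow> (\<exists>(K::nat) E \<phi>. (\<forall>j<K. (\<forall>i. \<phi> j (i + 1) + \<phi> j (i - 1) + w i * \<phi> j i = E j * \<phi> j i) \<and>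
          (\<exists>C c. 0 < C \<and> 0 < c \<and> (\<forall>i. \<bar>\<phi> j i\<bar> \<le> C * exp (- c * \<bar>real_of_int i\<bar>)))) \<and>
        (\<forall>j<K. \<forall>S. finite S \<longrightarrow> (\<Sum>i\<in>S. (\<phi> j i)\<^sup>2) \<le> 1) \<and>
        (\<forall>S. finite S \<longrightarrow> (\<Sum>i\<in>S. ((if i = 0 then 1 else 0) - (\<Sum>j<K. \<phi> j 0 * \<phi> j i))\<^sup>2) \<le> 6 * (\<eta>\<^sup>2 / 6)))"
    by (elim exE conjE) (rule that)
  define f where "f i = v0 (i - m)" for i
  have fV: "\<bar>f i - apply_bcontfun V i\<bar> \<le> \<epsilon>'" for i
    using spec[OF v0, of "i - m"] by (simp add: f_def v_def)
  have "\<bar>f i\<bar> \<le> norm V + 1" for i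
    using fV[of i] norm_bounded[of V i] \<epsilon>' by (auto simp: abs_le_iff)
  then have "f \<in> bcontfun"
    unfolding bcontfun_int_iff bounded_iff by auto
  then have app: "apply_bcontfun (Bcontfun f) = f" by (rule Bcontfun_inverse)
  have "near_basis W m \<delta>" if W: "W \<in> ball (Bcontfun f) r" for W
  proof -
    have "\<bar>apply_bcontfun W (i + m) - v0 i\<bar> \<le> r" for i
    proof -
      have "dist (apply_bcontfun W (i + m)) (apply_bcontfun (Bcontfun f) (i + m)) \<le> dist W (Bcontfun f)"
        by (rule dist_bounded)
      then show ?thesis using W by (simp add: app f_def dist_real_def dist_commute)
    qed
    then have "\<forall>i. \<bar>apply_bcontfun W (i + m) - v0 i\<bar> \<le> r" by blast
    from rob[THEN spec, THEN mp, OF this]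
    obtain K :: nat and E \<phi> where es: "\<forall>j<K. (\<forall>i. \<phi> j (i + 1) + \<phi> j (i - 1) + apply_bcontfun W (i + m) * \<phi> j i = E j * \<phi> j i) \<and>
        (\<exists>C c. 0 < C \<and> 0 < c \<and> (\<forall>i. \<bar>\<phi> j i\<bar> \<le> C * exp (- c * \<bar>real_of_int i\<bar>)))"
      and sq: "\<forall>j<K. \<forall>S. finite S \<longrightarrow> (\<Sum>i\<in>S. (\<phi> j i)\<^sup>2) \<le> 1"
      and approx: "\<forall>S. finite S \<longrightarrow> (\<Sum>i\<in>S. ((if i = 0 then 1 else 0) - (\<Sum>j<K. \<phi> j 0 * \<phi> j i))\<^sup>2) \<le> 6 * (\<eta>\<^sup>2 / 6)"
      by (elim exE conjE) (rule that)
    have eig: "\<phi> j (i + 1) + \<phi> j (i - 1) + apply_bcontfun W (i + m) * \<phi> j i = E j * \<phi> j i"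
      and decay: "\<exists>C c. 0 < C \<and> 0 < c \<and> (\<forall>i. \<bar>\<phi> j i\<bar> \<le> C * exp (- c * \<bar>real_of_int i\<bar>))" if "j < K" for j i
      using es that by simp_all
    have shift: "(\<Sum>i\<in>S. h (i - m)) = (\<Sum>i\<in>(\<lambda>i. i - m) ` S. h i)" for S and h :: "int \<Rightarrow> real"
      by (subst sum.reindex) (auto simp: inj_on_def)
    show ?thesis
    proof (rule near_basisI[where \<theta> = "\<lambda>j i. \<phi> j (i - m)" and E = E and K = K and \<eta> = \<eta>])
      show "\<phi> j (i + 1 - m) + \<phi> j (i - 1 - m) + apply_bcontfun W i * \<phi> j (i - m) = E j * \<phi> j (i - m)" if "j < K" for j i
        using eig[OF that, of "i - m"] by (simp add: algebra_simps)
      show "\<exists>C c. 0 < C \<and> 0 < c \<and> (\<forall>i. \<bar>\<phi> j (i - m)\<bar> \<le> C * exp (- c * \<bar>real_of_int i\<bar>))" if j: "j < K" for j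
      proof -
        obtain C c where C: "0 < C" "0 < c" "\<And>i. \<bar>\<phi> j i\<bar> \<le> C * exp (- c * \<bar>real_of_int i\<bar>)" using decay[OF j] by blast
        have "\<bar>\<phi> j (i - m)\<bar> \<le> (C * exp (c * \<bar>real_of_int m\<bar>)) * exp (- c * \<bar>real_of_int i\<bar>)" for i
        proof -
          have "\<bar>\<phi> j (i - m)\<bar> \<le> C * exp (- c * \<bar>real_of_int (i - m)\<bar>)" by (rule C(3))
          also have "\<dots> \<le> C * exp (c * \<bar>real_of_int m\<bar> - c * \<bar>real_of_int i\<bar>)"
          proof -
            have "c * \<bar>real_of_int i\<bar> \<le> c * (\<bar>real_of_int (i - m)\<bar> + \<bar>real_of_int m\<bar>)"
              using C by (intro mult_left_mono) auto
            then show ?thesis using C by (simp add: algebra_simps)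
          qed
          finally show ?thesis by (simp add: exp_diff exp_minus divide_inverse mult.assoc)
        qed
        then show ?thesis using C(1,2) by (intro exI[of _ "C * exp (c * \<bar>real_of_int m\<bar>)"] exI[of _ c]) auto
      qed
      show "(\<Sum>i\<in>S. (\<phi> j (i - m))\<^sup>2) \<le> 1" if "j < K" "finite S" for j S
        unfolding shift[of "\<lambda>i. (\<phi> j i)\<^sup>2"] using sq that by simp
      show "(\<Sum>i\<in>S. ((if i = m then 1 else 0) - (\<Sum>j<K. \<phi> j (m - m) * \<phi> j (i - m)))\<^sup>2) \<le> \<eta>\<^sup>2" if "finite S" for S
        using approx[THEN spec, of "(\<lambda>i. i - m) ` S"] that
        unfolding shift[of "\<lambda>i. ((if i = 0 then 1 else 0) - (\<Sum>j<K. \<phi> j 0 * \<phi> j i))\<^sup>2", symmetric] by simp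
    qed (rule \<eta>)+
  qed
  moreover have "dist (Bcontfun f) V \<le> \<epsilon>"
  proof (rule dist_bound)
    show "dist (apply_bcontfun (Bcontfun f) i) (apply_bcontfun V i) \<le> \<epsilon>" for i
      using fV[of i] \<epsilon>' by (simp add: app dist_real_def)
  qed
  ultimately show ?thesis using r by blast
qed

text \<open>The sequences that combinations of eigenvectors approximate form a linear space; it
  contains the unit vectors, whose span is dense.\<close>

lemma pure_point_of_near_basis:
  assumes nb: "\<And>m \<delta>. 0 < \<delta> \<Longrightarrow> near_basis V m \<delta>"
  shows "pure_point_spectrum V"
proof -
  define app where "app \<psi> \<longleftrightarrow> \<psi> \<in> ell2 \<and> (\<forall>\<epsilon>>0. \<exists>F c. finite F \<and> (\<forall>\<phi>\<in>F. eigenvector V \<phi>) \<and>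
        ell2_norm (\<lambda>n. \<psi> n - (\<Sum>\<phi>\<in>F. c \<phi> * \<phi> n)) < \<epsilon>)" for \<psi>
  have ell2_F: "(\<lambda>n. \<Sum>\<phi>\<in>F. c \<phi> * \<phi> n) \<in> ell2" if "finite F" "\<forall>\<phi>\<in>F. eigenvector V \<phi>" for F c
    using ell2_sum[of F "\<lambda>\<phi>. \<phi>" c] that by (auto simp: eigenvector_def)
  have app_add: "app (\<lambda>n. f n + g n)" if fg: "app f" "app g" for f g
    unfolding app_def
  proof (intro conjI allI impI)
    show "(\<lambda>n. f n + g n) \<in> ell2" using fg by (simp add: app_def ell2_add)
    fix \<epsilon> :: real assume "0 < \<epsilon>"
    then have e2: "0 < \<epsilon> / 2" by simp
    obtain F c where F: "finite F" "\<forall>\<phi>\<in>F. eigenvector V \<phi>" "ell2_norm (\<lambda>n. f n - (\<Sum>\<phi>\<in>F. c \<phi> * \<phi> n)) < \<epsilon> / 2"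
      using fg(1) e2 unfolding app_def by blast
    obtain G d where G: "finite G" "\<forall>\<phi>\<in>G. eigenvector V \<phi>" "ell2_norm (\<lambda>n. g n - (\<Sum>\<phi>\<in>G. d \<phi> * \<phi> n)) < \<epsilon> / 2"
      using fg(2) e2 unfolding app_def by blast
    define k where "k \<phi> = (if \<phi> \<in> F then c \<phi> else 0) + (if \<phi> \<in> G then d \<phi> else 0)" for \<phi>
    have "(\<Sum>\<phi>\<in>F \<union> G. k \<phi> * \<phi> n) = (\<Sum>\<phi>\<in>F. c \<phi> * \<phi> n) + (\<Sum>\<phi>\<in>G. d \<phi> * \<phi> n)" for n
    proof -
      have "(\<Sum>\<phi>\<in>F \<union> G. k \<phi> * \<phi> n) = (\<Sum>\<phi>\<in>F \<union> G. if \<phi> \<in> F then c \<phi> * \<phi> n else 0) + (\<Sum>\<phi>\<in>F \<union> G. if \<phi> \<in> G then d \<phi> * \<phi> n else 0)"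
        unfolding sum.distrib[symmetric] by (rule sum.cong) (auto simp: k_def distrib_right)
      then show ?thesis using F(1) G(1) by (simp add: sum.inter_restrict[symmetric] Int_absorb1)
    qed
    then have "(\<lambda>n. f n + g n - (\<Sum>\<phi>\<in>F \<union> G. k \<phi> * \<phi> n))
       = (\<lambda>n. (f n - (\<Sum>\<phi>\<in>F. c \<phi> * \<phi> n)) + (g n - (\<Sum>\<phi>\<in>G. d \<phi> * \<phi> n)))" by auto
    then have "ell2_norm (\<lambda>n. f n + g n - (\<Sum>\<phi>\<in>F \<union> G. k \<phi> * \<phi> n)) \<le>
       ell2_norm (\<lambda>n. f n - (\<Sum>\<phi>\<in>F. c \<phi> * \<phi> n)) + ell2_norm (\<lambda>n. g n - (\<Sum>\<phi>\<in>G. d \<phi> * \<phi> n))"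
      using fg F G by (auto intro!: ell2_norm_triangle ell2_diff ell2_F simp: app_def)
    then have "ell2_norm (\<lambda>n. f n + g n - (\<Sum>\<phi>\<in>F \<union> G. k \<phi> * \<phi> n)) < \<epsilon>" using F(3) G(3) by simp
    then show "\<exists>F c. finite F \<and> (\<forall>\<phi>\<in>F. eigenvector V \<phi>) \<and> ell2_norm (\<lambda>n. f n + g n - (\<Sum>\<phi>\<in>F. c \<phi> * \<phi> n)) < \<epsilon>"
      using F G by (intro exI[of _ "F \<union> G"] exI[of _ k]) auto
  qed
  have app_scale: "app (\<lambda>n. a * f n)" if f: "app f" for f a
    unfolding app_def
  proof (intro conjI allI impI)
    show "(\<lambda>n. a * f n) \<in> ell2" using f by (simp add: app_def ell2_scale)
    fix \<epsilon> :: real assume "0 < \<epsilon>"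
    then have "0 < \<epsilon> / (cmod a + 1)" by (simp add: add_nonneg_pos)
    then obtain F c where F: "finite F" "\<forall>\<phi>\<in>F. eigenvector V \<phi>" "ell2_norm (\<lambda>n. f n - (\<Sum>\<phi>\<in>F. c \<phi> * \<phi> n)) < \<epsilon> / (cmod a + 1)"
      using f unfolding app_def by blast
    let ?d = "\<lambda>n. f n - (\<Sum>\<phi>\<in>F. c \<phi> * \<phi> n)"
    have "ell2_norm (\<lambda>n. a * ?d n) \<le> cmod a * ell2_norm ?d"
      using f F by (intro ell2_scale ell2_diff ell2_F) (auto simp: app_def)
    also have "\<dots> \<le> (cmod a + 1) * ell2_norm ?d" by (intro mult_right_mono) (auto simp: ell2_norm_nonneg)
    also have "\<dots> < (cmod a + 1) * (\<epsilon> / (cmod a + 1))" by (intro mult_strict_left_mono F) (simp add: add_nonneg_pos)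
    also have "\<dots> = \<epsilon>" using norm_ge_zero[of a] by (simp add: add_nonneg_eq_0_iff)
    finally have "ell2_norm (\<lambda>n. a * f n - (\<Sum>\<phi>\<in>F. a * c \<phi> * \<phi> n)) < \<epsilon>"
      by (simp add: right_diff_distrib sum_distrib_left mult.assoc)
    then show "\<exists>F c. finite F \<and> (\<forall>\<phi>\<in>F. eigenvector V \<phi>) \<and> ell2_norm (\<lambda>n. a * f n - (\<Sum>\<phi>\<in>F. c \<phi> * \<phi> n)) < \<epsilon>"
      using F by (intro exI[of _ F] exI[of _ "\<lambda>\<phi>. a * c \<phi>"]) auto
  qed
  have app_basis: "app (\<lambda>n. if n = m then 1 else 0)" for m
    unfolding app_def
  proof (intro conjI allI impI)
    show "(\<lambda>n. if n = m then 1 else 0) \<in> ell2"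
    proof (rule ell2_boundI(1)[where b = 1])
      fix S :: "int set" assume S: "finite S"
      have "(\<Sum>n\<in>S. (cmod (if n = m then 1 else 0))\<^sup>2) = (\<Sum>n\<in>S. if n = m then 1 else 0)"
        by (rule sum.cong) auto
      then show "(\<Sum>n\<in>S. (cmod (if n = m then 1 else 0))\<^sup>2) \<le> 1\<^sup>2" using S by simp
    qed simp
    show "\<exists>F c. finite F \<and> (\<forall>\<phi>\<in>F. eigenvector V \<phi>) \<and> ell2_norm (\<lambda>n. (if n = m then 1 else 0) - (\<Sum>\<phi>\<in>F. c \<phi> * \<phi> n)) < \<epsilon>"
      if "0 < \<epsilon>" for \<epsilon>
      using nb[OF that, of m] unfolding near_basis_def localized_def by blast
  qed
  have app_fin: "app (\<lambda>n. \<Sum>m\<in>S. \<psi> m * (if n = m then 1 else 0))" if "finite S" for S \<psi>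
    using that
  proof (induction S rule: finite_induct)
    case empty
    then show ?case using app_scale[OF app_basis[of 0], of 0] by simp
  next
    case (insert x S)
    then show ?case using app_add[OF app_scale[OF app_basis, of "\<psi> x" x] insert.IH] by simp
  qed
  show ?thesis
    unfolding pure_point_spectrum_def
  proof (intro ballI allI impI)
    fix \<psi> and \<epsilon> :: real assume \<psi>: "\<psi> \<in> ell2" and \<epsilon>: "0 < \<epsilon>"
    let ?q = "\<lambda>n. (cmod (\<psi> n))\<^sup>2"
    have sm: "?q summable_on UNIV" using \<psi> by (simp add: ell2_def)
    obtain S where S: "finite S" "dist (sum ?q S) (infsum ?q UNIV) \<le> (\<epsilon> / 2)\<^sup>2 / 2"
      using infsum_finite_approximation[OF sm, of "(\<epsilon> / 2)\<^sup>2 / 2"] \<epsilon> by auto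
    define t where "t n = (\<Sum>m\<in>S. \<psi> m * (if n = m then 1 else 0))" for n
    have t: "t n = (if n \<in> S then \<psi> n else 0)" for n
      using S(1) by (simp add: t_def if_distrib cong: if_cong)
    have tail: "(\<Sum>n\<in>T. (cmod (\<psi> n - t n))\<^sup>2) \<le> (\<epsilon> / 2)\<^sup>2" if T: "finite T" for T
    proof -
      have "(\<Sum>n\<in>T. (cmod (\<psi> n - t n))\<^sup>2) = (\<Sum>n\<in>T - S. ?q n)"
        using T by (intro sum.mono_neutral_cong_right) (auto simp: t)
      moreover have "(\<Sum>n\<in>T - S. ?q n) + (\<Sum>n\<in>S. ?q n) = (\<Sum>n\<in>(T - S) \<union> S. ?q n)"
        using T S(1) by (intro sum.union_disjoint[symmetric]) auto
      moreover have "\<dots> \<le> infsum ?q UNIV" using T S(1) sm by (intro finite_sum_le_infsum) auto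
      moreover have "infsum ?q UNIV - sum ?q S \<le> (\<epsilon> / 2)\<^sup>2 / 2" using S(2) unfolding dist_real_def by linarith
      moreover have "(\<epsilon> / 2)\<^sup>2 / 2 \<le> (\<epsilon> / 2)\<^sup>2" by simp
      ultimately show ?thesis by linarith
    qed
    have d: "(\<lambda>n. \<psi> n - t n) \<in> ell2" "ell2_norm (\<lambda>n. \<psi> n - t n) \<le> \<epsilon> / 2"
      using ell2_boundI[of "\<lambda>n. \<psi> n - t n", OF tail] \<epsilon> by auto
    have "app t" unfolding t_def by (rule app_fin[OF S(1)])
    moreover have "0 < \<epsilon> / 2" using \<epsilon> by simp
    ultimately obtain F c where F: "finite F" "\<forall>\<phi>\<in>F. eigenvector V \<phi>" "ell2_norm (\<lambda>n. t n - (\<Sum>\<phi>\<in>F. c \<phi> * \<phi> n)) < \<epsilon> / 2"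
      unfolding app_def by blast
    have tl: "t \<in> ell2" using \<open>app t\<close> by (simp add: app_def)
    have "ell2_norm (\<lambda>n. (\<psi> n - t n) + (t n - (\<Sum>\<phi>\<in>F. c \<phi> * \<phi> n))) \<le> ell2_norm (\<lambda>n. \<psi> n - t n) + ell2_norm (\<lambda>n. t n - (\<Sum>\<phi>\<in>F. c \<phi> * \<phi> n))"
      by (intro ell2_norm_triangle d ell2_diff tl ell2_F F)
    then have "ell2_norm (\<lambda>n. \<psi> n - (\<Sum>\<phi>\<in>F. c \<phi> * \<phi> n)) < \<epsilon>" using d(2) F(3) by simp
    then show "\<exists>F c. finite F \<and> (\<forall>\<phi>\<in>F. eigenvector V \<phi>) \<and> ell2_norm (\<lambda>n. \<psi> n - (\<Sum>\<phi>\<in>F. c \<phi> * \<phi> n)) < \<epsilon>"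
      using F by blast
  qed
qed

section \<open>Simplicity of eigenvalues and decay of all eigenvectors\<close>

lemma schrodinger_solution_eq_0:
  assumes d: "schrodinger V d = (\<lambda>n. E * d n)" and z: "d k = 0" "d (k + 1) = 0"
  shows "d n = 0"
proof -
  have rec: "d (i + 1) + d (i - 1) + of_real (apply_bcontfun V i) * d i = E * d i" for i
    using fun_cong[OF d, of i] by (simp add: schrodinger_def)
  have up: "d (k + int j) = 0 \<and> d (k + int j + 1) = 0" for j
  proof (induction j)
    case (Suc j)
    then show ?case using rec[of "k + int j + 1"] by (simp add: algebra_simps)
  qed (use z in simp)
  have down: "d (k - int j) = 0 \<and> d (k - int j + 1) = 0" for j
  proof (induction j)
    case (Suc j)
    then show ?case using rec[of "k - int j"] by (simp add: algebra_simps)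
  qed (use z in simp)
  show ?thesis
  proof (cases "k \<le> n")
    case True
    then show ?thesis using up[of "nat (n - k)"] by simp
  next
    case False
    then show ?thesis using down[of "nat (k - n)"] by simp
  qed
qed

text \<open>The Wronskian \<open>w\<close> is summable, and its increments are E - D times the
  products paired in \<open>ne\<close>. Summed over the line they cancel, so E = D; now
  \<open>w\<close> is constant and summable, hence 0. The pairing carries no conjugate because this
  identity is bilinear.\<close>

lemma eigenvector_proportional:
  assumes \<phi>: "eigenvector V \<phi>" and \<psi>: "eigenvector V \<psi>" and ne: "(\<Sum>\<^sub>\<infinity>n. \<psi> n * \<phi> n) \<noteq> 0"
  shows "\<exists>c. \<phi> = (\<lambda>n. c * \<psi> n)"
proof -
  obtain E where E: "schrodinger V \<phi> = (\<lambda>n. E * \<phi> n)" using \<phi> by (auto simp: eigenvector_def)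
  obtain D where D: "schrodinger V \<psi> = (\<lambda>n. D * \<psi> n)" using \<psi> by (auto simp: eigenvector_def)
  have l2: "\<phi> \<in> ell2" "\<psi> \<in> ell2" using \<phi> \<psi> by (auto simp: eigenvector_def)
  define w where "w n = \<phi> (n + 1) * \<psi> n - \<phi> n * \<psi> (n + 1)" for n
  have diff: "w n - w (n - 1) = (E - D) * (\<psi> n * \<phi> n)" for n
  proof -
    have "\<phi> (n + 1) + \<phi> (n - 1) + of_real (apply_bcontfun V n) * \<phi> n = E * \<phi> n"
      "\<psi> (n + 1) + \<psi> (n - 1) + of_real (apply_bcontfun V n) * \<psi> n = D * \<psi> n"
      using fun_cong[OF E, of n] fun_cong[OF D, of n] by (simp_all add: schrodinger_def)
    then have "\<psi> n * (\<phi> (n + 1) + \<phi> (n - 1) + of_real (apply_bcontfun V n) * \<phi> n)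
      - \<phi> n * (\<psi> (n + 1) + \<psi> (n - 1) + of_real (apply_bcontfun V n) * \<psi> n) = \<psi> n * (E * \<phi> n) - \<phi> n * (D * \<psi> n)"
      by simp
    then show ?thesis by (simp add: w_def algebra_simps)
  qed
  have abs_w: "(\<lambda>n. cmod (w n)) summable_on UNIV"
  proof -
    have "(\<lambda>n. cmod (\<phi> (n + 1) * \<psi> n) + cmod (\<phi> n * \<psi> (n + 1))) summable_on UNIV"
      using ell2_mult_summable(1)[OF ell2_shift[OF l2(1), of 1] l2(2)] ell2_mult_summable(1)[OF l2(1) ell2_shift[OF l2(2), of 1]]
      by (intro summable_on_add) auto
    then show ?thesis
      by (rule summable_on_comparison_test) (auto simp: w_def norm_triangle_ineq4)
  qed
  have sw: "w summable_on UNIV" by (rule abs_summable_summable[OF abs_w])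
  have bij: "bij (\<lambda>n::int. n - 1)" by (rule bij_betw_byWitness[where f' = "\<lambda>n. n + 1"]) auto
  have sw': "(\<lambda>n. w (n - 1)) summable_on UNIV" using summable_on_reindex_bij_betw[OF bij, of w] sw by simp
  have "(\<Sum>\<^sub>\<infinity>n. w n - w (n - 1)) = (\<Sum>\<^sub>\<infinity>n. w n) - (\<Sum>\<^sub>\<infinity>n. w (n - 1))" by (rule infsum_complex_diff[OF sw sw'])
  also have "(\<Sum>\<^sub>\<infinity>n. w (n - 1)) = (\<Sum>\<^sub>\<infinity>n. w n)" by (rule infsum_reindex_bij_betw[OF bij])
  finally have "(E - D) * (\<Sum>\<^sub>\<infinity>n. \<psi> n * \<phi> n) = 0" unfolding diff infsum_cmult_right' by simp
  then have ED: "E = D" using ne by simp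
  have const: "w n = w 0" for n
  proof -
    have step: "w n = w (n - 1)" for n using diff[of n] ED by simp
    show ?thesis
    proof (induction n rule: int_induct[where k = 0])
      case (step1 i)
      then show ?case using step[of "i + 1"] by simp
    next
      case (step2 i)
      then show ?case using step[of i] by simp
    qed simp
  qed
  have w0: "w 0 = 0"
  proof (rule ccontr)
    assume "w 0 \<noteq> 0"
    obtain k :: nat where k: "(\<Sum>\<^sub>\<infinity>n. cmod (w n)) / cmod (w 0) < real k" using reals_Archimedean2 by blast
    have "(\<Sum>n\<in>{1..int k}. cmod (w n)) \<le> (\<Sum>\<^sub>\<infinity>n. cmod (w n))"
      using abs_w by (intro finite_sum_le_infsum) auto
    also have "(\<Sum>n\<in>{1..int k}. cmod (w n)) = (\<Sum>n\<in>{1..int k}. cmod (w 0))"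
      by (rule sum.cong[OF refl]) (rule arg_cong[OF const])
    also have "\<dots> = real k * cmod (w 0)" by simp
    finally show False using k \<open>w 0 \<noteq> 0\<close> by (simp add: divide_simps)
  qed
  obtain m where m: "\<psi> m \<noteq> 0" using \<psi> by (auto simp: eigenvector_def fun_eq_iff)
  define c where "c = \<phi> m / \<psi> m"
  define d where "d n = \<phi> n - c * \<psi> n" for n
  have "schrodinger V d = (\<lambda>n. E * d n)"
  proof
    fix n
    have "schrodinger V d n = schrodinger V \<phi> n - c * schrodinger V \<psi> n" by (simp add: schrodinger_def d_def algebra_simps)
    then show "schrodinger V d n = E * d n" unfolding E D by (simp add: d_def ED algebra_simps)
  qed
  moreover have dm: "d m = 0" using m by (simp add: d_def c_def)
  moreover have "d (m + 1) = 0"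
  proof -
    have "\<phi> (m + 1) * \<psi> m = \<phi> m * \<psi> (m + 1)" using const[of m] w0 by (simp add: w_def)
    then show ?thesis using m by (simp add: d_def c_def field_simps)
  qed
  ultimately have "d n = 0" for n by (rule schrodinger_solution_eq_0)
  then have "\<phi> = (\<lambda>n. c * \<psi> n)" by (simp add: d_def fun_eq_iff)
  then show ?thesis ..
qed

text \<open>An eigenvector pairing to zero with every localized one would see only the approximation
  error of a unit vector, and its value at \<open>m\<close> would be too small. Thus it pairs with
  some localized eigenvector and is a multiple of it.\<close>

lemma decay_of_near_basis:
  assumes nb: "\<And>m \<delta>. 0 < \<delta> \<Longrightarrow> near_basis V m \<delta>" and \<phi>: "eigenvector V \<phi>"
  shows "exponentially_decaying \<phi>"
proof -
  have l2: "\<phi> \<in> ell2" using \<phi> by (simp add: eigenvector_def)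
  obtain m where m: "\<phi> m \<noteq> 0" using \<phi> by (auto simp: eigenvector_def fun_eq_iff)
  have "\<exists>\<psi>. localized V \<psi> \<and> (\<Sum>\<^sub>\<infinity>n. \<psi> n * \<phi> n) \<noteq> 0"
  proof (rule ccontr)
    assume "\<not> ?thesis"
    then have orth: "(\<Sum>\<^sub>\<infinity>n. \<psi> n * \<phi> n) = 0" if "localized V \<psi>" for \<psi> using that by blast
    \<comment> \<open>Chosen so that \<open>\<delta>\<close> times the norm stays strictly below
      |\<phi> m|.\<close>
    define \<delta> where "\<delta> = cmod (\<phi> m) / (ell2_norm \<phi> + 1)"
    have N: "0 < ell2_norm \<phi> + 1" using ell2_norm_nonneg[of \<phi>] by simp
    have "0 < \<delta>" using m N by (simp add: \<delta>_def)
    then obtain F c where F: "finite F" "\<And>\<psi>. \<psi> \<in> F \<Longrightarrow> localized V \<psi>"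
      "ell2_norm (\<lambda>n. (if n = m then 1 else 0) - (\<Sum>\<psi>\<in>F. c \<psi> * \<psi> n)) < \<delta>"
      using nb[of \<delta> m] unfolding near_basis_def by blast
    let ?e = "\<lambda>n. (if n = m then 1 else 0) :: complex"
    let ?s = "\<lambda>n. \<Sum>\<psi>\<in>F. c \<psi> * \<psi> n"
    have l2\<psi>: "\<psi> \<in> ell2" if "\<psi> \<in> F" for \<psi> using F(2)[OF that] by (simp add: localized_def eigenvector_def)
    have s_l2: "?s \<in> ell2" using ell2_sum[of F "\<lambda>\<psi>. \<psi>" c] F(1) l2\<psi> by simp
    have e_l2: "?e \<in> ell2"
    proof (rule ell2_boundI(1)[where b = 1])
      fix S :: "int set" assume S: "finite S"
      have "(\<Sum>n\<in>S. (cmod (?e n))\<^sup>2) = (\<Sum>n\<in>S. if n = m then 1 else 0)"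
        by (rule sum.cong) auto
      then show "(\<Sum>n\<in>S. (cmod (?e n))\<^sup>2) \<le> 1\<^sup>2" using S by simp
    qed simp
    have sm: "(\<lambda>n. f n * \<phi> n) summable_on UNIV" if "f \<in> ell2" for f
      by (rule abs_summable_summable[OF ell2_mult_summable(1)[OF that l2]])
    have "(\<Sum>\<^sub>\<infinity>n. ?s n * \<phi> n) = (\<Sum>\<^sub>\<infinity>n. \<Sum>\<psi>\<in>F. c \<psi> * (\<psi> n * \<phi> n))"
      by (simp add: sum_distrib_right mult.assoc)
    also have "\<dots> = (\<Sum>\<psi>\<in>F. \<Sum>\<^sub>\<infinity>n. c \<psi> * (\<psi> n * \<phi> n))"
      using sm l2\<psi> F(1) by (intro infsum_complex_finite_sum summable_on_cmult_right) auto
    also have "\<dots> = 0" using orth F(2) by (simp add: infsum_cmult_right')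
    finally have s0: "(\<Sum>\<^sub>\<infinity>n. ?s n * \<phi> n) = 0" .
    have "(\<Sum>\<^sub>\<infinity>n. ?e n * \<phi> n) = (\<Sum>\<^sub>\<infinity>n\<in>{m}. ?e n * \<phi> n)"
      by (rule infsum_cong_neutral) auto
    then have e1: "(\<Sum>\<^sub>\<infinity>n. ?e n * \<phi> n) = \<phi> m" by simp
    have "(\<Sum>\<^sub>\<infinity>n. (?e n - ?s n) * \<phi> n) = \<phi> m"
      unfolding left_diff_distrib using infsum_complex_diff[OF sm[OF e_l2] sm[OF s_l2]] s0 e1 by simp
    then have "cmod (\<phi> m) \<le> ell2_norm (\<lambda>n. ?e n - ?s n) * ell2_norm \<phi>"
      using ell2_mult_summable(2)[OF ell2_diff[OF e_l2 s_l2] l2] by simp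
    also have "\<dots> \<le> \<delta> * ell2_norm \<phi>" using F(3) by (intro mult_right_mono) (auto simp: ell2_norm_nonneg)
    also have "\<dots> < \<delta> * (ell2_norm \<phi> + 1)" using \<open>0 < \<delta>\<close> by (intro mult_strict_left_mono) auto
    also have "\<dots> = cmod (\<phi> m)" using N by (simp add: \<delta>_def)
    finally show False by simp
  qed
  then obtain \<psi> where \<psi>: "localized V \<psi>" "(\<Sum>\<^sub>\<infinity>n. \<psi> n * \<phi> n) \<noteq> 0" by blast
  then obtain a where a: "\<phi> = (\<lambda>n. a * \<psi> n)"
    using eigenvector_proportional[OF \<phi>, of \<psi>] by (auto simp: localized_def)
  obtain C c where C: "0 < C" "0 < c" "\<And>n. cmod (\<psi> n) \<le> C * exp (- c * \<bar>real_of_int n\<bar>)"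
    using \<psi>(1) by (auto simp: localized_def exponentially_decaying_def)
  have "cmod (\<phi> n) \<le> ((cmod a + 1) * C) * exp (- c * \<bar>real_of_int n\<bar>)" for n
  proof -
    have "cmod (\<phi> n) \<le> (cmod a + 1) * cmod (\<psi> n)" by (simp add: a norm_mult mult_right_mono)
    also have "\<dots> \<le> (cmod a + 1) * (C * exp (- c * \<bar>real_of_int n\<bar>))" by (intro mult_left_mono C) auto
    finally show ?thesis by simp
  qed
  moreover have "0 < (cmod a + 1) * C" using C(1) by (simp add: add_nonneg_pos)
  ultimately show ?thesis unfolding exponentially_decaying_def using C(2) by blast
qed

lemma complete_potential: "complete (UNIV :: potential set)"
  unfolding complete_def
proof (intro allI impI)
  fix f :: "nat \<Rightarrow> potential"
  assume "(\<forall>n. f n \<in> UNIV) \<and> Cauchy f"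
  then have f: "Cauchy f" by simp
  have "uniformly_Cauchy_on UNIV (\<lambda>n. apply_bcontfun (f n))"
    using f unfolding uniformly_Cauchy_on_def Cauchy_def by (meson dist_fun_lt_imp_dist_val_lt)
  then have "uniformly_convergent_on UNIV (\<lambda>n. apply_bcontfun (f n))" by (rule Cauchy_uniformly_convergent)
  then obtain g where g: "uniform_limit UNIV f g sequentially" unfolding uniformly_convergent_on_def by blast
  show "\<exists>l\<in>UNIV. f \<longlonglongrightarrow> l" by (rule uniform_limit_bcontfunE[OF g]) auto
qed

theorem theorem1p1:
  shows "generic (\<lambda>V :: potential.
           pure_point_spectrum V \<and> (\<forall>\<phi>. eigenvector V \<phi> \<longrightarrow> exponentially_decaying \<phi>))"
proof -
  \<comment> \<open>Openness is built in by taking balls, since \<open>near_basis\<close> is known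
    to hold on whole balls but is not shown to be an open condition.\<close>
  define U where "U m k = \<Union>{ball V1 r | V1 r. \<forall>W\<in>ball V1 r. near_basis W m (1 / real (Suc k))}" for m k
  have U_open: "open (U m k)" for m k unfolding U_def by (intro open_Union) auto
  have U_dense: "closure (U m k) = UNIV" for m k
  proof -
    have "V \<in> closure (U m k)" for V
      unfolding closure_approachable
    proof (intro allI impI)
      fix \<epsilon> :: real assume "0 < \<epsilon>"
      then have "0 < \<epsilon> / 2" by simp
      from near_basis_dense[OF this, of "1 / real (Suc k)" V m]
      obtain V1 r where V1: "0 < r" "dist V1 V \<le> \<epsilon> / 2" "\<forall>W\<in>ball V1 r. near_basis W m (1 / real (Suc k))" by auto
      then have "V1 \<in> U m k" unfolding U_def by (auto intro!: exI[of _ "ball V1 r"])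
      then show "\<exists>y\<in>U m k. dist y V < \<epsilon>" using V1(2) \<open>0 < \<epsilon>\<close> by (intro bexI[of _ V1]) auto
    qed
    then show ?thesis by auto
  qed
  have U_near: "near_basis V m (1 / real (Suc k))" if "V \<in> U m k" for V m k
    using that unfolding U_def by blast
  define B where "B i = (case from_nat i of (m, k) \<Rightarrow> U m k)" for i :: nat
  define G where "G = (\<Inter>i. B i)"
  have B: "open (B i)" "closure (B i) = UNIV" for i
    using U_open U_dense by (simp_all add: B_def split: prod.split)
  have "gdelta G" unfolding G_def by (rule gdelta.intros) (rule B)
  moreover have "closure G = UNIV"
  proof -
    have "Met_TC.mtopology closure_of (\<Inter>(range B)) = (UNIV :: potential set)"
    proof (rule Met_TC.metric_Baire_category)
      show "Met_TC.mcomplete TYPE(potential)"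
        using complete_potential by simp
    qed (auto simp: B)
    then show ?thesis by (simp add: G_def)
  qed
  moreover have "pure_point_spectrum V \<and> (\<forall>\<phi>. eigenvector V \<phi> \<longrightarrow> exponentially_decaying \<phi>)" if V: "V \<in> G" for V
  proof -
    have nb: "near_basis V m \<delta>" if \<delta>: "0 < \<delta>" for m \<delta>
    proof -
      obtain k where k: "1 / real (Suc k) < \<delta>" using nat_approx_posE[OF \<delta>] by blast
      have "V \<in> B (to_nat (m, k))" using V by (auto simp: G_def)
      then have "near_basis V m (1 / real (Suc k))" by (intro U_near) (simp add: B_def)
      then obtain F c where "finite F" "\<forall>\<psi>\<in>F. localized V \<psi>"
        "ell2_norm (\<lambda>n. (if n = m then 1 else 0) - (\<Sum>\<psi>\<in>F. c \<psi> * \<psi> n)) < 1 / real (Suc k)"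
        unfolding near_basis_def by blast
      moreover note less_trans[OF this(3) k]
      ultimately show ?thesis unfolding near_basis_def by blast
    qed
    show ?thesis
      by (intro conjI allI impI pure_point_of_near_basis decay_of_near_basis[of V])
        (erule nb, erule nb, assumption)
  qed
  ultimately show ?thesis unfolding generic_def by (intro exI[of _ G]) simp
qed

end
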